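(* If $\mathrm{HC}(\kappa)$ fails for some regular cardinal $\kappa$, then $\mathrm{HC}(\lambda)$ fails for every cardinal $\lambda$ with $\mathrm{cf}(\lambda)=\kappa$.
   Context: A ray is a one-way infinite path. Two rays in a graph $G$ are equivalent if there are infinitely many pairwise vertex-disjoint paths between them in $G$; an end of $G$ is an equivalence class of rays. The degree of an end $\varepsilon$ is the maximum cardinality of a set of pairwise disjoint rays in $\varepsilon$. Given a set $\mathcal{R}$ of pairwise disjoint equivalent rays in $G$, an $\mathcal{R}$-path is a path meeting $\bigcup\mathcal{R}$ exactly in its two endvertices; a set of paths is independent if no inner vertex of one of them lies on another. A graph $H$ with vertex set $\mathcal{R}$ is a ray graph in $G$ if there is a set $\mathcal{P}$ of independent $\mathcal{R}$-paths in $G$ such that for each edge $RS$ of $H$ there are infinitely many disjoint $R$--$S$ paths in $\mathcal{P}$. $\mathrm{HC}(\kappa)$ is the statement: for every graph $G$ and every end $\varepsilon$ of $G$ of degree $\kappa$, there is a set $\mathcal{R}\subseteq\varepsilon$ of $\kappa$ pairwise disjoint rays admitting a connected ray graph in $G$ with vertex set $\mathcal{R}$. *)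

theory Defs
  imports Main
begin

unbundle cardinal_syntax

text \<open>Simple undirected graphs: vertex set V and a symmetric irreflexive
  adjacency relation E on V (possibly infinite).\<close>

definition graph :: "'a set \<Rightarrow> ('a \<times> 'a) set \<Rightarrow> bool" where
  "graph V E \<longleftrightarrow> E \<subseteq> V \<times> V \<and> sym E \<and> (\<forall>v. (v, v) \<notin> E)"

text \<open>A ray: a one-way infinite path v0 v1 v2 ... of distinct vertices.\<close>
definition is_ray :: "'a set \<Rightarrow> ('a \<times> 'a) set \<Rightarrow> (nat \<Rightarrow> 'a) \<Rightarrow> bool" where
  "is_ray V E R \<longleftrightarrow> inj R \<and> range R \<subseteq> V \<and> (\<forall>n. (R n, R (Suc n)) \<in> E)"

text \<open>A (finite) path, given as the nonempty list of its distinct vertices.\<close>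
definition is_path :: "'a set \<Rightarrow> ('a \<times> 'a) set \<Rightarrow> 'a list \<Rightarrow> bool" where
  "is_path V E p \<longleftrightarrow> p \<noteq> [] \<and> distinct p \<and> set p \<subseteq> V \<and>
     (\<forall>i. Suc i < length p \<longrightarrow> (p ! i, p ! Suc i) \<in> E)"

text \<open>An A--B path: meets A exactly in its first and B exactly in its last vertex.\<close>
definition AB_path :: "'a set \<Rightarrow> ('a \<times> 'a) set \<Rightarrow> 'a set \<Rightarrow> 'a set \<Rightarrow> 'a list \<Rightarrow> bool" where
  "AB_path V E A B p \<longleftrightarrow> is_path V E p \<and> set p \<inter> A = {hd p} \<and> set p \<inter> B = {last p}"

definition disjoint_paths :: "'a list set \<Rightarrow> bool" where
  "disjoint_paths P \<longleftrightarrow> (\<forall>p\<in>P. \<forall>q\<in>P. p \<noteq> q \<longrightarrow> set p \<inter> set q = {})"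

text \<open>Two rays are equivalent if there are infinitely many pairwise
  vertex-disjoint paths between them.\<close>
definition equiv_rays :: "'a set \<Rightarrow> ('a \<times> 'a) set \<Rightarrow> (nat \<Rightarrow> 'a) \<Rightarrow> (nat \<Rightarrow> 'a) \<Rightarrow> bool" where
  "equiv_rays V E R S \<longleftrightarrow> (\<exists>P. infinite P \<and> disjoint_paths P \<and>
       (\<forall>p\<in>P. AB_path V E (range R) (range S) p))"

text \<open>An end is an equivalence class of rays.\<close>
definition is_end :: "'a set \<Rightarrow> ('a \<times> 'a) set \<Rightarrow> (nat \<Rightarrow> 'a) set \<Rightarrow> bool" where
  "is_end V E \<epsilon> \<longleftrightarrow> (\<exists>R. is_ray V E R \<and> \<epsilon> = {S. is_ray V E S \<and> equiv_rays V E R S})"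

definition disjoint_rays :: "(nat \<Rightarrow> 'a) set \<Rightarrow> bool" where
  "disjoint_rays \<R> \<longleftrightarrow> (\<forall>R\<in>\<R>. \<forall>S\<in>\<R>. R \<noteq> S \<longrightarrow> range R \<inter> range S = {})"

text \<open>The end has degree \<kappa> (a cardinal given as a cardinal order relation):
  \<kappa> is the maximum cardinality of a set of pairwise disjoint rays in the end.\<close>
definition end_degree :: "'a set \<Rightarrow> ('a \<times> 'a) set \<Rightarrow> (nat \<Rightarrow> 'a) set \<Rightarrow> 'k rel \<Rightarrow> bool" where
  "end_degree V E \<epsilon> \<kappa> \<longleftrightarrow>
     (\<exists>\<R>. \<R> \<subseteq> \<epsilon> \<and> disjoint_rays \<R> \<and> |\<R>| =o \<kappa>) \<and>
     (\<forall>\<R>. \<R> \<subseteq> \<epsilon> \<and> disjoint_rays \<R> \<longrightarrow> |\<R>| \<le>o \<kappa>)"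

text \<open>Inner vertices of a path.\<close>
definition inner :: "'a list \<Rightarrow> 'a set" where
  "inner p = set (butlast (tl p))"

text \<open>An \<R>-path: meets the union of the rays in \<R> exactly in its two endvertices.\<close>
definition Rpath :: "'a set \<Rightarrow> ('a \<times> 'a) set \<Rightarrow> (nat \<Rightarrow> 'a) set \<Rightarrow> 'a list \<Rightarrow> bool" where
  "Rpath V E \<R> p \<longleftrightarrow> is_path V E p \<and> length p \<ge> 2 \<and>
     hd p \<in> (\<Union>R\<in>\<R>. range R) \<and> last p \<in> (\<Union>R\<in>\<R>. range R) \<and>
     inner p \<inter> (\<Union>R\<in>\<R>. range R) = {}"

definition independent_paths :: "'a list set \<Rightarrow> bool" where
  "independent_paths P \<longleftrightarrow> (\<forall>p\<in>P. \<forall>q\<in>P. p \<noteq> q \<longrightarrow> inner p \<inter> set q = {})"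

text \<open>An R--S path (in either orientation of the list).\<close>
definition RS_path :: "'a set \<Rightarrow> ('a \<times> 'a) set \<Rightarrow> (nat \<Rightarrow> 'a) \<Rightarrow> (nat \<Rightarrow> 'a) \<Rightarrow> 'a list \<Rightarrow> bool" where
  "RS_path V E R S p \<longleftrightarrow> AB_path V E (range R) (range S) p \<or> AB_path V E (range R) (range S) (rev p)"

text \<open>H (a set of edges on vertex set \<R>) is a ray graph in G.\<close>
definition is_ray_graph :: "'a set \<Rightarrow> ('a \<times> 'a) set \<Rightarrow> (nat \<Rightarrow> 'a) set \<Rightarrow> ((nat \<Rightarrow> 'a) \<times> (nat \<Rightarrow> 'a)) set \<Rightarrow> bool" where
  "is_ray_graph V E \<R> H \<longleftrightarrow> graph \<R> H \<and>
     (\<exists>\<P>. (\<forall>p\<in>\<P>. Rpath V E \<R> p) \<and> independent_paths \<P> \<and>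
        (\<forall>(R, S)\<in>H. \<exists>Q. Q \<subseteq> \<P> \<and> infinite Q \<and> disjoint_paths Q \<and> (\<forall>p\<in>Q. RS_path V E R S p)))"

definition connected_graph :: "'b set \<Rightarrow> ('b \<times> 'b) set \<Rightarrow> bool" where
  "connected_graph V H \<longleftrightarrow> V \<noteq> {} \<and> (\<forall>x\<in>V. \<forall>y\<in>V. (x, y) \<in> H\<^sup>*)"

text \<open>G = (V,E) with end \<epsilon> of degree \<kappa> is a counterexample to HC(\<kappa>).\<close>
definition HC_counterexample :: "'a set \<Rightarrow> ('a \<times> 'a) set \<Rightarrow> (nat \<Rightarrow> 'a) set \<Rightarrow> 'k rel \<Rightarrow> bool" where
  "HC_counterexample V E \<epsilon> \<kappa> \<longleftrightarrow> graph V E \<and> is_end V E \<epsilon> \<and> end_degree V E \<epsilon> \<kappa> \<and>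
     \<not> (\<exists>\<R> H. \<R> \<subseteq> \<epsilon> \<and> disjoint_rays \<R> \<and> |\<R>| =o \<kappa> \<and>
            is_ray_graph V E \<R> H \<and> connected_graph \<R> H)"

text \<open>cf(|L|) = |K|: least cardinality of a cofinal subset of the initial
  well-order |L| (library notion \<open>cofinal\<close>).\<close>
definition cf_eq :: "'l set \<Rightarrow> 'k set \<Rightarrow> bool" where
  "cf_eq L K \<longleftrightarrow> (\<exists>A. A \<subseteq> L \<and> cofinal A (card_of L) \<and> card_of A =o card_of K) \<and>
                  (\<forall>A. A \<subseteq> L \<and> cofinal A (card_of L) \<longrightarrow> card_of K \<le>o card_of A)"

end

theory Submission
  imports Defs "HOL-Library.Countable_Set_Type"
begin

text \<open>
  If \<open>\<kappa>\<close> is countable, the hypothesis is void, because HC holds for \<open>\<aleph>\<^sub>0\<close> (Halin).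

  Let \<open>\<kappa>\<close> be uncountable and let \<open>G\<close> be a counterexample; passing to a subgraph we may assume
  \<open>|G| = \<kappa>\<close>. Fix disjoint rays \<open>R\<^sub>k\<close>, \<open>k < \<kappa>\<close>, in the end, split \<open>\<lambda>\<close> into \<open>\<kappa>\<close> pieces such that fewer
  than \<open>\<kappa>\<close> of them never have union of size \<open>\<lambda>\<close>, and for every index \<open>l\<close> in the \<open>k\<close>-th piece attach a
  new ray \<open>T\<^sub>l\<close> to \<open>R\<^sub>k\<close> by the rungs of a ladder. The resulting end has degree \<open>\<lambda>\<close>.

  Suppose it had a connected ray graph of size \<open>\<lambda>\<close>. Identify all its new rays that hang on the same
  \<open>R\<^sub>k\<close>. The quotient is connected and has at least \<open>\<kappa>\<close> nodes, so by regularity it has a node of degree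
  \<open>\<kappa>\<close>. Since \<open>R\<^sub>k\<close> is countable and separates its new rays from the rest, \<open>\<kappa>\<close> of the neighbouring rays,
  with their paths to the centre, can be projected to \<open>G\<close>. This gives \<open>\<kappa>\<close> disjoint rays in the end of
  \<open>G\<close>, each joined to one countable set by infinitely many disjoint paths. The vertices of that set used
  by uncountably many of the rays dominate the end, hence lie on one ray, which is the centre of a
  star-shaped ray graph of size \<open>\<kappa>\<close> in \<open>G\<close>: a contradiction.
\<close>

section \<open>Reachability and systems of disjoint paths\<close>

text \<open>Infinitely many disjoint paths are treated throughout as inseparability by finite vertex
  sets (\<open>linked\<close>): connections avoiding one finite set can be concatenated and
  projected, whole path systems cannot. Two obstacles shape the way back to \<open>G\<close>. A walk
  through a new ray may project onto vertices of \<open>R k\<close> that it avoided upstairs, and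
  disjoint territories upstairs may lie over the same vertices, since many new rays share one
  \<open>R k\<close>. The first is met by shifting the projection past the finite set to be avoided,
  the second by showing that each vertex is covered by only countably many of the selected
  territories, so that a disjoint subfamily of full size exists. The centre of the star is not
  transferred as a ray: it may stand for all new rays on one \<open>R k\<close>. Only a countable
  set below it survives, and a new central ray is constructed from vertices of that set. The bound
  on \<open>|G|\<close> caps the degree of the new end, since disjoint rays never outnumber
  vertices. In the countable case rays are added one at a time, and the difficulty is to keep an
  infinite supply of rays untouched.\<close>

definition conn :: "('a \<times> 'a) set \<Rightarrow> 'a set \<Rightarrow> 'a \<Rightarrow> 'a \<Rightarrow> bool" where
  "conn E W x y \<longleftrightarrow> x \<in> W \<and> (x, y) \<in> (E \<inter> W \<times> W)\<^sup>*"

lemma conn_refl: "x \<in> W \<Longrightarrow> conn E W x x"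
  by (simp add: conn_def)

lemma conn_mem: assumes "conn E W x y" shows "x \<in> W" "y \<in> W"
proof -
  show x: "x \<in> W" using assms by (simp add: conn_def)
  have "(x, y) \<in> (E \<inter> W \<times> W)\<^sup>*" using assms by (simp add: conn_def)
  then show "y \<in> W" using x by (induction rule: rtrancl_induct) auto
qed

lemma conn_trans: "conn E W x y \<Longrightarrow> conn E W y z \<Longrightarrow> conn E W x z"
  by (auto simp: conn_def)

lemma conn_edge: "x \<in> W \<Longrightarrow> y \<in> W \<Longrightarrow> (x, y) \<in> E \<Longrightarrow> conn E W x y"
  by (auto simp: conn_def)

lemma conn_mono:
  assumes "conn E W x y" "E \<subseteq> E'" "W \<subseteq> W'" shows "conn E' W' x y"
proof -
  have "E \<inter> W \<times> W \<subseteq> E' \<inter> W' \<times> W'" using assms by auto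
  then have "(E \<inter> W \<times> W)\<^sup>* \<subseteq> (E' \<inter> W' \<times> W')\<^sup>*" by (rule rtrancl_mono)
  then show ?thesis using assms by (auto simp: conn_def)
qed

lemma conn_sym: assumes "sym E" "conn E W x y" shows "conn E W y x"
proof -
  have s: "sym (E \<inter> W \<times> W)" using assms(1) by (auto simp: sym_def)
  have "(x, y) \<in> (E \<inter> W \<times> W)\<^sup>*" using assms(2) by (simp add: conn_def)
  then have "(y, x) \<in> (E \<inter> W \<times> W)\<^sup>*" by (rule symD[OF sym_rtrancl[OF s]])
  then show ?thesis using conn_mem[OF assms(2)] by (simp add: conn_def)
qed

text \<open>A walk inside \<open>W\<close> cannot leave \<open>A\<close> if no edge inside
  \<open>W\<close> does. This is used to trap walks in a single new ray.\<close>

lemma conn_closed: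
  assumes "conn E W x y" "x \<in> A" "\<And>u v. (u, v) \<in> E \<Longrightarrow> u \<in> A \<inter> W \<Longrightarrow> v \<in> W \<Longrightarrow> v \<in> A"
  shows "conn E (W \<inter> A) x y"
proof -
  have x: "x \<in> W" and r: "(x, y) \<in> (E \<inter> W \<times> W)\<^sup>*" using assms(1) by (auto simp: conn_def)
  from r show ?thesis
  proof (induction rule: rtrancl_induct)
    case base then show ?case using x assms(2) by (auto intro: conn_refl)
  next
    case (step y z)
    then have "y \<in> W \<inter> A" by (auto dest: conn_mem)
    then have "z \<in> W \<inter> A" using step(2) assms(3)[of y z] by auto
    then show ?case using step \<open>y \<in> W \<inter> A\<close> by (blast intro: conn_trans conn_edge)
  qed
qed

text \<open>An edge only has to become a connection, so the map may collapse edges, as the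
  projection later does with rungs.\<close>

lemma conn_map:
  assumes "conn E W x y"
    and "\<And>u v. u \<in> W \<Longrightarrow> v \<in> W \<Longrightarrow> (u, v) \<in> E \<Longrightarrow> conn E' W' (f u) (f v)"
    and "f x \<in> W'"
  shows "conn E' W' (f x) (f y)"
proof -
  have "(x, y) \<in> (E \<inter> W \<times> W)\<^sup>*" using assms(1) by (simp add: conn_def)
  then show ?thesis
    by (induction rule: rtrancl_induct) (use assms in \<open>auto intro: conn_refl conn_trans\<close>)
qed

section \<open>Finite paths and their relation to connectedness\<close>

lemma is_path_take: "is_path V E p \<Longrightarrow> 0 < n \<Longrightarrow> is_path V E (take n p)"
  unfolding is_path_def using set_take_subset[of n p] by auto

lemma is_path_drop: "is_path V E p \<Longrightarrow> n < length p \<Longrightarrow> is_path V E (drop n p)"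
  unfolding is_path_def using set_drop_subset[of n p] by auto

lemma is_path_append:
  assumes "is_path V E p" "is_path V E q" "set p \<inter> set q = {}" "(last p, hd q) \<in> E"
  shows "is_path V E (p @ q)"
  unfolding is_path_def
proof (intro conjI allI impI)
  fix i assume i: "Suc i < length (p @ q)"
  consider "Suc i < length p" | "Suc i = length p" | "i \<ge> length p" by linarith
  then show "((p @ q) ! i, (p @ q) ! Suc i) \<in> E"
  proof cases
    case 1 then show ?thesis using assms(1) by (simp add: is_path_def nth_append)
  next
    case 2
    then have "(p @ q) ! i = last p" using assms(1)
      by (simp add: is_path_def nth_append last_conv_nth flip: 2)
    moreover have "(p @ q) ! Suc i = hd q" using 2 assms(2)
      by (simp add: is_path_def nth_append hd_conv_nth)
    ultimately show ?thesis using assms(4) by simp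
  next
    case 3
    then have "Suc (i - length p) < length q" using i by auto
    then have "(q ! (i - length p), q ! Suc (i - length p)) \<in> E" using assms(2) by (simp add: is_path_def)
    then show ?thesis using 3 by (simp add: nth_append Suc_diff_le)
  qed
qed (use assms in \<open>auto simp: is_path_def\<close>)

lemma is_path_join:
  assumes "is_path V E p" "is_path V E q" "set p \<inter> set q = {hd q}" "last p = hd q"
  shows "is_path V E (p @ tl q)" "set (p @ tl q) = set p \<union> set q" "last (p @ tl q) = last q"
proof -
  have ne: "p \<noteq> []" "q \<noteq> []" using assms(1,2) by (auto simp: is_path_def)
  then obtain x r where q: "q = x # r" by (cases q) auto
  have x: "x \<in> set p" using ne assms(4) q last_in_set[of p] by simp
  then show "set (p @ tl q) = set p \<union> set q" using q by auto
  show "last (p @ tl q) = last q" using q assms(4) by simp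
  show "is_path V E (p @ tl q)"
  proof (cases "r = []")
    case True then show ?thesis using assms(1) q by simp
  next
    case False
    have "is_path V E (drop 1 q)" using False q by (intro is_path_drop[OF assms(2)]) simp
    then have r: "is_path V E r" using q by simp
    have "(x, hd r) \<in> E" using assms(2) q False unfolding is_path_def
      by (metis One_nat_def Suc_less_eq hd_conv_nth length_Cons length_greater_0_conv nth_Cons_0 nth_Cons_Suc)
    moreover have "set p \<inter> set r = {}" using assms(2,3) q by (auto simp: is_path_def)
    ultimately show ?thesis using is_path_append[OF assms(1) r] assms(4) q by simp
  qed
qed

lemma is_path_ray_segment:
  assumes "is_ray V E R" "i < j" shows "is_path V E (map R [i..<j])"
  using assms by (auto simp: is_path_def is_ray_def distinct_map inj_on_def)

lemma is_path_single: "v \<in> V \<Longrightarrow> is_path V E [v]"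
  by (simp add: is_path_def)

lemma is_path_rev: assumes "sym E" "is_path V E p" shows "is_path V E (rev p)"
  unfolding is_path_def
proof (intro conjI allI impI)
  fix i assume i: "Suc i < length (rev p)"
  let ?j = "length p - Suc (Suc i)"
  have "(p ! ?j, p ! Suc ?j) \<in> E" using assms(2) i by (auto simp: is_path_def)
  then show "(rev p ! i, rev p ! Suc i) \<in> E" using i assms(1)
    by (simp add: rev_nth Suc_diff_Suc sym_def)
qed (use assms in \<open>auto simp: is_path_def\<close>)

lemma conn_path_nth:
  assumes "sym E" "is_path V E p" "set p \<subseteq> W" "i < length p" "j < length p"
  shows "conn E W (p ! i) (p ! j)"
proof -
  have *: "conn E W (p ! 0) (p ! k)" if "k < length p" for k
    using that
  proof (induction k)
    case 0 then show ?case using assms(3) by (auto intro!: conn_refl)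
  next
    case (Suc k)
    then show ?case using assms(2,3)
      by (meson Suc_lessD conn_edge conn_trans is_path_def nth_mem subsetD)
  qed
  show ?thesis using conn_trans[OF conn_sym[OF assms(1) *[OF assms(4)]] *[OF assms(5)]] .
qed

lemma conn_path:
  assumes "sym E" "is_path V E p" "set p \<subseteq> W" "x \<in> set p" "y \<in> set p"
  shows "conn E W x y"
  using conn_path_nth[OF assms(1-3)] assms(4,5) by (auto simp: in_set_conv_nth)

lemma conn_ray:
  assumes "sym E" "is_ray V E R" "\<And>n. n \<ge> N \<Longrightarrow> R n \<in> W" "a \<ge> N" "b \<ge> N"
  shows "conn E W (R a) (R b)"
proof -
  have *: "conn E W (R N) (R (N + k))" for k
  proof (induction k)
    case 0 then show ?case using assms(3) by (auto intro!: conn_refl)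
  next
    case (Suc k)
    have "(R (N + k), R (Suc (N + k))) \<in> E" using assms(2) by (simp add: is_ray_def)
    then have "conn E W (R (N + k)) (R (N + Suc k))" using assms(3) by (intro conn_edge) auto
    then show ?case using Suc conn_trans by metis
  qed
  have 1: "conn E W (R N) (R a)" and 2: "conn E W (R N) (R b)"
    using *[of "a - N"] *[of "b - N"] assms(4,5) by simp_all
  show ?thesis by (rule conn_trans[OF conn_sym[OF assms(1) 1] 2])
qed

lemma conn_imp_path:
  assumes "conn E W a b" "W \<subseteq> V"
  shows "\<exists>p. is_path V E p \<and> set p \<subseteq> W \<and> hd p = a \<and> last p = b"
proof -
  have a: "a \<in> W" and r: "(a, b) \<in> (E \<inter> W \<times> W)\<^sup>*" using assms(1) by (auto simp: conn_def)
  from r show ?thesis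
  proof (induction rule: rtrancl_induct)
    case base
    have "is_path V E [a]" using a assms(2) by (auto simp: is_path_def)
    then show ?case using a by (intro exI[of _ "[a]"]) auto
  next
    case (step y z)
    then obtain p where p: "is_path V E p" "set p \<subseteq> W" "hd p = a" "last p = y" by auto
    have yz: "(y, z) \<in> E" "z \<in> W" using step by auto
    have ne: "p \<noteq> []" using p by (auto simp: is_path_def)
    show ?case
    proof (cases "z \<in> set p")
      case False
      then have "is_path V E (p @ [z])" using p yz assms(2)
        by (intro is_path_append is_path_single) auto
      then show ?thesis using p yz ne by (intro exI[of _ "p @ [z]"]) auto
    next
      case True
      then obtain i where i: "i < length p" "p ! i = z" by (metis in_set_conv_nth)
      have "is_path V E (take (Suc i) p)" using p by (intro is_path_take) auto
      moreover have "last (take (Suc i) p) = z" using i by (simp add: take_Suc_conv_app_nth)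
      moreover have "hd (take (Suc i) p) = a" using p by simp
      moreover have "set (take (Suc i) p) \<subseteq> W" using p(2) set_take_subset[of "Suc i" p] by blast
      ultimately show ?thesis by blast
    qed
  qed
qed

text \<open>A shortest path from \<open>A\<close> to \<open>B\<close> inside \<open>W\<close> meets
  both sets only at its ends: a further vertex of \<open>A\<close> or \<open>B\<close> on it would
  give a shorter final or initial segment.\<close>

lemma conn_AB_path:
  assumes "conn E W a b" "W \<subseteq> V" "a \<in> A" "b \<in> B"
  shows "\<exists>p. AB_path V E A B p \<and> set p \<subseteq> W"
proof -
  let ?P = "\<lambda>p. is_path V E p \<and> set p \<subseteq> W \<and> hd p \<in> A \<and> last p \<in> B"
  have "\<exists>p. ?P p" using conn_imp_path[OF assms(1,2)] assms(3,4) by metis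
  then obtain p where p: "?P p" and min: "\<And>q. ?P q \<Longrightarrow> length p \<le> length q"
    using ex_has_least_nat[of ?P _ length] by metis
  have ne: "p \<noteq> []" using p by (auto simp: is_path_def)
  have "x = hd p" if x: "x \<in> set p" "x \<in> A" for x
  proof -
    obtain i where i: "i < length p" "p ! i = x" using x by (metis in_set_conv_nth)
    have "?P (drop i p)"
      using p i x set_drop_subset[of i p] is_path_drop[of V E p i] by (auto simp: hd_drop_conv_nth)
    from min[OF this] have "i = 0" using i by auto
    then show ?thesis using i ne by (simp add: hd_conv_nth)
  qed
  moreover have "x = last p" if x: "x \<in> set p" "x \<in> B" for x
  proof -
    obtain i where i: "i < length p" "p ! i = x" using x by (metis in_set_conv_nth)
    have "?P (take (Suc i) p)"
      using p i x ne set_take_subset[of "Suc i" p] is_path_take[of V E p "Suc i"]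
      by (auto simp: take_Suc_conv_app_nth hd_append hd_conv_nth)
    from min[OF this] have "Suc i = length p" using i by auto
    then show ?thesis using i ne by (metis diff_Suc_1 last_conv_nth)
  qed
  ultimately show ?thesis using p ne unfolding AB_path_def by (intro exI[of _ p]) auto
qed

lemma AB_path_conn:
  assumes "sym E" "AB_path V E A B p" "set p \<subseteq> W"
  shows "conn E W (hd p) (last p)" "hd p \<in> A" "last p \<in> B"
proof -
  have p: "is_path V E p" "p \<noteq> []" "set p \<inter> A = {hd p}" "set p \<inter> B = {last p}"
    using assms(2) by (auto simp: AB_path_def is_path_def)
  show "conn E W (hd p) (last p)" using p by (intro conn_path[OF assms(1) p(1) assms(3)]) auto
  show "hd p \<in> A" "last p \<in> B" using p by auto
qed

lemma AB_path_rev: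
  assumes "sym E" "AB_path V E A B p" shows "AB_path V E B A (rev p)"
  using assms(2) is_path_rev[OF assms(1), of V p] by (simp add: AB_path_def hd_rev last_rev)

section \<open>Disjoint path systems and inseparability by finite sets\<close>

text \<open>The source \<open>Q t\<close> may vary with the step, so that a schedule in which every
  index recurs yields many infinite families that are disjoint even from each other. The state
  carries the finite set of vertices used so far.\<close>

lemma greedy_sequence:
  assumes "\<And>t X. finite X \<Longrightarrow> \<exists>p\<in>Q t. p \<noteq> [] \<and> set p \<inter> X = {}"
  shows "\<exists>f :: nat \<Rightarrow> 'a list. (\<forall>t. f t \<in> Q t \<and> f t \<noteq> []) \<and> (\<forall>s t. s \<noteq> t \<longrightarrow> set (f s) \<inter> set (f t) = {})"
proof -
  have "\<exists>g. \<forall>t. (fst (g t) \<in> Q t \<and> fst (g t) \<noteq> [] \<and> finite (snd (g t)) \<and> set (fst (g t)) \<subseteq> snd (g t)) \<and>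
      (snd (g t) \<subseteq> snd (g (Suc t)) \<and> set (fst (g (Suc t))) \<inter> snd (g t) = {})"
  proof (rule dependent_nat_choice)
    obtain p where "p \<in> Q 0" "p \<noteq> []" using assms[of "{}" 0] by auto
    then show "\<exists>x. fst x \<in> Q 0 \<and> fst x \<noteq> [] \<and> finite (snd x) \<and> set (fst x) \<subseteq> snd x"
      by (intro exI[of _ "(p, set p)"]) auto
  next
    fix x :: "'a list \<times> 'a set" and n
    assume "fst x \<in> Q n \<and> fst x \<noteq> [] \<and> finite (snd x) \<and> set (fst x) \<subseteq> snd x"
    moreover then obtain p where "p \<in> Q (Suc n)" "p \<noteq> []" "set p \<inter> snd x = {}" using assms[of "snd x" "Suc n"] by auto
    ultimately show "\<exists>y. (fst y \<in> Q (Suc n) \<and> fst y \<noteq> [] \<and> finite (snd y) \<and> set (fst y) \<subseteq> snd y) \<and>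
            snd x \<subseteq> snd y \<and> set (fst y) \<inter> snd x = {}"
      by (intro exI[of _ "(p, snd x \<union> set p)"]) auto
  qed
  then obtain g where g: "\<And>t. fst (g t) \<in> Q t" "\<And>t. fst (g t) \<noteq> []" "\<And>t. set (fst (g t)) \<subseteq> snd (g t)"
     "\<And>t. snd (g t) \<subseteq> snd (g (Suc t))" "\<And>t. set (fst (g (Suc t))) \<inter> snd (g t) = {}" by blast
  have mono: "snd (g s) \<subseteq> snd (g t)" if "s \<le> t" for s t
    using lift_Suc_mono_le[of "\<lambda>t. snd (g t)", OF g(4) that] .
  have lt: "set (fst (g s)) \<inter> set (fst (g t)) = {}" if st: "s < t" for s t
  proof -
    obtain u where u: "t = Suc u" "s \<le> u" using less_imp_Suc_add[OF st] by auto
    have "set (fst (g s)) \<subseteq> snd (g u)" using g(3)[of s] mono[OF u(2)] by blast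
    then show ?thesis using g(5)[of u] u(1) by blast
  qed
  have "set (fst (g s)) \<inter> set (fst (g t)) = {}" if "s \<noteq> t" for s t
    using that lt[of s t] lt[of t s] by (cases "s < t") (auto simp: Int_commute)
  then show ?thesis using g(1,2) by (intro exI[of _ "\<lambda>t. fst (g t)"]) auto
qed

lemma inj_disjoint_sequence:
  fixes f :: "nat \<Rightarrow> 'a list"
  assumes "\<forall>t. f t \<noteq> []" "\<forall>s t. s \<noteq> t \<longrightarrow> set (f s) \<inter> set (f t) = {}"
  shows "inj f"
proof (rule injI)
  fix s t assume eq: "f s = f t"
  show "s = t"
  proof (rule ccontr)
    assume "s \<noteq> t"
    then have "set (f s) \<inter> set (f t) = {}" using assms(2) by blast
    then show False using eq assms(1) by (metis inf.idem set_empty)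
  qed
qed

lemma greedy_disjoint_paths:
  assumes "\<And>X. finite X \<Longrightarrow> \<exists>p\<in>Q. p \<noteq> [] \<and> set p \<inter> X = {}"
  shows "\<exists>P\<subseteq>Q. infinite P \<and> disjoint_paths P"
proof -
  obtain f :: "nat \<Rightarrow> 'a list" where f: "\<forall>t. f t \<in> Q \<and> f t \<noteq> []" "\<forall>s t. s \<noteq> t \<longrightarrow> set (f s) \<inter> set (f t) = {}"
    using greedy_sequence[of "\<lambda>_. Q"] assms by blast
  have "inj f" using f inj_disjoint_sequence by blast
  then have "infinite (range f)" using finite_imageD by blast
  moreover have "disjoint_paths (range f)" using f(2) unfolding disjoint_paths_def by (metis imageE)
  ultimately show ?thesis using f(1) by blast
qed

lemma disjoint_paths_finite_meet:
  assumes "disjoint_paths P" "finite X"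
  shows "finite {p \<in> P. set p \<inter> X \<noteq> {}}"
proof -
  have "\<forall>p\<in>{p \<in> P. set p \<inter> X \<noteq> {}}. \<exists>x. x \<in> set p \<inter> X" by blast
  from bchoice[OF this] obtain f where f: "\<forall>p\<in>{p \<in> P. set p \<inter> X \<noteq> {}}. f p \<in> set p \<inter> X" ..
  have "inj_on f {p \<in> P. set p \<inter> X \<noteq> {}}"
  proof (rule inj_onI, rule ccontr)
    fix p q assume pq: "p \<in> {p \<in> P. set p \<inter> X \<noteq> {}}" "q \<in> {p \<in> P. set p \<inter> X \<noteq> {}}" "f p = f q" "p \<noteq> q"
    then have "set p \<inter> set q = {}" using assms(1) by (simp add: disjoint_paths_def)
    then show False using bspec[OF f pq(1)] bspec[OF f pq(2)] pq(3) by auto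
  qed
  moreover have "f ` {p \<in> P. set p \<inter> X \<noteq> {}} \<subseteq> X" using f by blast
  ultimately show ?thesis using assms(2) by (rule inj_on_finite)
qed

lemma disjoint_paths_escape:
  assumes "infinite P" "disjoint_paths P" "finite X"
  shows "\<exists>p\<in>P. set p \<inter> X = {}"
proof (rule ccontr)
  assume "\<not> ?thesis"
  then have "{p \<in> P. set p \<inter> X \<noteq> {}} = P" by auto
  then show False using disjoint_paths_finite_meet[OF assms(2,3)] assms(1) by auto
qed

text \<open>Inseparability by finite sets within \<open>W\<close>, the working substitute for an
  infinite system of disjoint paths; \<open>disjoint_AB_paths_iff\<close> translates between the
  two.\<close>

definition linked :: "('a \<times> 'a) set \<Rightarrow> 'a set \<Rightarrow> 'a set \<Rightarrow> 'a set \<Rightarrow> bool" where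
  "linked E W A B \<longleftrightarrow> (\<forall>X. finite X \<longrightarrow> (\<exists>a\<in>A. \<exists>b\<in>B. conn E (W - X) a b))"

lemma linkedI: "(\<And>X. finite X \<Longrightarrow> \<exists>a\<in>A. \<exists>b\<in>B. conn E (W - X) a b) \<Longrightarrow> linked E W A B"
  by (simp add: linked_def)

lemma linkedE:
  assumes "linked E W A B" "finite X"
  obtains a b where "a \<in> A" "b \<in> B" "conn E (W - X) a b"
  using assms unfolding linked_def by blast

lemma linked_mono:
  assumes "linked E W A B" "W \<subseteq> W'" shows "linked E W' A B"
proof (rule linkedI)
  fix X :: "'a set" assume X: "finite X"
  obtain a b where ab: "a \<in> A" "b \<in> B" "conn E (W - X) a b" by (rule linkedE[OF assms(1) X])
  have "conn E (W' - X) a b" by (rule conn_mono[OF ab(3) order_refl]) (use assms(2) in blast)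
  then show "\<exists>a\<in>A. \<exists>b\<in>B. conn E (W' - X) a b" using ab by blast
qed

text \<open>The easy infinite form of Menger's theorem. A finite set meets only finitely many of the
  disjoint paths, so some path survives; conversely, paths are picked one by one off the vertices
  used before.\<close>

lemma disjoint_AB_paths_iff:
  assumes "sym E"
  shows "(\<exists>P. infinite P \<and> disjoint_paths P \<and> (\<forall>p\<in>P. AB_path V E A B p \<and> set p \<subseteq> W)) \<longleftrightarrow>
    linked E (W \<inter> V) A B" (is "?l \<longleftrightarrow> ?r")
proof
  assume ?l
  then obtain P where P: "infinite P" "disjoint_paths P" "\<forall>p\<in>P. AB_path V E A B p \<and> set p \<subseteq> W" by blast
  show ?r
  proof (rule linkedI)
    fix X :: "'a set" assume "finite X"
    from disjoint_paths_escape[OF P(1,2) this] obtain p where p: "p \<in> P" "set p \<inter> X = {}" by blast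
    have "set p \<subseteq> W \<inter> V - X" using p P(3) by (auto simp: AB_path_def is_path_def)
    then show "\<exists>a\<in>A. \<exists>b\<in>B. conn E ((W \<inter> V) - X) a b" using AB_path_conn[OF assms, of V A B p "W \<inter> V - X"] p P(3) by blast
  qed
next
  assume r: ?r
  have "\<exists>P\<subseteq>{p. AB_path V E A B p \<and> set p \<subseteq> W}. infinite P \<and> disjoint_paths P"
  proof (rule greedy_disjoint_paths)
    fix X :: "'a set" assume X: "finite X"
    obtain a b where ab: "a \<in> A" "b \<in> B" "conn E ((W \<inter> V) - X) a b" by (rule linkedE[OF r X])
    from conn_AB_path[OF ab(3) _ ab(1,2), of V] obtain p where "AB_path V E A B p" "set p \<subseteq> W \<inter> V - X" by blast
    then show "\<exists>p\<in>{p. AB_path V E A B p \<and> set p \<subseteq> W}. p \<noteq> [] \<and> set p \<inter> X = {}"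
      by (intro bexI[of _ p]) (auto simp: AB_path_def is_path_def)
  qed
  then show ?l by blast
qed

lemma equiv_rays_iff:
  assumes "sym E"
  shows "equiv_rays V E R S \<longleftrightarrow> (\<forall>X. finite X \<longrightarrow> (\<exists>a b. conn E (V - X) (R a) (S b)))"
proof -
  have "equiv_rays V E R S \<longleftrightarrow>
      (\<exists>P. infinite P \<and> disjoint_paths P \<and> (\<forall>p\<in>P. AB_path V E (range R) (range S) p \<and> set p \<subseteq> UNIV))"
    by (simp add: equiv_rays_def)
  also have "\<dots> \<longleftrightarrow> linked E (UNIV \<inter> V) (range R) (range S)"
    by (rule disjoint_AB_paths_iff[OF assms])
  also have "\<dots> \<longleftrightarrow> (\<forall>X. finite X \<longrightarrow> (\<exists>a b. conn E (V - X) (R a) (S b)))" by (auto simp: linked_def)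
  finally show ?thesis .
qed

section \<open>Equivalence of rays, ends, and two constructions of rays\<close>

lemma ray_avoids:
  fixes R :: "nat \<Rightarrow> 'a"
  assumes "inj R" "finite X" shows "\<exists>N. \<forall>n\<ge>N. R n \<notin> X"
proof -
  have "finite (R -` X)" using assms by (simp add: finite_vimageI)
  then obtain N where "\<forall>n\<in>R -` X. n < N" using finite_nat_set_iff_bounded[of "R -` X"] by blast
  then have "\<forall>n\<ge>N. R n \<notin> X" using not_le by auto
  then show ?thesis ..
qed

text \<open>Adding initial segments of both rays to the finite set forces the connection to begin
  and end far out.\<close>

lemma equiv_rays_far:
  assumes "sym E" "equiv_rays V E R S" "finite X"
  shows "\<exists>a\<ge>M. \<exists>b\<ge>N. conn E (V - X) (R a) (S b)"
proof -
  let ?X = "X \<union> R ` {..<M} \<union> S ` {..<N}"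
  have "finite ?X" using assms by auto
  then obtain a b where c: "conn E (V - ?X) (R a) (S b)"
    using assms(2) unfolding equiv_rays_iff[OF assms(1)] by presburger
  then have "a \<ge> M" "b \<ge> N" using conn_mem[OF c] by (auto simp: not_le)
  then show ?thesis using conn_mono[OF c order_refl, of "V - X"] by blast
qed

lemma equiv_rays_refl: assumes "sym E" "is_ray V E R" shows "equiv_rays V E R R"
proof (rule equiv_rays_iff[OF assms(1), THEN iffD2], intro allI impI)
  fix X :: "'a set" assume X: "finite X"
  have "inj R" using assms(2) by (simp add: is_ray_def)
  from ray_avoids[OF this X] obtain N where "\<forall>n\<ge>N. R n \<notin> X" by blast
  then have "conn E (V - X) (R N) (R N)" using assms(2) by (intro conn_refl) (auto simp: is_ray_def)
  then show "\<exists>a b. conn E (V - X) (R a) (R b)" by blast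
qed

lemma equiv_rays_sym:
  assumes "sym E" "equiv_rays V E R S" shows "equiv_rays V E S R"
proof -
  have "\<exists>a b. conn E (V - X) (S a) (R b)" if "finite X" for X
    using equiv_rays_far[OF assms that, of 0 0] conn_sym[OF assms(1)] by blast
  then show ?thesis by (simp add: equiv_rays_iff[OF assms(1)])
qed

lemma equiv_rays_trans:
  assumes "sym E" "is_ray V E S" "equiv_rays V E R S" "equiv_rays V E S T"
  shows "equiv_rays V E R T"
proof (rule equiv_rays_iff[OF assms(1), THEN iffD2], intro allI impI)
  fix X :: "'a set" assume X: "finite X"
  have "inj S" using assms(2) by (simp add: is_ray_def)
  from ray_avoids[OF this X] obtain N where N: "\<forall>n\<ge>N. S n \<notin> X" by blast
  obtain a b where 1: "b \<ge> N" "conn E (V - X) (R a) (S b)" using equiv_rays_far[OF assms(1,3) X] by blast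
  obtain c d where 2: "c \<ge> N" "conn E (V - X) (S c) (T d)" using equiv_rays_far[OF assms(1,4) X] by blast
  have "conn E (V - X) (S b) (S c)" using 1 2 N assms(2)
    by (intro conn_ray[OF assms(1,2), of N]) (auto simp: is_ray_def)
  then show "\<exists>a d. conn E (V - X) (R a) (T d)" using 1 2 conn_trans by meson
qed

lemma end_ray: "is_end V E \<epsilon> \<Longrightarrow> R \<in> \<epsilon> \<Longrightarrow> is_ray V E R"
  by (auto simp: is_end_def)

lemma end_equiv:
  assumes "graph V E" "is_end V E \<epsilon>" "R \<in> \<epsilon>"
  shows "\<epsilon> = {S. is_ray V E S \<and> equiv_rays V E R S}"
proof -
  have s: "sym E" using assms(1) by (simp add: graph_def)
  obtain T where T: "is_ray V E T" "\<epsilon> = {S. is_ray V E S \<and> equiv_rays V E T S}" using assms(2) by (auto simp: is_end_def)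
  have R: "is_ray V E R" "equiv_rays V E T R" "equiv_rays V E R T" using T(2) assms(3) equiv_rays_sym[OF s] by auto
  have "equiv_rays V E T S \<longleftrightarrow> equiv_rays V E R S" for S
    using equiv_rays_trans[OF s R(1,2)] equiv_rays_trans[OF s T(1) R(3)] by blast
  then show ?thesis using T(2) by simp
qed

text \<open>Every extension is proper, so stage \<open>k\<close> has more than \<open>k\<close>
  vertices and its entry at position \<open>k\<close> is final.\<close>

lemma ray_limit:
  assumes p: "\<And>k. is_path V E (s k)" and e: "\<And>k. \<exists>t. t \<noteq> [] \<and> s (Suc k) = s k @ t"
  shows "\<exists>R. is_ray V E R \<and> range R = (\<Union>k. set (s k)) \<and> (\<forall>k i. i < length (s k) \<longrightarrow> R i = s k ! i)"
proof -
  have ext: "\<exists>t. s (k + m) = s k @ t" for k m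
  proof (induction m)
    case (Suc m) then show ?case using e[of "k + m"] by auto
  qed simp
  have len: "k < length (s k)" for k
  proof (induction k)
    case 0 then show ?case using p[of 0] by (simp add: is_path_def)
  next
    case (Suc k)
    obtain t where t: "t \<noteq> []" "s (Suc k) = s k @ t" using e by blast
    then show ?case using Suc by (cases t) auto
  qed
  define R where "R n = s n ! n" for n
  have R: "R i = s k ! i" if "i < length (s k)" for i k
  proof (cases "i \<le> k")
    case True then show ?thesis using ext[of i "k - i"] len[of i] by (auto simp: R_def nth_append)
  next
    case False then show ?thesis using ext[of k "i - k"] that by (auto simp: R_def nth_append)
  qed
  have "inj R"
  proof (rule injI)
    fix i j assume ij: "R i = R j"
    have l: "i < length (s (max i j))" "j < length (s (max i j))" using len[of "max i j"] by auto
    then have "s (max i j) ! i = s (max i j) ! j" using R ij by metis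
    then show "i = j" using l p[of "max i j"] by (simp add: is_path_def nth_eq_iff_index_eq)
  qed
  moreover have "(R n, R (Suc n)) \<in> E" for n
    using R[of n "Suc n"] R[of "Suc n" "Suc n"] len[of "Suc n"] p[of "Suc n"] by (simp add: is_path_def)
  moreover have "range R = (\<Union>k. set (s k))"
  proof
    show "range R \<subseteq> (\<Union>k. set (s k))" using len by (auto simp: R_def)
    show "(\<Union>k. set (s k)) \<subseteq> range R"
    proof
      fix x assume "x \<in> (\<Union>k. set (s k))"
      then obtain k i where "i < length (s k)" "s k ! i = x" by (auto simp: in_set_conv_nth)
      then show "x \<in> range R" using R[of i k] rangeI[of R i] by simp
    qed
  qed
  moreover have "(\<Union>k. set (s k)) \<subseteq> V" using p by (auto simp: is_path_def)
  ultimately show ?thesis using R by (intro exI[of _ R]) (auto simp: is_ray_def)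
qed

text \<open>Loop erasure: from the current vertex jump to the time of its last visit and take the
  next step. A vertex once left in this way never returns.\<close>

lemma finite_to_one_walk_ray:
  assumes w: "\<And>n::nat. w n = w (Suc n) \<or> (w n, w (Suc n)) \<in> E"
    and fin: "\<And>v. finite {n. w n = v}" and V: "range w \<subseteq> V"
  shows "\<exists>R. is_ray V E R \<and> range R \<subseteq> range w"
proof -
  define l where "l n = Max {m. w m = w n}" for n
  have l: "w (l n) = w n" "n \<le> l n" "\<And>m. w m = w n \<Longrightarrow> m \<le> l n" for n
  proof -
    have "l n \<in> {m. w m = w n}" unfolding l_def using fin by (intro Max_in) auto
    then show "w (l n) = w n" by simp
    show *: "\<And>m. w m = w n \<Longrightarrow> m \<le> l n" unfolding l_def using fin by (intro Max_ge) auto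
    show "n \<le> l n" using *[of n] by simp
  qed
  define f where "f k = ((\<lambda>n. Suc (l n)) ^^ k) 0" for k
  have fS: "f (Suc k) = Suc (l (f k))" for k by (simp add: f_def)
  have "strict_mono f" unfolding strict_mono_Suc_iff using fS l(2) by (simp add: le_imp_less_Suc)
  have gt: "l (f i) < f j" if "i < j" for i j
  proof -
    have "f (Suc i) \<le> f j" using that \<open>strict_mono f\<close> by (simp add: strict_mono_less_eq)
    then show ?thesis using fS by simp
  qed
  have ne: "w (f i) \<noteq> w (f j)" if "i < j" for i j
    using gt[OF that] l(3)[of "f j" "f i"] by auto
  have "inj (\<lambda>k. w (f k))" by (rule injI) (metis linorder_neqE_nat ne)
  moreover have "(w (f k), w (f (Suc k))) \<in> E" for k
    using w[of "l (f k)"] l(1)[of "f k"] ne[of k "Suc k"] fS[of k] by auto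
  ultimately have "is_ray V E (\<lambda>k. w (f k))" using V by (auto simp: is_ray_def)
  then show ?thesis by (intro exI[of _ "\<lambda>k. w (f k)"]) auto
qed

section \<open>Ends of infinite degree contain a countable connected ray graph\<close>

lemma inner_path:
  assumes "p \<noteq> []" "distinct p" "hd p \<noteq> last p"
  shows "length p \<ge> 2" "inner p = set p - {hd p, last p}"
proof -
  obtain x q where p: "p = x # q" using assms(1) by (cases p) auto
  then have "q \<noteq> []" using assms(3) by auto
  then obtain r y where q: "q = r @ [y]" by (cases q rule: rev_cases) auto
  show "length p \<ge> 2" by (simp add: p q)
  show "inner p = set p - {hd p, last p}" using assms(2) by (auto simp: inner_def p q)
qed

lemma inner_subset: "inner p \<subseteq> set p"
  unfolding inner_def by (cases p) (auto dest: in_set_butlastD)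

lemma tail_in_end:
  assumes "graph V E" "is_end V E \<epsilon>" "R \<in> \<epsilon>"
  shows "(\<lambda>i. R (n + i)) \<in> \<epsilon>"
proof -
  have s: "sym E" using assms(1) by (simp add: graph_def)
  have R: "is_ray V E R" using end_ray[OF assms(2,3)] .
  have "inj (\<lambda>i. R (n + i))" by (rule injI) (use R in \<open>simp add: is_ray_def inj_eq\<close>)
  then have T: "is_ray V E (\<lambda>i. R (n + i))" using R by (auto simp: is_ray_def)
  have "equiv_rays V E R (\<lambda>i. R (n + i))"
  proof (rule equiv_rays_iff[OF s, THEN iffD2], intro allI impI)
    fix X :: "'a set" assume X: "finite X"
    obtain a b where "b \<ge> n" "conn E (V - X) (R a) (R b)"
      using equiv_rays_far[OF s equiv_rays_refl[OF s R] X] by blast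
    then show "\<exists>a b. conn E (V - X) (R a) (R (n + b))" by (metis le_add_diff_inverse)
  qed
  then show ?thesis using T end_equiv[OF assms] by simp
qed

text \<open>Renews the supply of rays: a finite intersection with \<open>W\<close> is removed by
  passing to a tail, and tails of disjoint rays stay distinct and in the end.\<close>

lemma disjoint_tails:
  assumes "graph V E" "is_end V E \<epsilon>" "\<D> \<subseteq> \<epsilon>" "infinite \<D>" "disjoint_rays \<D>"
    and fin: "\<forall>D\<in>\<D>. finite (range D \<inter> W)"
  shows "\<exists>\<D>'\<subseteq>\<epsilon>. infinite \<D>' \<and> disjoint_rays \<D>' \<and> (\<forall>D\<in>\<D>'. range D \<inter> W = {})"
proof -
  have "\<forall>D\<in>\<D>. \<exists>n. \<forall>m\<ge>n. D m \<notin> range D \<inter> W"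
  proof
    fix D assume D: "D \<in> \<D>"
    then have "inj D" using end_ray[OF assms(2)] assms(3) by (auto simp: is_ray_def)
    from ray_avoids[OF this bspec[OF fin D]] show "\<exists>n. \<forall>m\<ge>n. D m \<notin> range D \<inter> W" .
  qed
  from bchoice[OF this] obtain n where n: "\<forall>D\<in>\<D>. \<forall>m\<ge>n D. D m \<notin> range D \<inter> W" ..
  define t where "t D = (\<lambda>i. D (n D + i))" for D :: "nat \<Rightarrow> 'a"
  have sub: "range (t D) \<subseteq> range D" for D by (auto simp: t_def)
  have inj: "inj_on t \<D>"
  proof (rule inj_onI, rule ccontr)
    fix D D' assume D: "D \<in> \<D>" "D' \<in> \<D>" "t D = t D'" "D \<noteq> D'"
    then have "range D \<inter> range D' = {}" using assms(5) by (simp add: disjoint_rays_def)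
    moreover have "t D 0 \<in> range D" "t D 0 \<in> range D'" using sub[of D] sub[of D'] D(3) by auto
    ultimately show False by auto
  qed
  have "infinite (t ` \<D>)" using finite_imageD[OF _ inj] assms(4) by blast
  moreover have "disjoint_rays (t ` \<D>)"
    unfolding disjoint_rays_def
  proof (intro ballI impI)
    fix R S assume "R \<in> t ` \<D>" "S \<in> t ` \<D>" "R \<noteq> S"
    then obtain D D' where D: "D \<in> \<D>" "D' \<in> \<D>" "R = t D" "S = t D'" "D \<noteq> D'" by auto
    then have "range D \<inter> range D' = {}" using assms(5) by (simp add: disjoint_rays_def)
    then show "range R \<inter> range S = {}" unfolding D(3,4) using sub[of D] sub[of D'] by blast
  qed
  moreover have "t ` \<D> \<subseteq> \<epsilon>" using tail_in_end[OF assms(1,2)] assms(3) by (auto simp: t_def)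
  moreover have "\<forall>D\<in>t ` \<D>. range D \<inter> W = {}" using n by (auto simp: t_def)
  ultimately show ?thesis by blast
qed

text \<open>The path \<open>p\<close> is prolonged along \<open>R\<close>, sends off a path \<open>t\<close> to \<open>B\<close>, and then crosses over to
  \<open>T\<close>; \<open>F\<close> collects everything used so far, and \<open>O'\<close> the rays that have already been left behind.\<close>

lemma zigzag_step:
  assumes s: "sym E" and R: "is_ray V E R" and T: "is_ray V E T" and dis: "range R \<inter> range T = {}"
    and RB: "range R \<inter> B = {}" and RO: "range R \<inter> O' = {}"
    and link: "linked E (V - B - O') (range R) (range T)" and out: "linked E (V - O') (range R) B"
    and p: "is_path V E p" "set p \<subseteq> F" "last p = R n" "\<And>m. m > n \<Longrightarrow> R m \<notin> F" and F: "finite F"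
  shows "\<exists>u m t. u \<noteq> [] \<and> is_path V E (p @ u) \<and> last (p @ u) = T m \<and> set u \<inter> F = {} \<and>
    set u \<inter> (B \<union> O') = {} \<and> set t \<inter> (F \<union> O') = {} \<and> is_path V E t \<and> set t \<inter> (set p \<union> set u) = {hd t} \<and>
    set t \<inter> B = {last t} \<and> (\<forall>m'>m. T m' \<notin> F \<union> set u \<union> set t)"
proof -
  have injR: "inj R" and injT: "inj T" using R T by (auto simp: is_ray_def)
  have pne: "p \<noteq> []" using p(1) by (simp add: is_path_def)
  have finX: "finite (F \<union> R ` {..n})" using F by simp
  \<comment> \<open>The path \<open>t\<close> to \<open>B\<close> is chosen before the crossing
    path. Excluding the initial segment of \<open>R\<close> makes it start at some
    \<open>R a\<close> with \<open>a > n\<close>; the crossing will leave \<open>R\<close> only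
    after \<open>a\<close>, so the prolonged path runs through the start of
    \<open>t\<close>.\<close>
  obtain a' b' where ab': "a' \<in> range R" "b' \<in> B" "conn E (V - O' - (F \<union> R ` {..n})) a' b'"
    by (rule linkedE[OF out finX])
  from conn_AB_path[OF ab'(3) _ ab'(1,2), of V] obtain t where t: "AB_path V E (range R) B t"
    "set t \<subseteq> V - O' - (F \<union> R ` {..n})" by blast
  have t': "is_path V E t" "t \<noteq> []" "set t \<inter> range R = {hd t}" "set t \<inter> B = {last t}"
    using t(1) by (auto simp: AB_path_def is_path_def)
  obtain a where a: "hd t = R a" using t'(3) by auto
  have "R a \<in> set t" using a t'(2) hd_in_set by metis
  then have "a > n" using t(2) by (metis Diff_iff UnI2 atMost_iff imageI not_le subsetD)
  \<comment> \<open>From \<open>M\<close> on, \<open>T\<close> is clear of everything used so far.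
    The crossing is made to land there, which leaves the rest of \<open>T\<close> free for the next
    step.\<close>
  obtain M where M: "\<forall>m\<ge>M. T m \<notin> F \<union> set t" using ray_avoids[OF injT, of "F \<union> set t"] F by auto
  let ?X = "F \<union> set t \<union> R ` {..a} \<union> T ` {..<M}"
  have finX': "finite ?X" using F by simp
  obtain c d where cd: "c \<in> range R" "d \<in> range T" "conn E (V - B - O' - ?X) c d"
    by (rule linkedE[OF link finX'])
  from conn_AB_path[OF cd(3) _ cd(1,2), of V] obtain q where q: "AB_path V E (range R) (range T) q"
    "set q \<subseteq> V - B - O' - ?X" by blast
  have q': "is_path V E q" "q \<noteq> []" "set q \<inter> range R = {hd q}" "set q \<inter> range T = {last q}"
    using q(1) by (auto simp: AB_path_def is_path_def)
  obtain b where b: "hd q = R b" using q'(3) by auto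
  obtain m where m: "last q = T m" using q'(4) by auto
  have "R b \<in> set q" using b q'(2) hd_in_set by metis
  then have "b > a" using q(2) by (metis Diff_iff UnI1 UnI2 atMost_iff imageI not_le subsetD)
  have "T m \<in> set q" using m q'(2) last_in_set by metis
  then have "m \<ge> M" using q(2) by (metis Diff_iff UnI2 lessThan_iff imageI not_le subsetD)
  define g where "g = map R [Suc n..<Suc b]"
  have nb: "Suc n < Suc b" using \<open>a > n\<close> \<open>b > a\<close> by simp
  have g: "is_path V E g" "set g = R ` {Suc n..b}" "hd g = R (Suc n)" "last g = R b" "g \<noteq> []"
  proof -
    show "is_path V E g" unfolding g_def by (rule is_path_ray_segment[OF R nb])
    show "set g = R ` {Suc n..b}" by (simp only: g_def set_map set_upt atLeastLessThanSuc_atLeastAtMost)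
    show "g \<noteq> []" using nb by (simp add: g_def)
    show "hd g = R (Suc n)" using hd_conv_nth[OF \<open>g \<noteq> []\<close>] nb unfolding g_def by (simp del: upt_Suc)
    show "last g = R b" using nb by (simp add: g_def)
  qed
  have gF: "set g \<inter> F = {}" using p(4) g(2) by fastforce
  have "is_path V E (p @ g)"
  proof (rule is_path_append[OF p(1) g(1)])
    show "set p \<inter> set g = {}" using gF p(2) by auto
    show "(last p, hd g) \<in> E" using p(3) g(3) R by (simp add: is_ray_def)
  qed
  moreover have "set (p @ g) \<inter> set q = {hd q}"
  proof -
    have "set p \<inter> set q = {}" using p(2) q(2) by auto
    moreover have "set g \<inter> set q = {hd q}" using g(2,4,5) q'(2,3) b last_in_set[of g] hd_in_set[of q] by fastforce
    ultimately show ?thesis by auto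
  qed
  moreover have "last (p @ g) = hd q" using g b by simp
  ultimately have J: "is_path V E ((p @ g) @ tl q)" "set ((p @ g) @ tl q) = set (p @ g) \<union> set q"
    "last ((p @ g) @ tl q) = last q" using is_path_join[OF _ q'(1)] by blast+
  have setu: "set (g @ tl q) = set g \<union> set q"
  proof -
    have "hd q \<in> set g" using g b last_in_set by metis
    then show ?thesis using q'(2) by (cases q) auto
  qed
  show ?thesis
  proof (intro exI conjI)
    show "g @ tl q \<noteq> []" using g by simp
    show "is_path V E (p @ g @ tl q)" using J(1) by simp
    show "last (p @ g @ tl q) = T m" using J(3) m by simp
    show "set (g @ tl q) \<inter> F = {}" unfolding setu using gF q(2) by auto
    show "set (g @ tl q) \<inter> (B \<union> O') = {}" 
    proof -
      have "set g \<subseteq> range R" using g(2) by auto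
      then show ?thesis unfolding setu using RB RO q(2) by blast
    qed
    show "set t \<inter> (F \<union> O') = {}" using t(2) by auto
    show "is_path V E t" by fact
    show "set t \<inter> B = {last t}" by fact
    have "R a \<in> set g" using g(2) \<open>a > n\<close> \<open>b > a\<close> by auto
    then show "set t \<inter> (set p \<union> set (g @ tl q)) = {hd t}" unfolding setu
      using a \<open>R a \<in> set t\<close> t'(3) g(2) t(2) p(2) q(2) by auto
    show "\<forall>m'>m. T m' \<notin> F \<union> set (g @ tl q) \<union> set t"
    proof (intro allI impI)
      fix m' assume m': "m' > m"
      then have "T m' \<notin> F \<union> set t" using M \<open>m \<ge> M\<close> by simp
      moreover have "T m' \<notin> set g" using g(2) dis by auto
      moreover have "T m' \<notin> set q"
      proof
        assume "T m' \<in> set q"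
        then have "T m' = T m" using q'(4) m by auto
        then show False using injT m' by (simp add: inj_eq)
      qed
      ultimately show "T m' \<notin> F \<union> set (g @ tl q) \<union> set t" unfolding setu by simp
    qed
  qed
qed

text \<open>Iterates \<open>zigzag_step\<close>. All pieces added after stage \<open>Suc i\<close>
  avoid \<open>D i\<close>, so the ray and its paths to \<open>B\<close> meet \<open>D i\<close>
  only in the finite set collected up to then.\<close>

lemma zigzag_ray:
  fixes D :: "nat \<Rightarrow> nat \<Rightarrow> 'a"
  assumes s: "sym E" and D: "\<And>k. is_ray V E (D k)" "\<And>i j. i \<noteq> j \<Longrightarrow> range (D i) \<inter> range (D j) = {}"
    "\<And>k. range (D k) \<inter> B = {}"
    and link: "\<And>k. linked E (V - B - (\<Union>i<k. range (D i))) (range (D k)) (range (D (Suc k)))"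
    and out: "\<And>k. linked E (V - (\<Union>i<k. range (D i))) (range (D k)) B"
  shows "\<exists>S P. is_ray V E S \<and> range S \<inter> B = {} \<and> infinite P \<and> disjoint_paths P \<and>
    (\<forall>p\<in>P. AB_path V E (range S) B p) \<and> (\<forall>i. finite (range (D i) \<inter> (range S \<union> \<Union>(set ` P))))"
proof -
  let ?O = "\<lambda>k. \<Union>i<k. range (D i)"
  \<comment> \<open>The path \<open>p\<close> ends at \<open>D k n\<close>, and \<open>D k\<close>
    is untouched beyond \<open>n\<close>, so that it can be followed further. The component
    \<open>t\<close> is the path to \<open>B\<close> sent off in the step leading to the state; at
    stage 0 it is a dummy.\<close>
  define Inv where "Inv k x = (case x of (p, n, F, t) \<Rightarrow> is_path V E p \<and> set p \<inter> B = {} \<and> set p \<subseteq> F \<and>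
    last p = D k n \<and> finite F \<and> (\<forall>m>n. D k m \<notin> F))" for k and x :: "'a list \<times> nat \<times> 'a set \<times> 'a list"
  define Stp where "Stp k x y = (case x of (p, n, F, t) \<Rightarrow> case y of (p', n', F', t') \<Rightarrow>
    \<exists>u. u \<noteq> [] \<and> p' = p @ u \<and> F' = F \<union> set u \<union> set t' \<and> set u \<inter> (F \<union> ?O k) = {} \<and> set t' \<inter> (F \<union> ?O k) = {} \<and>
      is_path V E t' \<and> set t' \<inter> set p' = {hd t'} \<and> set t' \<inter> B = {last t'})"
    for k and x y :: "'a list \<times> nat \<times> 'a set \<times> 'a list"
  have "\<exists>f. \<forall>k. Inv k (f k) \<and> Stp k (f k) (f (Suc k))"
  proof (rule dependent_nat_choice)
    have "D 0 0 \<in> V" "D 0 0 \<notin> B" using D(1)[of 0] D(3)[of 0] by (auto simp: is_ray_def)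
    moreover have "D 0 m \<noteq> D 0 0" if "m > 0" for m using D(1)[of 0] that by (auto simp: is_ray_def dest: injD)
    ultimately show "\<exists>x. Inv 0 x"
      by (intro exI[of _ "([D 0 0], 0, {D 0 0}, [])"]) (auto simp: Inv_def is_path_single)
  next
    fix x k assume x: "Inv k x"
    obtain p n F t where xe: "x = (p, n, F, t)" by (cases x)
    have p: "is_path V E p" "set p \<inter> B = {}" "set p \<subseteq> F" "last p = D k n" "finite F" "\<And>m. m > n \<Longrightarrow> D k m \<notin> F"
      using x by (auto simp: Inv_def xe)
    have RO: "range (D k) \<inter> ?O k = {}" using D(2)[of k] by fastforce
    obtain u m t' where u: "u \<noteq> []" "is_path V E (p @ u)" "last (p @ u) = D (Suc k) m" "set u \<inter> F = {}"
       "set u \<inter> (B \<union> ?O k) = {}" "set t' \<inter> (F \<union> ?O k) = {}" "is_path V E t'" "set t' \<inter> (set p \<union> set u) = {hd t'}"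
       "set t' \<inter> B = {last t'}" "\<forall>m'>m. D (Suc k) m' \<notin> F \<union> set u \<union> set t'"
      using zigzag_step[OF s D(1)[of k] D(1)[of "Suc k"] D(2)[of k "Suc k"] D(3)[of k] RO link[of k] out[of k] p(1,3,4,6,5)]
      by fastforce
    let ?y = "(p @ u, m, F \<union> set u \<union> set t', t')"
    have "Inv (Suc k) ?y" unfolding Inv_def using u p by auto
    moreover have "Stp k x ?y" unfolding Stp_def xe using u by auto
    ultimately show "\<exists>y. Inv (Suc k) y \<and> Stp k x y" by blast
  qed
  then obtain f where f: "\<And>k. Inv k (f k)" "\<And>k. Stp k (f k) (f (Suc k))" by blast
  define p where "p k = fst (f k)" for k
  define F where "F k = fst (snd (snd (f k)))" for k
  define t where "t k = snd (snd (snd (f (Suc k))))" for k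
  have I: "is_path V E (p k)" "set (p k) \<inter> B = {}" "set (p k) \<subseteq> F k" "finite (F k)" for k
    using f(1)[of k] by (auto simp: Inv_def p_def F_def split: prod.splits)
  have "\<exists>u. u \<noteq> [] \<and> p (Suc k) = p k @ u \<and> F (Suc k) = F k \<union> set u \<union> set (t k) \<and> set u \<inter> (F k \<union> ?O k) = {} \<and>
     set (t k) \<inter> (F k \<union> ?O k) = {} \<and> is_path V E (t k) \<and> set (t k) \<inter> set (p (Suc k)) = {hd (t k)} \<and> set (t k) \<inter> B = {last (t k)}" for k
    using f(2)[of k] by (auto simp: Stp_def p_def F_def t_def split: prod.splits)
  then obtain u where u: "\<And>k. u k \<noteq> []" "\<And>k. p (Suc k) = p k @ u k" "\<And>k. F (Suc k) = F k \<union> set (u k) \<union> set (t k)"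
     "\<And>k. set (u k) \<inter> (F k \<union> ?O k) = {}" "\<And>k. set (t k) \<inter> (F k \<union> ?O k) = {}" "\<And>k. is_path V E (t k)"
     "\<And>k. set (t k) \<inter> set (p (Suc k)) = {hd (t k)}" "\<And>k. set (t k) \<inter> B = {last (t k)}" by metis
  have Fmono: "F i \<subseteq> F j" if "i \<le> j" for i j
    using lift_Suc_mono_le[of F, OF _ that] u(3) by blast
  obtain S where S: "is_ray V E S" "range S = (\<Union>k. set (p k))"
    using ray_limit[of V E p] I(1) u(1,2) by metis
  have tdis: "set (t i) \<inter> set (t j) = {}" if "i < j" for i j
  proof -
    have "set (t i) \<subseteq> F j" using u(3)[of i] Fmono[of "Suc i" j] that by auto
    then show ?thesis using u(5)[of j] by auto
  qed
  have tdis': "\<forall>i j. i \<noteq> j \<longrightarrow> set (t i) \<inter> set (t j) = {}"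
    using tdis by (metis Int_commute linorder_neqE_nat)
  have tne: "\<forall>k. t k \<noteq> []" using u(6) by (auto simp: is_path_def)
  have "infinite (range t)" using inj_disjoint_sequence[OF tne tdis'] finite_imageD by blast
  moreover have "disjoint_paths (range t)"
    unfolding disjoint_paths_def using tdis' by (metis imageE)
  moreover have "AB_path V E (range S) B (t k)" for k
  proof -
    have "set (t k) \<inter> set (p (Suc k + j)) = {hd (t k)}" for j
    proof (induction j)
      case 0 then show ?case using u(7) by simp
    next
      case (Suc j)
      have "set (t k) \<subseteq> F (Suc k + j)" using u(3)[of k] Fmono[of "Suc k" "Suc k + j"] by auto
      then have "set (t k) \<inter> set (u (Suc k + j)) = {}" using u(4)[of "Suc k + j"] by auto
      then show ?case using Suc u(2)[of "Suc k + j"] by auto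
    qed
    moreover have "set (p i) \<subseteq> set (p (Suc k + i))" for i
      using lift_Suc_mono_le[of "\<lambda>i. set (p i)" i "Suc k + i"] u(2) by simp
    ultimately have "set (t k) \<inter> range S = {hd (t k)}" unfolding S(2) by fastforce
    then show ?thesis using u(6,8) by (simp add: AB_path_def)
  qed
  moreover have "range S \<inter> B = {}" using S(2) I(2) by auto
  moreover have "finite (range (D i) \<inter> (range S \<union> \<Union>(set ` range t)))" for i
  proof -
    have "range (D i) \<inter> F (Suc i + j) \<subseteq> F (Suc i)" for j
    proof (induction j)
      case (Suc j)
      have "i \<in> {..<Suc i + j}" by simp
      then have "range (D i) \<subseteq> ?O (Suc i + j)" by blast
      then have "range (D i) \<inter> (set (u (Suc i + j)) \<union> set (t (Suc i + j))) = {}"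
        using u(4)[of "Suc i + j"] u(5)[of "Suc i + j"] by blast
      then show ?case using Suc u(3)[of "Suc i + j"] by auto
    qed auto
    moreover have "set (p k) \<subseteq> F (Suc i + k)" "set (t k) \<subseteq> F (Suc i + k)" for k
      using I(3)[of k] u(3)[of k] Fmono[of k "Suc i + k"] Fmono[of "Suc k" "Suc i + k"] by auto
    ultimately have "range (D i) \<inter> (range S \<union> \<Union>(set ` range t)) \<subseteq> F (Suc i)" unfolding S(2) by blast
    then show ?thesis using I(4) finite_subset by blast
  qed
  ultimately show ?thesis using S(1) by (intro exI[of _ S] exI[of _ "range t"]) blast
qed

text \<open>Start with disjoint paths from a supply ray \<open>R\<close> to \<open>B\<close>. If some other supply ray meets infinitely
  many of them, pass to that ray and the final segments of those paths, which avoid \<open>R\<close>. If this stops,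
  the last ray is the one wanted; if it never stops, the rays visited admit a zigzag ray.\<close>

lemma supply_step:
  assumes "graph V E" "is_end V E \<epsilon>" and B: "B \<subseteq> V" "R0 \<in> \<epsilon>" "range R0 \<subseteq> B"
    and D: "\<D> \<subseteq> \<epsilon>" "infinite \<D>" "disjoint_rays \<D>" and away: "\<forall>D\<in>\<D>. range D \<inter> B = {}"
  shows "\<exists>S P \<D>'. is_ray V E S \<and> range S \<inter> B = {} \<and> infinite P \<and> disjoint_paths P \<and>
    (\<forall>p\<in>P. AB_path V E (range S) B p) \<and> \<D>' \<subseteq> \<epsilon> \<and> infinite \<D>' \<and> disjoint_rays \<D>' \<and>
    (\<forall>D\<in>\<D>'. range D \<inter> (B \<union> range S \<union> \<Union>(set ` P)) = {})" (is ?goal)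
proof (rule ccontr)
  assume contra: "\<not> ?goal"
  have no: False if "is_ray V E S" "range S \<inter> B = {}" "infinite P" "disjoint_paths P"
    "\<forall>p\<in>P. AB_path V E (range S) B p" "\<D>' \<subseteq> \<epsilon>" "infinite \<D>'" "disjoint_rays \<D>'"
    "\<forall>D\<in>\<D>'. range D \<inter> (B \<union> range S \<union> \<Union>(set ` P)) = {}" for S P \<D>'
    by (rule notE[OF contra], intro exI conjI) (fact that)+
  have s: "sym E" using assms(1) by (simp add: graph_def)
  have DB: "range D \<inter> B = {}" if "D \<in> \<D>" for D using away that by blast
  have ray: "is_ray V E D" if "D \<in> \<D>" for D using end_ray[OF assms(2)] D(1) that by blast
  have dj: "range R \<inter> range S = {}" if "R \<in> \<D>" "S \<in> \<D>" "R \<noteq> S" for R S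
    using D(3) that by (simp add: disjoint_rays_def)
  \<comment> \<open>\<open>F\<close> collects the rays already left behind; \<open>R\<close> still
    has infinitely many disjoint paths to \<open>B\<close> off all of them.\<close>
  define good where "good R F \<longleftrightarrow> R \<in> \<D> \<and> R \<notin> F \<and> F \<subseteq> \<D> \<and> finite F \<and>
    linked E (V - \<Union>(range ` F)) (range R) B" for R F
  define link where "link R F R' \<longleftrightarrow> linked E (V - B - \<Union>(range ` F)) (range R) (range R')"
    for R R' :: "nat \<Rightarrow> 'a" and F :: "(nat \<Rightarrow> 'a) set"
  have ext: "\<exists>R'. link R F R' \<and> good R' (insert R F)" if g: "good R F" for R F
  proof -
    have RF: "R \<in> \<D>" "R \<notin> F" "F \<subseteq> \<D>" "finite F" using g by (auto simp: good_def)
    let ?W = "- \<Union>(range ` F)"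
    have "linked E (?W \<inter> V) (range R) B" using g by (simp add: good_def Diff_eq Int_commute)
    then obtain P where P: "infinite P" "disjoint_paths P" "\<forall>p\<in>P. AB_path V E (range R) B p \<and> set p \<subseteq> ?W"
      using disjoint_AB_paths_iff[OF s, of V "range R" B ?W] by blast
    \<comment> \<open>If each remaining supply ray met only finitely many of the paths, tails of
      these rays would avoid \<open>B\<close>, \<open>R\<close> and all the paths, and
      \<open>R\<close> with \<open>P\<close> would be as required.\<close>
    have "\<exists>R'\<in>\<D> - insert R F. infinite {p \<in> P. set p \<inter> range R' \<noteq> {}}"
    proof (rule ccontr)
      assume n: "\<not> ?thesis"
      let ?W' = "B \<union> range R \<union> \<Union>(set ` P)"
      have fin: "\<forall>D\<in>\<D> - insert R F. finite (range D \<inter> ?W')"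
      proof
        fix D assume D': "D \<in> \<D> - insert R F"
        have "range D \<inter> B = {}" "range D \<inter> range R = {}" using D' DB dj[of D R] RF by auto
        then have "range D \<inter> ?W' \<subseteq> \<Union>(set ` {p \<in> P. set p \<inter> range D \<noteq> {}})" by auto
        moreover have "finite (\<Union>(set ` {p \<in> P. set p \<inter> range D \<noteq> {}}))" using n D' by auto
        ultimately show "finite (range D \<inter> ?W')" using finite_subset by blast
      qed
      have 1: "infinite (\<D> - insert R F)" using D(2) RF(4) by simp
      have 2: "disjoint_rays (\<D> - insert R F)" using D(3) by (auto simp: disjoint_rays_def)
      have 3: "\<D> - insert R F \<subseteq> \<epsilon>" using D(1) by auto
      obtain \<D>' where D': "\<D>' \<subseteq> \<epsilon>" "infinite \<D>'" "disjoint_rays \<D>'" "\<forall>D\<in>\<D>'. range D \<inter> ?W' = {}"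
        using disjoint_tails[OF assms(1,2) 3 1 2 fin] by (elim exE conjE) (rule that)
      have "\<forall>p\<in>P. AB_path V E (range R) B p" using P(3) by blast
      from no[OF ray[OF RF(1)] DB[OF RF(1)] P(1,2) this D'] show False .
    qed
    then obtain R' where R': "R' \<in> \<D>" "R' \<noteq> R" "R' \<notin> F" and inf: "infinite {p \<in> P. set p \<inter> range R' \<noteq> {}}" by blast
    have RR: "range R \<inter> range R' = {}" "range R' \<inter> B = {}" using dj[OF RF(1) R'(1)] R' DB by auto
    have dP: "disjoint_paths {p \<in> P. set p \<inter> range R' \<noteq> {}}" using P(2) by (auto simp: disjoint_paths_def)
    \<comment> \<open>A path of \<open>P\<close> through \<open>R'\<close> is cut there. Its initial
      part avoids \<open>B\<close>, as only its last vertex lies in \<open>B\<close>, and joins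
      \<open>R\<close> to \<open>R'\<close>; its final part avoids \<open>R\<close>, as only its
      first vertex lies on \<open>R\<close>, and joins \<open>R'\<close> to
      \<open>B\<close>.\<close>
    have key: "(\<exists>a\<in>range R. \<exists>b\<in>range R'. conn E (V - B - \<Union>(range ` F) - X) a b) \<and>
       (\<exists>a\<in>range R'. \<exists>b\<in>B. conn E (V - \<Union>(range ` insert R F) - X) a b)" if X: "finite X" for X
    proof -
      obtain p where p: "p \<in> P" "set p \<inter> range R' \<noteq> {}" "set p \<inter> X = {}"
        using disjoint_paths_escape[OF inf dP X] by blast
      have q: "is_path V E p" "p \<noteq> []" "set p \<inter> range R = {hd p}" "set p \<inter> B = {last p}" "set p \<subseteq> V" "set p \<subseteq> ?W" "distinct p"
        using P(3) p(1) by (auto simp: AB_path_def is_path_def)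
      obtain i where i: "i < length p" "p ! i \<in> range R'" using p(2) by (metis disjoint_iff in_set_conv_nth)
      have hl: "hd p = p ! 0" "last p = p ! (length p - 1)" "0 < length p" using q(2) by (auto simp: hd_conv_nth last_conv_nth)
      have "p ! 0 \<in> range R" "p ! (length p - 1) \<in> B" using q(3,4) hl by auto
      then have "i \<noteq> 0" "i \<noteq> length p - 1" using i(2) RR by (metis disjoint_iff)+
      then have i': "0 < i" "Suc i < length p" using i(1) by auto
      have 1: "set (take (Suc i) p) \<subseteq> V - B - \<Union>(range ` F) - X"
      proof
        fix x assume x: "x \<in> set (take (Suc i) p)"
        have xp: "x \<in> set p" using x set_take_subset[of "Suc i" p] by blast
        have "x \<noteq> last p"
        proof
          assume "x = last p"
          then have "last p \<in> set (drop (Suc i) p)" using i'(2) last_in_set[of "drop (Suc i) p"] by simp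
          then show False using \<open>x = last p\<close> x q(7) set_take_disj_set_drop_if_distinct[of p "Suc i" "Suc i"] by auto
        qed
        then show "x \<in> V - B - \<Union>(range ` F) - X" using xp q(4,5,6) p(3) by blast
      qed
      have "conn E (V - B - \<Union>(range ` F) - X) (p ! 0) (p ! i)"
      proof (rule conn_path[OF s is_path_take[OF q(1), of "Suc i"] 1])
        show "p ! 0 \<in> set (take (Suc i) p)" using hl(3) i(1) by (auto simp: in_set_conv_nth intro: exI[of _ 0])
        show "p ! i \<in> set (take (Suc i) p)" using i(1) by (auto simp: in_set_conv_nth intro: exI[of _ i])
      qed simp
      moreover have 2: "set (drop i p) \<subseteq> V - \<Union>(range ` insert R F) - X"
      proof
        fix x assume x: "x \<in> set (drop i p)"
        have xp: "x \<in> set p" using x set_drop_subset[of i p] by blast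
        have "hd p \<in> set (take i p)" using i'(1) hl by (auto simp: in_set_conv_nth intro: exI[of _ 0])
        then have "x \<noteq> hd p" using x q(7) set_take_disj_set_drop_if_distinct[of p i i] by auto
        then show "x \<in> V - \<Union>(range ` insert R F) - X" using xp q(3,5,6) p(3) by blast
      qed
      moreover have "conn E (V - \<Union>(range ` insert R F) - X) (p ! i) (last p)"
      proof (rule conn_path[OF s is_path_drop[OF q(1) i(1)] 2])
        show "p ! i \<in> set (drop i p)" using i(1) by (metis Cons_nth_drop_Suc list.set_intros(1))
        show "last p \<in> set (drop i p)" using i(1) last_in_set[of "drop i p"] by simp
      qed
      ultimately show ?thesis using \<open>p ! 0 \<in> range R\<close> i(2) q(4) by blast
    qed
    have "link R F R'" unfolding link_def by (rule linkedI) (use key in blast)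
    moreover have "linked E (V - \<Union>(range ` insert R F)) (range R') B" by (rule linkedI) (use key in blast)
    then have "good R' (insert R F)" using R' RF by (simp add: good_def)
    ultimately show ?thesis by blast
  qed
  have "\<exists>f. \<forall>k::nat. good (fst (f k)) (snd (f k)) \<and>
     (snd (f (Suc k)) = insert (fst (f k)) (snd (f k)) \<and> link (fst (f k)) (snd (f k)) (fst (f (Suc k))))"
  proof (rule dependent_nat_choice)
    obtain D0 where D0: "D0 \<in> \<D>" using D(2) by (metis ex_in_conv infinite_imp_nonempty)
    have eq: "equiv_rays V E D0 R0" using end_equiv[OF assms(1,2), of D0] D0 D(1) B(2) by auto
    have "linked E V (range D0) B"
    proof (rule linkedI)
      fix X :: "'a set" assume "finite X"
      from equiv_rays_far[OF s eq this, of 0 0] obtain a b where ab: "conn E (V - X) (D0 a) (R0 b)" by blast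
      show "\<exists>a\<in>range D0. \<exists>b\<in>B. conn E (V - X) a b"
        using B(3) ab by (intro bexI[of _ "D0 a"] bexI[of _ "R0 b"]) auto
    qed
    then have "good D0 {}" using D0 by (simp add: good_def)
    then show "\<exists>x. good (fst x) (snd x)" by (intro exI[of _ "(D0, {})"]) simp
  next
    fix x :: "(nat \<Rightarrow> 'a) \<times> (nat \<Rightarrow> 'a) set" and n :: nat
    assume "good (fst x) (snd x)"
    from ext[OF this] obtain R' where R': "link (fst x) (snd x) R'" "good R' (insert (fst x) (snd x))" by blast
    show "\<exists>y. good (fst y) (snd y) \<and> (snd y = insert (fst x) (snd x) \<and> link (fst x) (snd x) (fst y))"
      using R' by (intro exI[of _ "(R', insert (fst x) (snd x))"]) simp
  qed
  then obtain f where f: "\<And>k. good (fst (f k)) (snd (f k))" "\<And>k. snd (f (Suc k)) = insert (fst (f k)) (snd (f k))"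
     "\<And>k. link (fst (f k)) (snd (f k)) (fst (f (Suc k)))" by blast
  define R where "R k = fst (f k)" for k
  define F where "F k = snd (f k)" for k
  have F: "R ` {..<k} \<subseteq> F k" for k
  proof (induction k)
    case (Suc k)
    have "F (Suc k) = insert (R k) (F k)" using f(2)[of k] by (simp add: R_def F_def)
    then show ?case using Suc by (simp only: lessThan_Suc image_insert) blast
  qed simp
  have RD: "R k \<in> \<D>" for k using f(1)[of k] by (simp add: R_def good_def)
  have lt: "R i \<noteq> R j" if "i < j" for i j
    using f(1)[of j] F[of j] that by (auto simp: R_def F_def good_def)
  have ne: "R i \<noteq> R j" if "i \<noteq> j" for i j using that lt[of i j] lt[of j i] by (cases "i < j") auto
  have "\<exists>S P. is_ray V E S \<and> range S \<inter> B = {} \<and> infinite P \<and> disjoint_paths P \<and>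
    (\<forall>p\<in>P. AB_path V E (range S) B p) \<and> (\<forall>i. finite (range (R i) \<inter> (range S \<union> \<Union>(set ` P))))"
  proof (rule zigzag_ray[OF s])
    fix k show "is_ray V E (R k)" using ray RD by blast
    show "range (R k) \<inter> B = {}" using DB RD by blast
  next
    fix i j :: nat assume "i \<noteq> j"
    then show "range (R i) \<inter> range (R j) = {}" using dj RD ne by blast
  next
    fix k
    have "linked E (V - B - \<Union>(range ` F k)) (range (R k)) (range (R (Suc k)))"
      using f(3)[of k] by (simp add: link_def R_def F_def)
    then show "linked E (V - B - (\<Union>i<k. range (R i))) (range (R k)) (range (R (Suc k)))"
      by (rule linked_mono) (use F[of k] in auto)
    have "linked E (V - \<Union>(range ` F k)) (range (R k)) B" using f(1)[of k] by (simp add: good_def R_def F_def)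
    then show "linked E (V - (\<Union>i<k. range (R i))) (range (R k)) B" by (rule linked_mono) (use F[of k] in auto)
  qed
  then obtain S P where SP: "is_ray V E S" "range S \<inter> B = {}" "infinite P" "disjoint_paths P"
    "\<forall>p\<in>P. AB_path V E (range S) B p" "\<forall>i. finite (range (R i) \<inter> (range S \<union> \<Union>(set ` P)))"
    by (elim exE conjE) (rule that)
  have "inj R" by (rule injI) (use ne in blast)
  then have 1: "infinite (range R)" using finite_imageD by blast
  have 2: "disjoint_rays (range R)" using D(3) RD by (auto simp: disjoint_rays_def)
  have 3: "range R \<subseteq> \<epsilon>" using RD D(1) by auto
  have 4: "\<forall>D\<in>range R. finite (range D \<inter> (B \<union> range S \<union> \<Union>(set ` P)))"
  proof
    fix D assume "D \<in> range R"
    obtain i where "D = R i" using \<open>D \<in> range R\<close> by blast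
    then have "range D \<inter> (B \<union> range S \<union> \<Union>(set ` P)) = range (R i) \<inter> (range S \<union> \<Union>(set ` P))" using DB[OF RD[of i]] by auto
    then show "finite (range D \<inter> (B \<union> range S \<union> \<Union>(set ` P)))" using SP(6)[rule_format, of i] by simp
  qed
  obtain \<D>' where D': "\<D>' \<subseteq> \<epsilon>" "infinite \<D>'" "disjoint_rays \<D>'"
    "\<forall>D\<in>\<D>'. range D \<inter> (B \<union> range S \<union> \<Union>(set ` P)) = {}"
    using disjoint_tails[OF assms(1,2) 3 1 2 4] by (elim exE conjE) (rule that)
  from no[OF SP(1-5) D'] show False .
qed

text \<open>The last condition (all but finitely many vertices of \<open>B\<close> reach the chosen rays inside \<open>B - X\<close>) lets
  a disjoint family of paths ending anywhere in \<open>B\<close> be prolonged to the rays.\<close>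

definition ray_stage :: "'a set \<Rightarrow> ('a \<times> 'a) set \<Rightarrow> (nat \<Rightarrow> 'a) set \<Rightarrow>
    (nat \<Rightarrow> 'a) set \<Rightarrow> 'a set \<Rightarrow> (nat \<Rightarrow> 'a) set \<Rightarrow> bool" where
  "ray_stage V E \<epsilon> Rs B \<D> \<longleftrightarrow> finite Rs \<and> Rs \<noteq> {} \<and> Rs \<subseteq> \<epsilon> \<and> disjoint_rays Rs \<and> B \<subseteq> V \<and>
     (\<forall>R\<in>Rs. range R \<subseteq> B) \<and> \<D> \<subseteq> \<epsilon> \<and> infinite \<D> \<and> disjoint_rays \<D> \<and> (\<forall>D\<in>\<D>. range D \<inter> B = {}) \<and>
     (\<forall>X. finite X \<longrightarrow> finite {b \<in> B. \<not> (\<exists>r\<in>\<Union>(range ` Rs). conn E (B - X) b r)})"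

text \<open>The new ray has infinitely many disjoint paths to \<open>B\<close>, and all but finitely
  many vertices of \<open>B\<close> lead on to \<open>Rs\<close> within \<open>B\<close>. A path
  stopped at its first vertex on \<open>Rs\<close> avoids every ray of \<open>Rs\<close> except the
  one where it ends.\<close>

lemma ray_stage_extend:
  assumes "graph V E" "is_end V E \<epsilon>" "ray_stage V E \<epsilon> Rs B \<D>"
  shows "\<exists>S B' \<D>'. ray_stage V E \<epsilon> (insert S Rs) B' \<D>' \<and> B \<subseteq> B' \<and> range S \<inter> B = {} \<and>
    (\<exists>R\<in>Rs. linked E (B' - \<Union>(range ` (Rs - {R}))) (range S) (range R))"
proof -
  have s: "sym E" using assms(1) by (simp add: graph_def)
  have st: "finite Rs" "Rs \<noteq> {}" "Rs \<subseteq> \<epsilon>" "disjoint_rays Rs" "B \<subseteq> V" "\<And>R. R \<in> Rs \<Longrightarrow> range R \<subseteq> B"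
    "\<D> \<subseteq> \<epsilon>" "infinite \<D>" "disjoint_rays \<D>" "\<forall>D\<in>\<D>. range D \<inter> B = {}"
    and tight: "\<And>X. finite X \<Longrightarrow> finite {b \<in> B. \<not> (\<exists>r\<in>\<Union>(range ` Rs). conn E (B - X) b r)}"
    using assms(3) by (auto simp: ray_stage_def)
  obtain R0 where R0: "R0 \<in> Rs" using st(2) by blast
  have R0': "R0 \<in> \<epsilon>" "range R0 \<subseteq> B" using R0 st by auto
  obtain S P \<D>' where S: "is_ray V E S" "range S \<inter> B = {}" and P: "infinite P" "disjoint_paths P"
    and P': "\<forall>p\<in>P. AB_path V E (range S) B p" and D': "\<D>' \<subseteq> \<epsilon>" "infinite \<D>'" "disjoint_rays \<D>'"
    "\<forall>D\<in>\<D>'. range D \<inter> (B \<union> range S \<union> \<Union>(set ` P)) = {}"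
    using supply_step[OF assms(1,2) st(5) R0' st(7,8,9,10)] by (elim exE conjE) (rule that)
  have P3: "\<And>p. p \<in> P \<Longrightarrow> AB_path V E (range S) B p" using P' by blast
  define B' where "B' = B \<union> range S \<union> \<Union>(set ` P)"
  have PV: "set p \<subseteq> V" "p \<noteq> []" "is_path V E p" "hd p \<in> range S" "last p \<in> B" if "p \<in> P" for p
    using P3[OF that] by (auto simp: AB_path_def is_path_def)
  have B'V: "B' \<subseteq> V" unfolding B'_def using st(5) S(1) PV(1) by (auto simp: is_ray_def)
  have reach: "\<exists>R\<in>Rs. \<exists>a\<in>range S. \<exists>b\<in>range R. conn E (B' - \<Union>(range ` (Rs - {R})) - X) a b" if X: "finite X" for X
  proof -
    let ?bad = "{b \<in> B. \<not> (\<exists>r\<in>\<Union>(range ` Rs). conn E (B - X) b r)}"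
    have "finite (X \<union> ?bad)" using X tight[OF X] by simp
    from disjoint_paths_escape[OF P(1,2) this] obtain p where p: "p \<in> P" "set p \<inter> (X \<union> ?bad) = {}" by blast
    have "last p \<in> set p" using PV(2)[OF p(1)] by simp
    then have "last p \<notin> ?bad" using p(2) by blast
    then obtain r where r: "r \<in> \<Union>(range ` Rs)" "conn E (B - X) (last p) r" using PV(5)[OF p(1)] by blast
    have "set p \<subseteq> B' - X" using p by (auto simp: B'_def)
    then have "conn E (B' - X) (hd p) (last p)" by (rule AB_path_conn(1)[OF s P3[OF p(1)]])
    moreover have "conn E (B' - X) (last p) r" using conn_mono[OF r(2) order_refl, of "B' - X"] by (auto simp: B'_def)
    ultimately have "conn E (B' - X) (hd p) r" by (rule conn_trans)
    from conn_AB_path[OF this _ PV(4)[OF p(1)] r(1), of V] B'V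
    obtain q where q: "AB_path V E (range S) (\<Union>(range ` Rs)) q" "set q \<subseteq> B' - X" by blast
    have "is_path V E q \<and> set q \<inter> range S = {hd q} \<and> set q \<inter> \<Union>(range ` Rs) = {last q}"
      using q(1) by (simp only: AB_path_def)
    then have qe: "hd q \<in> range S" "last q \<in> \<Union>(range ` Rs)" "set q \<inter> \<Union>(range ` Rs) = {last q}" "is_path V E q"
      by blast+
    then obtain R where R: "R \<in> Rs" "last q \<in> range R" by blast
    have lq: "last q \<notin> \<Union>(range ` (Rs - {R}))" using R st(4) by (auto simp: disjoint_rays_def)
    have xq: "x = last q" if "x \<in> set q" "x \<in> \<Union>(range ` (Rs - {R}))" for x
    proof -
      have "x \<in> set q \<inter> \<Union>(range ` Rs)" using that by auto
      then show ?thesis by (simp only: qe(3) singleton_iff)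
    qed
    have "set q \<subseteq> B' - \<Union>(range ` (Rs - {R})) - X"
    proof (intro subsetI DiffI notI)
      fix x assume x: "x \<in> set q"
      show "x \<in> B'" using subsetD[OF q(2) x] by simp
      show False if "x \<in> X" using subsetD[OF q(2) x] that by simp
      show False if "x \<in> \<Union>(range ` (Rs - {R}))" using xq[OF x that] lq that by simp
    qed
    then have "conn E (B' - \<Union>(range ` (Rs - {R})) - X) (hd q) (last q)" by (rule AB_path_conn(1)[OF s q(1)])
    then show ?thesis using R qe(1) by blast
  qed
  \<comment> \<open>Pigeonhole over the finite set \<open>Rs\<close>: if every \<open>R\<close> had
    its own finite separator \<open>X R\<close>, the union of these would contradict
    \<open>reach\<close>.\<close>
  have "\<exists>R\<in>Rs. linked E (B' - \<Union>(range ` (Rs - {R}))) (range S) (range R)"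
  proof (rule ccontr)
    assume "\<not> ?thesis"
    then have "\<forall>R\<in>Rs. \<exists>X. finite X \<and> \<not> (\<exists>a\<in>range S. \<exists>b\<in>range R. conn E (B' - \<Union>(range ` (Rs - {R})) - X) a b)"
      unfolding linked_def by blast
    from bchoice[OF this] obtain X where X: "\<forall>R\<in>Rs. finite (X R) \<and>
      \<not> (\<exists>a\<in>range S. \<exists>b\<in>range R. conn E (B' - \<Union>(range ` (Rs - {R})) - X R) a b)" ..
    have "finite (\<Union>(X ` Rs))" using X st(1) by blast
    from reach[OF this] obtain R a b where R: "R \<in> Rs" "a \<in> range S" "b \<in> range R"
      "conn E (B' - \<Union>(range ` (Rs - {R})) - \<Union>(X ` Rs)) a b" by blast
    have "conn E (B' - \<Union>(range ` (Rs - {R})) - X R) a b" by (rule conn_mono[OF R(4) order_refl]) (use R(1) in auto)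
    then show False using X R(1-3) by blast
  qed
  then obtain R where R: "R \<in> Rs" and RX: "linked E (B' - \<Union>(range ` (Rs - {R}))) (range S) (range R)" by blast
  have "equiv_rays V E S R"
  proof (rule equiv_rays_iff[OF s, THEN iffD2], intro allI impI)
    fix X :: "'a set" assume "finite X"
    have "linked E V (range S) (range R)" by (rule linked_mono[OF RX]) (use B'V in blast)
    from linkedE[OF this \<open>finite X\<close>] show "\<exists>a b. conn E (V - X) (S a) (R b)" by blast
  qed
  then have "equiv_rays V E R S" by (rule equiv_rays_sym[OF s])
  then have Se: "S \<in> \<epsilon>" using end_equiv[OF assms(1,2), of R] R st(3) S(1) by auto
  have "finite {b \<in> B'. \<not> (\<exists>r\<in>\<Union>(range ` insert S Rs). conn E (B' - X) b r)}" if X: "finite X" for X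
  proof (rule finite_subset)
    let ?bad = "{b \<in> B. \<not> (\<exists>r\<in>\<Union>(range ` Rs). conn E (B - X) b r)}"
    \<comment> \<open>The possible exceptions: \<open>X\<close> itself, the exceptions inherited
      from \<open>B\<close>, and the vertices of the finitely many paths hit by \<open>X\<close>.
      Any other vertex on a path of \<open>P\<close> can walk back to \<open>S\<close>.\<close>
    let ?fin = "X \<union> ?bad \<union> \<Union>(set ` {p \<in> P. set p \<inter> X \<noteq> {}})"
    show "finite ?fin" using X tight[OF X] disjoint_paths_finite_meet[OF P(2) X] by simp
    show "{b \<in> B'. \<not> (\<exists>r\<in>\<Union>(range ` insert S Rs). conn E (B' - X) b r)} \<subseteq> ?fin"
    proof (rule subsetI, rule ccontr)
      fix b assume b: "b \<in> {b \<in> B'. \<not> (\<exists>r\<in>\<Union>(range ` insert S Rs). conn E (B' - X) b r)}" and nf: "b \<notin> ?fin"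
      consider "b \<in> B" | "b \<in> range S" | p where "p \<in> P" "b \<in> set p" using b by (auto simp: B'_def)
      then have "\<exists>r\<in>\<Union>(range ` insert S Rs). conn E (B' - X) b r"
      proof cases
        case 1
        then obtain r where r: "r \<in> \<Union>(range ` Rs)" "conn E (B - X) b r" using nf by blast
        have "conn E (B' - X) b r" by (rule conn_mono[OF r(2)]) (auto simp: B'_def)
        then show ?thesis using r(1) by blast
      next
        case 2
        then have "conn E (B' - X) b b" using nf by (intro conn_refl) (auto simp: B'_def)
        then show ?thesis using 2 by blast
      next
        case 3
        then have "set p \<subseteq> B' - X" using nf by (auto simp: B'_def)
        then have "conn E (B' - X) b (hd p)" using 3 PV(2,3)[OF 3(1)] by (intro conn_path[OF s]) auto
        then show ?thesis using PV(4)[OF 3(1)] by blast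
      qed
      then show False using b by blast
    qed
  qed
  moreover have "disjoint_rays (insert S Rs)"
  proof -
    have "range S \<inter> range T = {}" if "T \<in> Rs" for T using st(6)[OF that] S(2) by blast
    then show ?thesis using st(4) unfolding disjoint_rays_def by blast
  qed
  moreover have "\<forall>T\<in>insert S Rs. range T \<subseteq> B'" using st(6) by (auto simp: B'_def)
  ultimately have "ray_stage V E \<epsilon> (insert S Rs) B' \<D>'"
    unfolding ray_stage_def using st(1,3) Se B'V D' unfolding B'_def[symmetric] by blast
  moreover have "B \<subseteq> B'" by (auto simp: B'_def)
  ultimately show ?thesis using S(2) R RX by blast
qed

text \<open>Each new ray is joined to an earlier one, so \<open>H\<close> is an infinite tree. The
  paths for its \<open>n\<close>-th edge lie in \<open>B (Suc n)\<close>, which all later rays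
  avoid; hence they remain paths for the final family.\<close>

lemma halin_countable:
  assumes "graph V E" "is_end V E \<epsilon>" "\<D> \<subseteq> \<epsilon>" "infinite \<D>" "disjoint_rays \<D>"
  shows "\<exists>\<R> H. \<R> \<subseteq> \<epsilon> \<and> disjoint_rays \<R> \<and> infinite \<R> \<and> countable \<R> \<and>
    is_ray_graph V E \<R> H \<and> connected_graph \<R> H"
proof -
  have s: "sym E" using assms(1) by (simp add: graph_def)
  define Stp where "Stp x y \<longleftrightarrow> (\<exists>S R. fst y = insert S (fst x) \<and> fst (snd x) \<subseteq> fst (snd y) \<and> range S \<inter> fst (snd x) = {} \<and>
     R \<in> fst x \<and> linked E (fst (snd y) - \<Union>(range ` (fst x - {R}))) (range S) (range R))"
    for x y :: "(nat \<Rightarrow> 'a) set \<times> 'a set \<times> (nat \<Rightarrow> 'a) set"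
  obtain D0 where D0: "D0 \<in> \<D>" using assms(4) by (metis ex_in_conv infinite_imp_nonempty)
  \<comment> \<open>The clause for \<open>n = 0\<close> pins the start of the sequence to
    \<open>{D0}\<close>, the root from which connectedness of \<open>H\<close> is proved.\<close>
  have "\<exists>f. \<forall>n::nat. (ray_stage V E \<epsilon> (fst (f n)) (fst (snd (f n))) (snd (snd (f n))) \<and> (n = 0 \<longrightarrow> fst (f n) = {D0})) \<and>
      Stp (f n) (f (Suc n))"
  proof (rule dependent_nat_choice)
    have dj: "range D \<inter> range D0 = {}" if "D \<in> \<D> - {D0}" for D using that D0 assms(5) by (auto simp: disjoint_rays_def)
    have "finite {b \<in> range D0. \<not> (\<exists>r\<in>\<Union>(range ` {D0}). conn E (range D0 - X) b r)}" if "finite X" for X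
    proof (rule finite_subset[OF _ that], rule subsetI, rule ccontr)
      fix b assume b: "b \<in> {b \<in> range D0. \<not> (\<exists>r\<in>\<Union>(range ` {D0}). conn E (range D0 - X) b r)}" "b \<notin> X"
      then have "conn E (range D0 - X) b b" by (intro conn_refl) auto
      then show False using b by auto
    qed
    moreover have "range D0 \<subseteq> V" using end_ray[OF assms(2)] D0 assms(3) by (auto simp: is_ray_def)
    moreover have "disjoint_rays (\<D> - {D0})" "disjoint_rays {D0}" using assms(5) by (auto simp: disjoint_rays_def)
    ultimately have "ray_stage V E \<epsilon> {D0} (range D0) (\<D> - {D0})"
      unfolding ray_stage_def using D0 assms(3,4) dj by auto
    then show "\<exists>x. ray_stage V E \<epsilon> (fst x) (fst (snd x)) (snd (snd x)) \<and> ((0::nat) = 0 \<longrightarrow> fst x = {D0})"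
      by (intro exI[of _ "({D0}, range D0, \<D> - {D0})"]) simp
  next
    fix x :: "(nat \<Rightarrow> 'a) set \<times> 'a set \<times> (nat \<Rightarrow> 'a) set" and n :: nat
    assume "ray_stage V E \<epsilon> (fst x) (fst (snd x)) (snd (snd x)) \<and> (n = 0 \<longrightarrow> fst x = {D0})"
    then have "ray_stage V E \<epsilon> (fst x) (fst (snd x)) (snd (snd x))" ..
    from ray_stage_extend[OF assms(1,2) this] obtain S B' \<D>' where
      "ray_stage V E \<epsilon> (insert S (fst x)) B' \<D>' \<and> fst (snd x) \<subseteq> B' \<and> range S \<inter> fst (snd x) = {} \<and>
       (\<exists>R\<in>fst x. linked E (B' - \<Union>(range ` (fst x - {R}))) (range S) (range R))" by (elim exE) (rule that)
    then show "\<exists>y. (ray_stage V E \<epsilon> (fst y) (fst (snd y)) (snd (snd y)) \<and> (Suc n = 0 \<longrightarrow> fst y = {D0})) \<and> Stp x y"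
      unfolding Stp_def by (intro exI[of _ "(insert S (fst x), B', \<D>')"]) auto
  qed
  then obtain f where f: "\<And>n. ray_stage V E \<epsilon> (fst (f n)) (fst (snd (f n))) (snd (snd (f n)))" "fst (f 0) = {D0}"
    "\<And>n. Stp (f n) (f (Suc n))" by blast
  define Rs where "Rs n = fst (f n)" for n
  define B where "B n = fst (snd (f n))" for n
  have R: "finite (Rs n)" "Rs n \<noteq> {}" "Rs n \<subseteq> \<epsilon>" "disjoint_rays (Rs n)" "B n \<subseteq> V" "\<And>R. R \<in> Rs n \<Longrightarrow> range R \<subseteq> B n" for n
    using f(1)[of n] by (auto simp: ray_stage_def Rs_def B_def)
  have "\<forall>n. \<exists>S R. Rs (Suc n) = insert S (Rs n) \<and> B n \<subseteq> B (Suc n) \<and> range S \<inter> B n = {} \<and>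
     R \<in> Rs n \<and> linked E (B (Suc n) - \<Union>(range ` (Rs n - {R}))) (range S) (range R)"
    using f(3) unfolding Stp_def Rs_def B_def by blast
  from choice[OF this] obtain S where "\<forall>n. \<exists>R. Rs (Suc n) = insert (S n) (Rs n) \<and> B n \<subseteq> B (Suc n) \<and> range (S n) \<inter> B n = {} \<and>
     R \<in> Rs n \<and> linked E (B (Suc n) - \<Union>(range ` (Rs n - {R}))) (range (S n)) (range R)" ..
  from choice[OF this] obtain T where T: "\<forall>n. Rs (Suc n) = insert (S n) (Rs n) \<and> B n \<subseteq> B (Suc n) \<and> range (S n) \<inter> B n = {} \<and>
     T n \<in> Rs n \<and> linked E (B (Suc n) - \<Union>(range ` (Rs n - {T n}))) (range (S n)) (range (T n))" ..
  have ST: "Rs (Suc n) = insert (S n) (Rs n)" "B n \<subseteq> B (Suc n)" "range (S n) \<inter> B n = {}" "T n \<in> Rs n"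
    "linked E (B (Suc n) - \<Union>(range ` (Rs n - {T n}))) (range (S n)) (range (T n))" for n
    using T by (simp_all only:)
  have Bm: "B i \<subseteq> B j" if "i \<le> j" for i j using lift_Suc_mono_le[of B, OF _ that] ST(2) by blast
  have Rm: "Rs i \<subseteq> Rs j" if "i \<le> j" for i j using lift_Suc_mono_le[of Rs, OF _ that] ST(1) by blast
  define \<R> where "\<R> = (\<Union>n. Rs n)"
  have split: "U \<in> Rs n \<or> (\<exists>m\<ge>n. U = S m)" if U: "U \<in> \<R>" for U n
  proof -
    have "U \<in> Rs n \<or> (\<exists>m\<ge>n. U = S m)" if "U \<in> Rs (n + k)" for k using that
    proof (induction k)
      case (Suc k)
      then have "U = S (n + k) \<or> U \<in> Rs (n + k)" using ST(1)[of "n + k"] by simp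
      then show ?case using Suc.IH le_add1[of n k] by blast
    qed simp
    moreover obtain k where "U \<in> Rs k" using U by (auto simp: \<R>_def)
    moreover have "Rs k \<subseteq> Rs (n + k)" by (rule Rm) simp
    ultimately show ?thesis by blast
  qed
  have far: "range U \<inter> B n = {}" if U: "U \<in> \<R>" "U \<notin> Rs n" for U n
  proof -
    obtain m where "m \<ge> n" "U = S m" using split[OF U(1), of n] U(2) by blast
    then show ?thesis using ST(3)[of m] Bm[of n m] by blast
  qed
  have Snew: "S n \<notin> Rs n" for n
  proof
    assume "S n \<in> Rs n"
    then have "S n 0 \<in> B n" using R(6) by blast
    then show False using ST(3)[of n] by blast
  qed
  have SR: "S n \<in> \<R>" "T n \<in> \<R>" for n using ST(1,4) by (auto simp: \<R>_def)
  have dR: "disjoint_rays \<R>" unfolding disjoint_rays_def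
  proof (intro ballI impI)
    fix U W assume U: "U \<in> \<R>" "W \<in> \<R>" "U \<noteq> W"
    then obtain i j where "U \<in> Rs i" "W \<in> Rs j" by (auto simp: \<R>_def)
    then have "U \<in> Rs (max i j)" "W \<in> Rs (max i j)" using Rm[of i "max i j"] Rm[of j "max i j"] by auto
    then show "range U \<inter> range W = {}" using R(4)[of "max i j"] U(3) by (simp add: disjoint_rays_def)
  qed
  have Sinj: "S i \<noteq> S j" if "i < j" for i j
  proof -
    have "S i \<in> Rs j" using ST(1)[of i] Rm[of "Suc i" j] that by auto
    then show ?thesis using Snew[of j] by auto
  qed
  have "inj S" by (rule injI) (metis Sinj linorder_neqE_nat)
  then have "infinite (range S)" using finite_imageD by blast
  moreover have "range S \<subseteq> \<R>" using SR by blast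
  ultimately have infR: "infinite \<R>" using finite_subset by blast
  have cR: "countable \<R>" unfolding \<R>_def using R(1) by (simp add: countable_finite)
  have RE: "\<R> \<subseteq> \<epsilon>" unfolding \<R>_def using R(3) by blast
  define H where "H = (\<Union>n. {(S n, T n), (T n, S n)})"
  have ne: "S n \<noteq> T n" for n using Snew ST(4) by metis
  have H: "(x, y) \<in> H \<longleftrightarrow> (\<exists>n. (x = S n \<and> y = T n) \<or> (x = T n \<and> y = S n))" for x y
    by (auto simp: H_def)
  have gH: "graph \<R> H" unfolding graph_def
  proof (intro conjI allI)
    show "H \<subseteq> \<R> \<times> \<R>" using SR by (auto simp: H_def)
    show "sym H" unfolding sym_def H by blast
    show "(v, v) \<notin> H" for v unfolding H using ne by metis
  qed
  define Q where "Q n = {p. AB_path V E (range (S n)) (range (T n)) p \<and> Rpath V E \<R> p}" for n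
  have Q: "\<exists>p\<in>Q n. p \<noteq> [] \<and> set p \<inter> X = {}" if X: "finite X" for X n
  proof -
    let ?W = "B (Suc n) - \<Union>(range ` (Rs n - {T n})) - X"
    obtain a b where ab: "a \<in> range (S n)" "b \<in> range (T n)" "conn E ?W a b" by (rule linkedE[OF ST(5) X])
    have "?W \<subseteq> V" using R(5)[of "Suc n"] by auto
    from conn_AB_path[OF ab(3) this ab(1,2)] obtain p where p: "AB_path V E (range (S n)) (range (T n)) p" "set p \<subseteq> ?W" by blast
    have p': "is_path V E p" "p \<noteq> []" "distinct p" "set p \<inter> range (S n) = {hd p}" "set p \<inter> range (T n) = {last p}"
      using p(1) by (auto simp: AB_path_def is_path_def)
    have dST: "range (S n) \<inter> range (T n) = {}" using dR SR ne by (auto simp: disjoint_rays_def)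
    have hl: "hd p \<noteq> last p" using p' dST by blast
    have len: "length p \<ge> 2" and inn: "inner p \<subseteq> set p - {hd p, last p}" using inner_path[OF p'(2,3) hl] by auto
    have "inner p \<inter> range U = {}" if U: "U \<in> \<R>" for U
    proof (cases "U \<in> Rs (Suc n)")
      case False
      then have "range U \<inter> B (Suc n) = {}" using far U by blast
      then show ?thesis using inn p(2) by blast
    next
      case True
      then consider "U = S n" | "U = T n" | "U \<in> Rs n - {T n}" using ST(1) by blast
      then show ?thesis
      proof cases
        case 1 then show ?thesis using inn p'(4) by blast
      next
        case 2 then show ?thesis using inn p'(5) by blast
      next
        case 3 then show ?thesis using inn p(2) by blast
      qed
    qed
    then have "inner p \<inter> (\<Union>R\<in>\<R>. range R) = {}" by blast
    moreover have "hd p \<in> (\<Union>R\<in>\<R>. range R)" "last p \<in> (\<Union>R\<in>\<R>. range R)" using p'(4,5) SR[of n] by blast+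
    ultimately have "Rpath V E \<R> p" using p'(1) len by (simp only: Rpath_def)
    then show ?thesis using p p'(2) by (intro bexI[of _ p]) (auto simp: Q_def)
  qed
  \<comment> \<open>Under \<open>prod_decode\<close> every edge index recurs infinitely often, so a
    single greedy run supplies each edge with infinitely many paths, all disjoint and hence
    independent.\<close>
  obtain g :: "nat \<Rightarrow> 'a list" where g: "\<forall>t. g t \<in> Q (fst (prod_decode t)) \<and> g t \<noteq> []" "\<forall>s t. s \<noteq> t \<longrightarrow> set (g s) \<inter> set (g t) = {}"
    using greedy_sequence[of "\<lambda>t. Q (fst (prod_decode t))"] Q by blast
  have injg: "inj g" using inj_disjoint_sequence[of g] g by blast
  have "is_ray_graph V E \<R> H" unfolding is_ray_graph_def
  proof (intro conjI exI[of _ "range g"])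
    show "graph \<R> H" by fact
    show "\<forall>p\<in>range g. Rpath V E \<R> p" using g(1) by (auto simp: Q_def)
    show "independent_paths (range g)" unfolding independent_paths_def
    proof (intro ballI impI)
      fix p q assume "p \<in> range g" "q \<in> range g" "p \<noteq> q"
      then have "set p \<inter> set q = {}" using g(2) by (metis imageE)
      then show "inner p \<inter> set q = {}" using inner_subset[of p] by blast
    qed
    show "\<forall>(R, Sa)\<in>H. \<exists>Q\<subseteq>range g. infinite Q \<and> disjoint_paths Q \<and> (\<forall>p\<in>Q. RS_path V E R Sa p)"
    proof (rule ballI, clarify)
      fix R R' assume "(R, R') \<in> H"
      then obtain n where n: "(R = S n \<and> R' = T n) \<or> (R = T n \<and> R' = S n)" by (auto simp: H_def)
      let ?Q = "range (\<lambda>j. g (prod_encode (n, j)))"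
      have "inj (\<lambda>j. g (prod_encode (n, j)))"
      proof (rule injI)
        fix i j assume "g (prod_encode (n, i)) = g (prod_encode (n, j))"
        then have "prod_encode (n, i) = prod_encode (n, j)" by (rule injD[OF injg])
        then show "i = j" by simp
      qed
      then have "infinite ?Q" using finite_imageD by blast
      moreover have "disjoint_paths ?Q" unfolding disjoint_paths_def
      proof (intro ballI impI)
        fix p q assume "p \<in> ?Q" "q \<in> ?Q" "p \<noteq> q"
        then obtain i j where "p = g (prod_encode (n, i))" "q = g (prod_encode (n, j))" "prod_encode (n, i) \<noteq> prod_encode (n, j)" by auto
        then show "set p \<inter> set q = {}" using g(2) by blast
      qed
      moreover have "RS_path V E R R' p" if "p \<in> ?Q" for p
      proof -
        obtain j where "p = g (prod_encode (n, j))" using \<open>p \<in> ?Q\<close> by blast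
        then have "p \<in> Q n" using g(1)[rule_format, of "prod_encode (n, j)"] by simp
        then have "AB_path V E (range (S n)) (range (T n)) p" by (simp add: Q_def)
        then show ?thesis using n AB_path_rev[OF s] unfolding RS_path_def by blast
      qed
      ultimately show "\<exists>Q\<subseteq>range g. infinite Q \<and> disjoint_paths Q \<and> (\<forall>p\<in>Q. RS_path V E R R' p)"
        by (intro exI[of _ ?Q]) blast
    qed
  qed
  moreover have "connected_graph \<R> H"
  proof -
    have symH: "sym H" using gH by (simp add: graph_def)
    have "\<forall>U\<in>Rs n. (D0, U) \<in> H\<^sup>*" for n
    proof (induction n)
      case 0 then show ?case using f(2) by (simp add: Rs_def)
    next
      case (Suc n)
      have "(T n, S n) \<in> H" by (auto simp: H_def)
      then have "(D0, S n) \<in> H\<^sup>*" using Suc ST(4)[of n] by (meson rtrancl.rtrancl_into_rtrancl)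
      then show ?case using Suc ST(1)[of n] by simp
    qed
    then have c: "(D0, U) \<in> H\<^sup>*" if "U \<in> \<R>" for U using that by (auto simp: \<R>_def)
    have "(U, W) \<in> H\<^sup>*" if "U \<in> \<R>" "W \<in> \<R>" for U W
      using symD[OF sym_rtrancl[OF symH] c[OF that(1)]] c[OF that(2)] by (rule rtrancl_trans)
    moreover have "\<R> \<noteq> {}" using infR by auto
    ultimately show ?thesis by (simp add: connected_graph_def)
  qed
  ultimately show ?thesis using RE dR infR cR by (intro exI[of _ \<R>] exI[of _ H]) simp
qed

section \<open>Stars of rays of uncountable size\<close>

lemma card_of_not_ordLeq: "\<not> |A| \<le>o |B| \<longleftrightarrow> |B| <o |A|"
  by (rule not_ordLeq_iff_ordLess[OF card_of_Well_order card_of_Well_order])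

lemma countable_ordLess_uncountable:
  assumes "countable C" "uncountable J" shows "|C| <o |J|"
proof (rule ccontr)
  assume "\<not> |C| <o |J|"
  then have "|J| \<le>o |C|" using card_of_not_ordLeq by blast
  then show False using countable_ordLeq assms by blast
qed

lemma card_of_Diff_small:
  assumes "infinite J" "|C| <o |J|" shows "|J - C| =o |J|"
proof (rule ccontr)
  assume n: "\<not> |J - C| =o |J|"
  have "|J - C| \<le>o |J|" by (intro card_of_mono1) auto
  then have "|J - C| <o |J|" using n ordLeq_iff_ordLess_or_ordIso by blast
  then have "|(J - C) \<union> C| <o |J|" using card_of_Un_ordLess_infinite assms by blast
  moreover have "|J| \<le>o |(J - C) \<union> C|" by (intro card_of_mono1) auto
  ultimately show False using not_ordLess_ordLeq by blast
qed

lemma card_of_Diff_countable: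
  assumes "uncountable J" "countable C" shows "|J - C| =o |J|"
  using card_of_Diff_small[OF _ countable_ordLess_uncountable[OF assms(2,1)]] assms(1) countable_finite by blast

lemma uncountable_ordIso: "|A| =o |B| \<Longrightarrow> uncountable B \<Longrightarrow> uncountable A"
  using countable_ordLeq ordIso_iff_ordLeq by blast

lemma disjoint_family_meet:
  assumes "\<And>i j. i \<in> J \<Longrightarrow> j \<in> J \<Longrightarrow> i \<noteq> j \<Longrightarrow> Z i \<inter> Z j = {}"
  shows "|{j \<in> J. Z j \<inter> C \<noteq> {}}| \<le>o |C|"
proof -
  let ?J = "{j \<in> J. Z j \<inter> C \<noteq> {}}"
  have "\<forall>j\<in>?J. \<exists>x. x \<in> Z j \<inter> C" by blast
  from bchoice[OF this] obtain f where f: "\<forall>j\<in>?J. f j \<in> Z j \<inter> C" ..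
  have "inj_on f ?J"
  proof (rule inj_onI, rule ccontr)
    fix i j assume ij: "i \<in> ?J" "j \<in> ?J" "f i = f j" "i \<noteq> j"
    then have "Z i \<inter> Z j = {}" using assms by simp
    then show False using bspec[OF f ij(1)] bspec[OF f ij(2)] ij(3) by auto
  qed
  then show ?thesis by (rule card_of_ordLeqI) (use f in blast)
qed

lemma disjoint_family_meet_finite:
  assumes "\<And>i j. i \<in> J \<Longrightarrow> j \<in> J \<Longrightarrow> i \<noteq> j \<Longrightarrow> Z i \<inter> Z j = {}" "finite C"
  shows "finite {j \<in> J. Z j \<inter> C \<noteq> {}}"
  using card_of_ordLeq_finite[OF disjoint_family_meet[of J Z C]] assms by blast

lemma disjoint_family_meet_countable:
  assumes "\<And>i j. i \<in> J \<Longrightarrow> j \<in> J \<Longrightarrow> i \<noteq> j \<Longrightarrow> Z i \<inter> Z j = {}" "countable C"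
  shows "countable {j \<in> J. Z j \<inter> C \<noteq> {}}"
  using countable_ordLeq[OF disjoint_family_meet[of J Z C]] assms by blast

text \<open>Let \<open>M\<close> be a maximal disjoint subfamily. Every other \<open>Z j\<close>
  meets the union over \<open>M\<close>, whose points each lie in countably many \<open>Z j\<close>.
  So \<open>J\<close> is countable if \<open>M\<close> is finite, and no larger than
  \<open>M\<close> otherwise.\<close>

lemma large_disjoint_subfamily:
  assumes "uncountable J" "\<And>j. j \<in> J \<Longrightarrow> countable (Z j)" "\<And>v. countable {j \<in> J. v \<in> Z j}"
  shows "\<exists>J'\<subseteq>J. |J'| =o |J| \<and> (\<forall>i\<in>J'. \<forall>j\<in>J'. i \<noteq> j \<longrightarrow> Z i \<inter> Z j = {})"
proof -
  define Q where "Q A \<longleftrightarrow> A \<subseteq> J \<and> (\<forall>i\<in>A. \<forall>j\<in>A. i \<noteq> j \<longrightarrow> Z i \<inter> Z j = {})" for A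
  have "\<exists>M\<in>Collect Q. \<forall>X\<in>Collect Q. M \<subseteq> X \<longrightarrow> X = M"
  proof (rule subset_Zorn_nonempty)
    have "Q {}" by (simp add: Q_def)
    then show "Collect Q \<noteq> {}" by blast
    fix \<C> assume ch: "subset.chain (Collect Q) \<C>"
    have sub: "\<And>A. A \<in> \<C> \<Longrightarrow> Q A" and lin: "\<And>A B. A \<in> \<C> \<Longrightarrow> B \<in> \<C> \<Longrightarrow> A \<subseteq> B \<or> B \<subseteq> A"
      using ch unfolding subset_chain_def by auto
    have "Z i \<inter> Z j = {}" if ij: "i \<in> \<Union>\<C>" "j \<in> \<Union>\<C>" "i \<noteq> j" for i j
    proof -
      obtain A B where AB: "A \<in> \<C>" "B \<in> \<C>" "i \<in> A" "j \<in> B" using ij by blast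
      then obtain D where D: "D \<in> \<C>" "i \<in> D" "j \<in> D" using lin[OF AB(1,2)] by blast
      show ?thesis using sub[OF D(1)] D(2,3) ij(3) unfolding Q_def by simp
    qed
    moreover have "\<Union>\<C> \<subseteq> J" using sub by (auto simp: Q_def)
    ultimately show "\<Union>\<C> \<in> Collect Q" by (simp add: Q_def)
  qed
  then obtain M where QM: "Q M" and max: "\<And>X. Q X \<Longrightarrow> M \<subseteq> X \<Longrightarrow> X = M" by auto
  have M: "M \<subseteq> J" "\<forall>i\<in>M. \<forall>j\<in>M. i \<noteq> j \<longrightarrow> Z i \<inter> Z j = {}" using QM by (simp_all add: Q_def)
  let ?T = "M \<union> (\<Union>v\<in>(\<Union>i\<in>M. Z i). {j \<in> J. v \<in> Z j})"
  have cover: "J \<subseteq> ?T"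
  proof (rule subsetI, rule ccontr)
    fix j assume j: "j \<in> J" "j \<notin> ?T"
    then have d: "Z j \<inter> Z i = {}" if "i \<in> M" for i using that by blast
    have d': "Z i \<inter> Z j = {}" if "i \<in> M" for i using d[OF that] by (simp add: Int_commute)
    have "Q (insert j M)" using QM j(1) d d' by (simp add: Q_def)
    then show False using max[of "insert j M"] j by blast
  qed
  have "|J| \<le>o |M|"
  proof (cases "finite M")
    case True
    have cM: "countable M" using True by (rule countable_finite)
    have "countable (\<Union>i\<in>M. Z i)" using M(1) assms(2) by (intro countable_UN[OF cM]) auto
    then have "countable (\<Union>v\<in>(\<Union>i\<in>M. Z i). {j \<in> J. v \<in> Z j})" by (rule countable_UN) (rule assms(3))
    then have "countable ?T" using cM by (rule countable_Un[rotated])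
    then show ?thesis using cover assms(1) countable_subset by blast
  next
    case False
    have c: "|C| \<le>o |M|" if "countable C" for C :: "'c set"
      using that False by (meson countable_card_le_natLeq infinite_iff_natLeq_ordLeq ordLeq_transitive)
    have c': "|C| \<le>o |M|" if "countable C" for C :: "'b set"
      using that False by (meson countable_card_le_natLeq infinite_iff_natLeq_ordLeq ordLeq_transitive)
    have 1: "|\<Union>i\<in>M. Z i| \<le>o |M|"
      using M(1) assms(2) by (intro card_of_UNION_ordLeq_infinite[OF False ordLeq_refl] ballI c' c) (auto simp: card_of_Card_order)
    have "|\<Union>v\<in>(\<Union>i\<in>M. Z i). {j \<in> J. v \<in> Z j}| \<le>o |M|"
      using assms(3) by (intro card_of_UNION_ordLeq_infinite[OF False 1] ballI c c')
    then have "|?T| \<le>o |M|" using False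
      by (intro card_of_Un_ordLeq_infinite_Field card_of_mono1[OF order_refl] card_of_Card_order)
        (simp_all add: Field_card_of)
    then show ?thesis using card_of_mono1[OF cover] ordLeq_transitive by blast
  qed
  then have "|M| =o |J|" using card_of_mono1[OF M(1)] by (simp add: ordIso_iff_ordLeq)
  then show ?thesis using M by blast
qed

text \<open>The nodes at bounded distance from a fixed node of the quotient form the sets
  \<open>B n\<close>. If all degrees were below \<open>K\<close>, regularity would keep each
  \<open>B n\<close> below \<open>K\<close>, and, \<open>K\<close> being uncountable, their
  countable union too; by connectedness this union is everything.\<close>

lemma connected_large_degree:
  fixes K :: "'k set" and \<phi> :: "'b \<Rightarrow> 'c"
  assumes K: "Cinfinite |K|" "regularCard |K|" "uncountable K"
    and H: "connected_graph M H" "H \<subseteq> M \<times> M" and big: "\<not> |\<phi> ` M| <o |K|"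
  shows "\<exists>\<nu>\<in>\<phi> ` M. \<not> |{\<phi> y | x y. (x, y) \<in> H \<and> \<phi> x = \<nu>}| <o |K|"
proof (rule ccontr)
  assume n: "\<not> ?thesis"
  define N where "N \<nu> = {\<phi> y | x y. (x, y) \<in> H \<and> \<phi> x = \<nu>}" for \<nu>
  have N: "|N \<nu>| <o |K|" if "\<nu> \<in> \<phi> ` M" for \<nu> using n that by (auto simp: N_def)
  have infK: "infinite K" using K(3) countable_finite by blast
  obtain x0 where x0: "x0 \<in> M" using H(1) by (auto simp: connected_graph_def)
  define B where "B = rec_nat {\<phi> x0} (\<lambda>_ B. B \<union> (\<Union>\<nu>\<in>B. N \<nu>))"
  have B0: "B 0 = {\<phi> x0}" and BS: "\<And>n. B (Suc n) = B n \<union> (\<Union>\<nu>\<in>B n. N \<nu>)" by (simp_all add: B_def)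
  have B: "B n \<subseteq> \<phi> ` M \<and> |B n| <o |K|" for n
  proof (induction n)
    case 0
    have "|{\<phi> x0}| <o |K|" using K(3) by (intro countable_ordLess_uncountable) auto
    then show ?case using x0 B0 by simp
  next
    case (Suc n)
    have "|\<Union>\<nu>\<in>B n. N \<nu>| <o |K|" using Suc N by (intro regularCard_UNION_bound[OF K(1,2)]) auto
    then have "|B (Suc n)| <o |K|" unfolding BS using Suc by (intro card_of_Un_ordLess_infinite[OF infK]) auto
    moreover have "N \<nu> \<subseteq> \<phi> ` M" for \<nu> using H(2) by (auto simp: N_def)
    ultimately show ?case using Suc BS by auto
  qed
  have "|UNIV :: nat set| <o |K|" using K(3) by (intro countable_ordLess_uncountable) auto
  then have U: "|\<Union>n. B n| <o |K|" using B by (intro regularCard_UNION_bound[OF K(1,2)]) auto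
  have "\<phi> y \<in> (\<Union>n. B n)" if "(x0, y) \<in> H\<^sup>*" for y using that
  proof (induction rule: rtrancl_induct)
    case base then show ?case using B0 by auto
  next
    case (step y z)
    then obtain n where n: "\<phi> y \<in> B n" by blast
    have "\<phi> z \<in> N (\<phi> y)" using step(2) by (auto simp: N_def)
    then have "\<phi> z \<in> B (Suc n)" using n BS by blast
    then show ?case by blast
  qed
  then have "\<phi> ` M \<subseteq> (\<Union>n. B n)" using H(1) x0 by (auto simp: connected_graph_def)
  then have "|\<phi> ` M| \<le>o |\<Union>n. B n|" by (rule card_of_mono1)
  then show False using U big ordLeq_ordLess_trans by blast
qed

lemma ray_through_countable_set:
  assumes s: "sym E" and U: "infinite U" "countable U" "U \<subseteq> V"
    and con: "\<And>X u v. finite X \<Longrightarrow> u \<in> U - X \<Longrightarrow> v \<in> U - X \<Longrightarrow> conn E (V - X) u v"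
  shows "\<exists>C. is_ray V E C \<and> U \<subseteq> range C"
proof -
  have e: "range (from_nat_into U) = U" using U by (simp add: range_from_nat_into infinite_imp_nonempty)
  let ?e = "from_nat_into U"
  have "\<exists>p. \<forall>k. (is_path V E (p k) \<and> last (p k) \<in> U) \<and> ((\<exists>t. t \<noteq> [] \<and> p (Suc k) = p k @ t) \<and> ?e k \<in> set (p (Suc k)))"
  proof (rule dependent_nat_choice)
    have "is_path V E [?e 0]" using e U(3) by (intro is_path_single) blast
    then show "\<exists>p. is_path V E p \<and> last p \<in> U" using e by (intro exI[of _ "[?e 0]"]) auto
  next
    fix p k assume p: "is_path V E p \<and> last p \<in> U"
    have pne: "p \<noteq> []" using p by (auto simp: is_path_def)
    \<comment> \<open>If the \<open>k\<close>-th vertex of \<open>U\<close> is already on the path,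
      any fresh vertex of \<open>U\<close> is taken instead, so that the extension is proper as
      \<open>ray_limit\<close> demands.\<close>
    have "\<exists>v\<in>U - set p. ?e k \<in> insert v (set p)"
    proof (cases "?e k \<in> set p")
      case True
      have "infinite (U - set p)" using U(1) by simp
      then show ?thesis using True by (metis ex_in_conv infinite_imp_nonempty insertCI)
    next
      case False
      then show ?thesis using e by blast
    qed
    then obtain v where v: "v \<in> U - set p" "?e k \<in> insert v (set p)" by blast
    let ?X = "set p - {last p}"
    have "conn E (V - ?X) (last p) v" using p v by (intro con) auto
    from conn_imp_path[OF this] obtain q where q: "is_path V E q" "set q \<subseteq> V - ?X" "hd q = last p" "last q = v" by auto
    have qne: "q \<noteq> []" using q(1) by (auto simp: is_path_def)
    have int: "set p \<inter> set q = {hd q}"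
    proof
      show "set p \<inter> set q \<subseteq> {hd q}" using q(2,3) by auto
      show "{hd q} \<subseteq> set p \<inter> set q" using q(3) pne qne hd_in_set[of q] last_in_set[of p] by auto
    qed
    have p1: "is_path V E p" using p by simp
    note J = is_path_join[OF p1 q(1) int q(3)[symmetric]]
    have "hd q \<noteq> last q" using q(3,4) v(1) last_in_set[OF pne] by (metis DiffE)
    then have "tl q \<noteq> []" using qne by (cases q) auto
    moreover have "?e k \<in> set (p @ tl q)" unfolding J(2) using v(2) q(4) qne last_in_set[of q] by auto
    ultimately show "\<exists>y. (is_path V E y \<and> last y \<in> U) \<and> ((\<exists>t. t \<noteq> [] \<and> y = p @ t) \<and> ?e k \<in> set y)"
      using J(1,3) q(4) v(1) by (intro exI[of _ "p @ tl q"]) auto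
  qed
  then obtain p where p: "\<And>k. is_path V E (p k)" "\<And>k. \<exists>t. t \<noteq> [] \<and> p (Suc k) = p k @ t" "\<And>k. ?e k \<in> set (p (Suc k))"
    by blast
  obtain C where C: "is_ray V E C" "range C = (\<Union>k. set (p k))" using ray_limit[of V E p, OF p(1) p(2)] by blast
  have "U \<subseteq> range C"
  proof
    fix u assume "u \<in> U"
    then obtain k where "u = ?e k" using e by (metis imageE)
    then show "u \<in> range C" unfolding C(2) using p(3)[of k] by (intro UN_I[of "Suc k"]) simp_all
  qed
  then show ?thesis using C(1) by blast
qed

text \<open>Each territory \<open>Z j\<close> contains \<open>N j\<close> together with the inner
  vertices of its paths to \<open>C\<close>. Disjointness of the territories makes paths for
  different \<open>j\<close> independent and keeps them off the other rays.\<close>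

lemma star_ray_graph:
  assumes G: "graph V E" and J: "uncountable J" and C: "is_ray V E C"
    and N: "\<And>j. j \<in> J \<Longrightarrow> is_ray V E (N j)" "\<And>j. j \<in> J \<Longrightarrow> range (N j) \<subseteq> Z j"
    and Z: "\<And>i j. i \<in> J \<Longrightarrow> j \<in> J \<Longrightarrow> i \<noteq> j \<Longrightarrow> Z i \<inter> Z j = {}" "\<And>j. j \<in> J \<Longrightarrow> Z j \<inter> range C = {}"
    and att: "\<And>j. j \<in> J \<Longrightarrow> linked E ((Z j \<union> range C) \<inter> V) (range (N j)) (range C)"
  shows "\<exists>H. disjoint_rays (insert C (N ` J)) \<and> |insert C (N ` J)| =o |J| \<and>
    is_ray_graph V E (insert C (N ` J)) H \<and> connected_graph (insert C (N ` J)) H"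
proof -
  have s: "sym E" using G by (simp add: graph_def)
  let ?R = "insert C (N ` J)"
  have CN: "range C \<inter> range (N j) = {}" if "j \<in> J" for j using N(2)[OF that] Z(2)[OF that] by blast
  have NN: "range (N i) \<inter> range (N j) = {}" if "i \<in> J" "j \<in> J" "i \<noteq> j" for i j
    using N(2)[OF that(1)] N(2)[OF that(2)] Z(1)[OF that] by blast
  have neq: "C \<noteq> N j" if "j \<in> J" for j using CN[OF that] by auto
  have injN: "inj_on N J"
  proof (rule inj_onI, rule ccontr)
    fix i j assume ij: "i \<in> J" "j \<in> J" "N i = N j" "i \<noteq> j"
    show False using NN[OF ij(1,2,4)] ij(3) by auto
  qed
  have dR: "disjoint_rays ?R" unfolding disjoint_rays_def
  proof (intro ballI impI)
    fix R S assume "R \<in> ?R" "S \<in> ?R" "R \<noteq> S"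
    then show "range R \<inter> range S = {}" using CN NN by blast
  qed
  have infJ: "infinite J" using J countable_finite by blast
  have card: "|?R| =o |J|"
  proof -
    have 1: "|N ` J| =o |J|" using card_of_ordIsoI[OF inj_on_imp_bij_betw[OF injN]] ordIso_symmetric by blast
    have "|{C} \<union> N ` J| \<le>o |J|"
    proof (rule card_of_Un_ordLeq_infinite_Field)
      show "infinite (Field |J| )" using infJ by (simp add: Field_card_of)
      have "|{C}| <o |J|" by (rule countable_ordLess_uncountable[OF _ J]) simp
      then show "|{C}| \<le>o |J|" by (rule ordLess_imp_ordLeq)
      show "|N ` J| \<le>o |J|" by (rule card_of_image)
    qed (simp add: card_of_Card_order)
    moreover have "|J| \<le>o |?R|"
      using ordIso_ordLeq_trans[OF ordIso_symmetric[OF 1] card_of_mono1[of "N ` J" ?R]] by blast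
    ultimately show ?thesis by (simp add: ordIso_iff_ordLeq)
  qed
  have "\<forall>j\<in>J. \<exists>P. infinite P \<and> disjoint_paths P \<and> (\<forall>p\<in>P. AB_path V E (range (N j)) (range C) p \<and> set p \<subseteq> Z j \<union> range C)"
  proof
    fix j assume "j \<in> J"
    then show "\<exists>P. infinite P \<and> disjoint_paths P \<and> (\<forall>p\<in>P. AB_path V E (range (N j)) (range C) p \<and> set p \<subseteq> Z j \<union> range C)"
      unfolding disjoint_AB_paths_iff[OF s] using att by blast
  qed
  from bchoice[OF this] obtain P where P: "\<forall>j\<in>J. infinite (P j) \<and> disjoint_paths (P j) \<and>
    (\<forall>p\<in>P j. AB_path V E (range (N j)) (range C) p \<and> set p \<subseteq> Z j \<union> range C)" ..
  have pr: "is_path V E p" "p \<noteq> []" "length p \<ge> 2" "inner p \<subseteq> Z j - range (N j)" "hd p \<in> range (N j)" "last p \<in> range C"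
      "set p \<subseteq> Z j \<union> range C" "AB_path V E (range (N j)) (range C) p"
    if jp: "j \<in> J" "p \<in> P j" for j p
  proof -
    show ab: "AB_path V E (range (N j)) (range C) p" "set p \<subseteq> Z j \<union> range C" using P jp by blast+
    then show p: "is_path V E p" "p \<noteq> []" by (auto simp: AB_path_def is_path_def)
    have hl: "set p \<inter> range (N j) = {hd p}" "set p \<inter> range C = {last p}" using ab by (simp_all add: AB_path_def)
    have "hd p \<in> set p \<inter> range (N j)" "last p \<in> set p \<inter> range C" unfolding hl by simp_all
    then show 2: "hd p \<in> range (N j)" "last p \<in> range C" by simp_all
    have ne: "hd p \<noteq> last p" using 2 CN[OF jp(1)] by (metis disjoint_iff)
    have "distinct p" using p by (simp add: is_path_def)
    note I = inner_path[OF p(2) this ne]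
    show "length p \<ge> 2" by (rule I)
    show "inner p \<subseteq> Z j - range (N j)"
    proof
      fix x assume "x \<in> inner p"
      then have "x \<in> set p" "x \<noteq> hd p" "x \<noteq> last p" using I(2) by auto
      then have "x \<notin> range (N j)" "x \<notin> range C" "x \<in> Z j \<union> range C" using hl ab(2) by auto
      then show "x \<in> Z j - range (N j)" by simp
    qed
  qed
  define H where "H = (\<Union>j\<in>J. {(C, N j), (N j, C)})"
  have Hiff: "(x, y) \<in> H \<longleftrightarrow> (\<exists>j\<in>J. (x = C \<and> y = N j) \<or> (x = N j \<and> y = C))" for x y by (auto simp: H_def)
  have "is_ray_graph V E ?R H" unfolding is_ray_graph_def
  proof (intro conjI exI[of _ "\<Union>(P ` J)"])
    show "graph ?R H" unfolding graph_def
    proof (intro conjI allI)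
      show "H \<subseteq> ?R \<times> ?R" by (auto simp: H_def)
      show "sym H" unfolding sym_def Hiff by blast
      show "(v, v) \<notin> H" for v unfolding Hiff using neq by metis
    qed
    show "\<forall>p\<in>\<Union>(P ` J). Rpath V E ?R p"
    proof
      fix p assume "p \<in> \<Union>(P ` J)"
      then obtain j where j: "j \<in> J" "p \<in> P j" by blast
      note q = pr[OF j]
      have "inner p \<inter> range R = {}" if R: "R \<in> ?R" for R
      proof -
        consider "R = C" | "R = N j" | i where "i \<in> J" "i \<noteq> j" "R = N i" using R by blast
        then show ?thesis
        proof cases
          case 1 then show ?thesis using q(4) Z(2)[OF j(1)] by blast
        next
          case 2 then show ?thesis using q(4) by blast
        next
          case 3 then show ?thesis using q(4) N(2)[OF 3(1)] Z(1)[OF 3(1) j(1) 3(2)] by blast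
        qed
      qed
      then have "inner p \<inter> (\<Union>R\<in>?R. range R) = {}" by blast
      moreover have "hd p \<in> (\<Union>R\<in>?R. range R)" "last p \<in> (\<Union>R\<in>?R. range R)" using q(5,6) j(1) by blast+
      ultimately show "Rpath V E ?R p" using q(1,3) by (simp only: Rpath_def)
    qed
    show "independent_paths (\<Union>(P ` J))" unfolding independent_paths_def
    proof (intro ballI impI)
      fix p q assume "p \<in> \<Union>(P ` J)" "q \<in> \<Union>(P ` J)" and ne: "p \<noteq> q"
      then obtain i j where i: "i \<in> J" "p \<in> P i" and j: "j \<in> J" "q \<in> P j" by blast
      show "inner p \<inter> set q = {}"
      proof (cases "i = j")
        case True
        then have "set p \<inter> set q = {}" using P i j ne by (auto simp: disjoint_paths_def)
        then show ?thesis using inner_subset[of p] by blast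
      next
        case False
        have "set q \<subseteq> Z j \<union> range C" "inner p \<subseteq> Z i" using pr(7)[OF j] pr(4)[OF i] by auto
        then show ?thesis using Z(1)[OF i(1) j(1) False] Z(2)[OF i(1)] by blast
      qed
    qed
    show "\<forall>(R, S)\<in>H. \<exists>Q\<subseteq>\<Union>(P ` J). infinite Q \<and> disjoint_paths Q \<and> (\<forall>p\<in>Q. RS_path V E R S p)"
    proof (rule ballI, clarify)
      fix R S assume "(R, S) \<in> H"
      then obtain j where j: "j \<in> J" "(R = C \<and> S = N j) \<or> (R = N j \<and> S = C)" unfolding Hiff by blast
      have "RS_path V E R S p" if "p \<in> P j" for p
        using pr(8)[OF j(1) that] j(2) AB_path_rev[OF s] unfolding RS_path_def by blast
      moreover have "infinite (P j)" "disjoint_paths (P j)" using P j(1) by blast+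
      ultimately show "\<exists>Q\<subseteq>\<Union>(P ` J). infinite Q \<and> disjoint_paths Q \<and> (\<forall>p\<in>Q. RS_path V E R S p)"
        using j(1) by (intro exI[of _ "P j"]) auto
    qed
  qed
  moreover have "connected_graph ?R H"
  proof -
    have c: "(C, R) \<in> H\<^sup>*" "(R, C) \<in> H\<^sup>*" if "R \<in> ?R" for R using that by (auto simp: H_def)
    have "(R, S) \<in> H\<^sup>*" if "R \<in> ?R" "S \<in> ?R" for R S using c(2)[OF that(1)] c(1)[OF that(2)] by (rule rtrancl_trans)
    then show ?thesis by (simp add: connected_graph_def)
  qed
  ultimately show ?thesis using dR card by blast
qed

definition has_connected_ray_graph ::
    "'a set \<Rightarrow> ('a \<times> 'a) set \<Rightarrow> (nat \<Rightarrow> 'a) set \<Rightarrow> 'k rel \<Rightarrow> bool" where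
  "has_connected_ray_graph V E \<epsilon> r \<longleftrightarrow> (\<exists>\<R> H. \<R> \<subseteq> \<epsilon> \<and> disjoint_rays \<R> \<and> |\<R>| =o r \<and>
     is_ray_graph V E \<R> H \<and> connected_graph \<R> H)"

lemma HC_counterexample_iff:
  "HC_counterexample V E \<epsilon> r \<longleftrightarrow> graph V E \<and> is_end V E \<epsilon> \<and> end_degree V E \<epsilon> r \<and>
     \<not> has_connected_ray_graph V E \<epsilon> r"
  by (simp add: HC_counterexample_def has_connected_ray_graph_def)

text \<open>\<open>Ub\<close> consists of the vertices attached to uncountably many of the disjoint sets \<open>Z j\<close>. A finite set
  misses most of these, so the vertices of \<open>Ub\<close> dominate the end and one ray runs through all of them.\<close>

lemma star_over_countable_set:
  assumes G: "graph V E" "is_end V E \<epsilon>" and J: "uncountable J" and U: "countable U"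
    and N: "\<And>j. j \<in> J \<Longrightarrow> N j \<in> \<epsilon>" "\<And>j. j \<in> J \<Longrightarrow> range (N j) \<subseteq> Z j"
    and Z: "\<And>i j. i \<in> J \<Longrightarrow> j \<in> J \<Longrightarrow> i \<noteq> j \<Longrightarrow> Z i \<inter> Z j = {}" "\<And>j. j \<in> J \<Longrightarrow> Z j \<subseteq> V"
    and att: "\<And>j X. j \<in> J \<Longrightarrow> finite X \<Longrightarrow>
      \<exists>a\<in>range (N j). \<exists>z. \<exists>u\<in>U - X. conn E (Z j - X) a z \<and> (z, u) \<in> E"
  shows "has_connected_ray_graph V E \<epsilon> |J|"
proof -
  have s: "sym E" and EV: "E \<subseteq> V \<times> V" using G(1) by (simp_all add: graph_def)
  define A where "A j = {u \<in> U. \<exists>a\<in>range (N j). \<exists>z. conn E (Z j) a z \<and> (z, u) \<in> E}" for j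
  have att': "\<exists>a\<in>range (N j). \<exists>z. \<exists>u\<in>A j - X. conn E (Z j - X) a z \<and> (z, u) \<in> E" if j: "j \<in> J" "finite X" for j X
  proof -
    obtain a z u where a: "a \<in> range (N j)" "u \<in> U - X" "conn E (Z j - X) a z" "(z, u) \<in> E" using att[OF j] by blast
    have "conn E (Z j) a z" by (rule conn_mono[OF a(3)]) auto
    then have "u \<in> A j - X" using a by (auto simp: A_def)
    then show ?thesis using a by blast
  qed
  define Ub where "Ub = {u \<in> U. uncountable {j \<in> J. u \<in> A j}}"
  \<comment> \<open>Each of the countably many vertices of \<open>U - Ub\<close> is attached to
    countably many indices. Deleting these indices leaves sets attached to vertices of
    \<open>Ub\<close> only.\<close>
  define J1 where "J1 = J - (\<Union>u\<in>U - Ub. {j \<in> J. u \<in> A j})"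
  have "countable (\<Union>u\<in>U - Ub. {j \<in> J. u \<in> A j})" using U by (intro countable_UN) (auto simp: Ub_def)
  then have J1: "|J1| =o |J|" unfolding J1_def by (rule card_of_Diff_countable[OF J])
  have J1U: "A j \<subseteq> Ub" if "j \<in> J1" for j using that by (auto simp: J1_def A_def)
  have J1J: "J1 \<subseteq> J" by (auto simp: J1_def)
  have uJ1: "uncountable J1" by (rule uncountable_ordIso[OF J1 J])
  then obtain j0 where j0: "j0 \<in> J1" by (metis countable_empty ex_in_conv)
  define R0 where "R0 = N j0"
  have R0: "R0 \<in> \<epsilon>" using j0 J1J N(1) by (auto simp: R0_def)
  note R0r = end_ray[OF G(2) R0]
  have UbV: "Ub \<subseteq> V"
  proof
    fix u assume "u \<in> Ub"
    then have "{j \<in> J. u \<in> A j} \<noteq> {}" unfolding Ub_def by (metis (no_types, lifting) countable_empty mem_Collect_eq)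
    then show "u \<in> V" using EV by (auto simp: A_def)
  qed
  \<comment> \<open>A finite \<open>X\<close> meets only finitely many of the disjoint
    \<open>Z j\<close>. Among the uncountably many attached to \<open>u\<close>, one therefore
    avoids \<open>X\<close> and leads from \<open>u\<close> to its ray \<open>N j\<close> and on to
    \<open>R0\<close>.\<close>
  have dom: "\<exists>n\<ge>M. conn E (V - X) u (R0 n)" if u: "u \<in> Ub" "u \<notin> X" and X: "finite X" for u X M
  proof -
    have "finite {j \<in> J. Z j \<inter> X \<noteq> {}}" by (rule disjoint_family_meet_finite[OF Z(1) X])
    moreover have "uncountable {j \<in> J. u \<in> A j}" using u by (simp add: Ub_def)
    ultimately have "\<not> {j \<in> J. u \<in> A j} \<subseteq> {j \<in> J. Z j \<inter> X \<noteq> {}}" using countable_finite countable_subset by blast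
    then obtain j where j: "j \<in> J" "u \<in> A j" "Z j \<inter> X = {}" by blast
    obtain i z where z: "conn E (Z j) (N j i) z" "(z, u) \<in> E" using j(2) by (auto simp: A_def)
    have sub: "Z j \<subseteq> V - X" using Z(2)[OF j(1)] j(3) by blast
    have "equiv_rays V E (N j) R0" using end_equiv[OF G N(1)[OF j(1)]] R0 by auto
    from equiv_rays_far[OF s this X] obtain i' n where n: "n \<ge> M" "conn E (V - X) (N j i') (R0 n)" by blast
    have "N j m \<in> V - X" for m using N(2)[OF j(1)] sub by blast
    then have 1: "conn E (V - X) (N j i) (N j i')"
      by (intro conn_ray[OF s end_ray[OF G(2) N(1)[OF j(1)]], of 0]) auto
    have 2: "conn E (V - X) (N j i) z" by (rule conn_mono[OF z(1) order_refl sub])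
    have 3: "conn E (V - X) u z"
    proof (rule conn_sym[OF s], rule conn_edge)
      show "z \<in> V - X" using conn_mem[OF 2] by blast
      show "u \<in> V - X" using u UbV by blast
    qed (rule z)
    have "conn E (V - X) u (R0 n)" by (rule conn_trans[OF conn_trans[OF conn_trans[OF 3 conn_sym[OF s 2]] 1] n(2)])
    then show ?thesis using n(1) by blast
  qed
  have pair: "conn E (V - X) u v" if X: "finite X" and uv: "u \<in> Ub - X" "v \<in> Ub - X" for X u v
  proof -
    have "inj R0" using R0r by (simp add: is_ray_def)
    from ray_avoids[OF this X] obtain M where M: "\<forall>n\<ge>M. R0 n \<notin> X" ..
    obtain n where n: "n \<ge> M" "conn E (V - X) u (R0 n)" using dom[of u X M] uv X by blast
    obtain m where m: "m \<ge> M" "conn E (V - X) v (R0 m)" using dom[of v X M] uv X by blast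
    have "conn E (V - X) (R0 n) (R0 m)"
      using M R0r n m by (intro conn_ray[OF s R0r, of M]) (auto simp: is_ray_def)
    from conn_trans[OF conn_trans[OF n(2) this] conn_sym[OF s m(2)]] show ?thesis .
  qed
  \<comment> \<open>A finite \<open>Ub\<close> could itself serve as the finite set to be avoided,
    giving an attachment outside \<open>Ub\<close>.\<close>
  have infU: "infinite Ub"
  proof
    assume "finite Ub"
    then obtain u where "u \<in> A j0 - Ub" using att'[of j0 Ub] j0 J1J by blast
    then show False using J1U[OF j0] by blast
  qed
  have "countable Ub" by (rule countable_subset[OF _ U]) (auto simp: Ub_def)
  from ray_through_countable_set[OF s infU this UbV pair] obtain C where C: "is_ray V E C" "Ub \<subseteq> range C" by blast
  have "equiv_rays V E R0 C"
  proof (rule equiv_rays_sym[OF s], rule equiv_rays_iff[OF s, THEN iffD2], intro allI impI)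
    fix X :: "'a set" assume X: "finite X"
    have "\<not> Ub \<subseteq> X" using infU finite_subset[OF _ X, of Ub] by blast
    then obtain u where u: "u \<in> Ub" "u \<notin> X" by blast
    obtain n where "conn E (V - X) u (R0 n)" using dom[OF u X, of 0] by blast
    moreover obtain c where "u = C c" using u C(2) by blast
    ultimately show "\<exists>a b. conn E (V - X) (C a) (R0 b)" by blast
  qed
  then have Ce: "C \<in> \<epsilon>" using end_equiv[OF G R0] C(1) by simp
  define J2 where "J2 = J1 - {j \<in> J1. Z j \<inter> range C \<noteq> {}}"
  have Z1: "Z i \<inter> Z j = {}" if "i \<in> J1" "j \<in> J1" "i \<noteq> j" for i j using Z(1) J1J that by blast
  have "countable {j \<in> J1. Z j \<inter> range C \<noteq> {}}" by (rule disjoint_family_meet_countable[OF Z1]) auto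
  then have J2: "|J2| =o |J1|" unfolding J2_def by (rule card_of_Diff_countable[OF uJ1])
  have uJ2: "uncountable J2" by (rule uncountable_ordIso[OF J2 uJ1])
  have J2J: "J2 \<subseteq> J" using J1J by (auto simp: J2_def)
  have "\<exists>H. disjoint_rays (insert C (N ` J2)) \<and> |insert C (N ` J2)| =o |J2| \<and>
    is_ray_graph V E (insert C (N ` J2)) H \<and> connected_graph (insert C (N ` J2)) H"
  proof (rule star_ray_graph[OF G(1) uJ2 C(1)])
    fix j assume j: "j \<in> J2"
    show "is_ray V E (N j)" using end_ray[OF G(2)] N(1) j J2J by blast
    show "range (N j) \<subseteq> Z j" using N(2) j J2J by blast
    show "Z j \<inter> range C = {}" using j by (auto simp: J2_def)
    show "linked E ((Z j \<union> range C) \<inter> V) (range (N j)) (range C)"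
    proof (rule linkedI)
      fix X :: "'a set" assume X: "finite X"
      obtain a z u where a: "a \<in> range (N j)" "u \<in> A j - X" "conn E (Z j - X) a z" "(z, u) \<in> E"
        using att'[OF _ X, of j] j J2J by blast
      have uC: "u \<in> range C" using a(2) J1U[of j] j C(2) by (auto simp: J2_def)
      have 1: "conn E ((Z j \<union> range C) \<inter> V - X) a z" by (rule conn_mono[OF a(3)]) (use Z(2) j J2J in auto)
      have "conn E ((Z j \<union> range C) \<inter> V - X) z u"
      proof (rule conn_edge[OF _ _ a(4)])
        show "z \<in> (Z j \<union> range C) \<inter> V - X" using conn_mem[OF 1] by blast
        show "u \<in> (Z j \<union> range C) \<inter> V - X" using uC a(2,4) EV by blast
      qed
      from conn_trans[OF 1 this] show "\<exists>a\<in>range (N j). \<exists>b\<in>range C. conn E ((Z j \<union> range C) \<inter> V - X) a b" using a(1) uC by blast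
    qed
  next
    fix i j assume "i \<in> J2" "j \<in> J2" "i \<noteq> j"
    then show "Z i \<inter> Z j = {}" using Z(1) J2J by blast
  qed
  then obtain H where H: "disjoint_rays (insert C (N ` J2))" "|insert C (N ` J2)| =o |J2|"
    "is_ray_graph V E (insert C (N ` J2)) H" "connected_graph (insert C (N ` J2)) H" by blast
  have "|insert C (N ` J2)| =o |J|" using ordIso_transitive[OF H(2) ordIso_transitive[OF J2 J1]] .
  moreover have "insert C (N ` J2) \<subseteq> \<epsilon>" using Ce N(1) J2J by blast
  ultimately show ?thesis unfolding has_connected_ray_graph_def
    using H by (intro exI[of _ "insert C (N ` J2)"] exI[of _ H]) simp
qed


section \<open>Passing to a subgraph with at most \<open>K\<close> vertices\<close>

lemma is_path_mono: "is_path V0 E0 p \<Longrightarrow> V0 \<subseteq> V \<Longrightarrow> E0 \<subseteq> E \<Longrightarrow> is_path V E p"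
  unfolding is_path_def by (simp add: subset_iff)

lemma equiv_rays_mono:
  assumes "equiv_rays V0 E0 R S" "V0 \<subseteq> V" "E0 \<subseteq> E" shows "equiv_rays V E R S"
proof -
  obtain P where P: "infinite P" "disjoint_paths P" "\<forall>p\<in>P. AB_path V0 E0 (range R) (range S) p"
    using assms(1) by (auto simp: equiv_rays_def)
  have "\<forall>p\<in>P. AB_path V E (range R) (range S) p"
    using P(3) is_path_mono[OF _ assms(2,3)] by (simp add: AB_path_def)
  then show ?thesis using P(1,2) by (auto simp: equiv_rays_def)
qed

lemma is_ray_graph_mono:
  assumes "is_ray_graph V0 E0 \<R> H" "V0 \<subseteq> V" "E0 \<subseteq> E" shows "is_ray_graph V E \<R> H"
proof -
  have p: "is_path V0 E0 p \<Longrightarrow> is_path V E p" for p by (rule is_path_mono[OF _ assms(2,3)])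
  have r: "Rpath V0 E0 \<R> p \<Longrightarrow> Rpath V E \<R> p" for p using p by (simp add: Rpath_def)
  have q: "RS_path V0 E0 R S p \<Longrightarrow> RS_path V E R S p" for R S p
    using p[of p] p[of "rev p"] by (auto simp: RS_path_def AB_path_def)
  obtain \<P> where P: "\<forall>p\<in>\<P>. Rpath V0 E0 \<R> p" "independent_paths \<P>"
    "\<forall>(R, S)\<in>H. \<exists>Q. Q \<subseteq> \<P> \<and> infinite Q \<and> disjoint_paths Q \<and> (\<forall>p\<in>Q. RS_path V0 E0 R S p)" and g: "graph \<R> H"
    using assms(1) unfolding is_ray_graph_def by (elim exE conjE) (rule that)
  have "\<forall>(R, S)\<in>H. \<exists>Q. Q \<subseteq> \<P> \<and> infinite Q \<and> disjoint_paths Q \<and> (\<forall>p\<in>Q. RS_path V E R S p)"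
  proof (rule ballI, clarify)
    fix R S assume RS: "(R, S) \<in> H"
    have "\<exists>Q. Q \<subseteq> \<P> \<and> infinite Q \<and> disjoint_paths Q \<and> (\<forall>p\<in>Q. RS_path V0 E0 R S p)"
      using bspec[OF P(3) RS] by simp
    then show "\<exists>Q\<subseteq>\<P>. infinite Q \<and> disjoint_paths Q \<and> (\<forall>p\<in>Q. RS_path V E R S p)" using q[of R S] by blast
  qed
  moreover have "\<forall>p\<in>\<P>. Rpath V E \<R> p" using P(1) r by blast
  ultimately show ?thesis unfolding is_ray_graph_def using g P(2) by (intro conjI exI[of _ \<P>])
qed

lemma disjoint_rays_card:
  assumes "\<And>R. R \<in> \<R> \<Longrightarrow> is_ray V E R" "disjoint_rays \<R>" shows "|\<R>| \<le>o |V|"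
proof (rule card_of_ordLeqI)
  show "inj_on (\<lambda>R. R 0) \<R>"
  proof (rule inj_onI, rule ccontr)
    fix R S assume "R \<in> \<R>" "S \<in> \<R>" and eq: "R 0 = S 0" and "R \<noteq> S"
    then have "range R \<inter> range S = {}" using assms(2) by (simp add: disjoint_rays_def)
    then show False using eq by (metis disjoint_iff rangeI)
  qed
  show "R 0 \<in> V" if "R \<in> \<R>" for R using assms(1)[OF that] by (auto simp: is_ray_def)
qed

text \<open>Each of the disjoint paths uses up a vertex of its own on the countable set
  \<open>range R\<close>.\<close>

lemma disjoint_AB_paths_countable:
  fixes R :: "nat \<Rightarrow> 'a"
  assumes "disjoint_paths P" "\<And>p. p \<in> P \<Longrightarrow> AB_path V E (range R) B p" shows "countable P"
proof -
  have "countable {p \<in> P. set p \<inter> range R \<noteq> {}}"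
    by (rule disjoint_family_meet_countable) (use assms(1) in \<open>auto simp: disjoint_paths_def\<close>)
  moreover have "{p \<in> P. set p \<inter> range R \<noteq> {}} = P" using assms(2) by (auto simp: AB_path_def)
  ultimately show ?thesis by simp
qed

text \<open>The subgraph consists of a largest disjoint family and, for each of its rays, countably
  many paths from \<open>R0\<close>, which keep the family equivalent. Its end is contained in the
  original one, so a connected ray graph there would already be one in the large graph.\<close>

lemma HC_counterexample_small:
  fixes V :: "'a set"
  assumes hc: "HC_counterexample V E \<epsilon> |K|" and K: "infinite K"
  shows "\<exists>(V0 :: 'a set) E0 \<epsilon>0. HC_counterexample V0 E0 \<epsilon>0 |K| \<and> |V0| \<le>o |K|"
proof -
  have G: "graph V E" "is_end V E \<epsilon>" and deg: "end_degree V E \<epsilon> |K|"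
    and nex: "\<not> has_connected_ray_graph V E \<epsilon> |K|"
    using hc by (simp_all add: HC_counterexample_iff)
  have s: "sym E" using G(1) by (simp add: graph_def)
  obtain \<R> where R: "\<R> \<subseteq> \<epsilon>" "disjoint_rays \<R>" "|\<R>| =o |K|" using deg by (auto simp: end_degree_def)
  have infR: "infinite \<R>" using card_of_ordIso_finite[OF R(3)] K by simp
  then obtain R0 where R0: "R0 \<in> \<R>" by (metis ex_in_conv infinite_imp_nonempty)
  have R0e: "R0 \<in> \<epsilon>" using R0 R(1) by blast
  have "\<forall>R\<in>\<R>. \<exists>P. infinite P \<and> disjoint_paths P \<and> (\<forall>p\<in>P. AB_path V E (range R0) (range R) p)"
    using end_equiv[OF G R0e] R(1) by (auto simp: equiv_rays_def)
  from bchoice[OF this] obtain P where P: "\<forall>R\<in>\<R>. infinite (P R) \<and> disjoint_paths (P R) \<and> (\<forall>p\<in>P R. AB_path V E (range R0) (range R) p)" ..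
  define V0 where "V0 = (\<Union>R\<in>\<R>. range R \<union> \<Union>(set ` P R))"
  define E0 where "E0 = E \<inter> V0 \<times> V0"
  have V0V: "V0 \<subseteq> V"
  proof
    fix v assume "v \<in> V0"
    then obtain R where Rr: "R \<in> \<R>" "v \<in> range R \<or> (\<exists>p\<in>P R. v \<in> set p)" by (auto simp: V0_def)
    have "is_ray V E R" using end_ray[OF G(2)] Rr(1) R(1) by blast
    moreover have "set p \<subseteq> V" if "p \<in> P R" for p using P Rr(1) that by (auto simp: AB_path_def is_path_def)
    ultimately show "v \<in> V" using Rr(2) by (auto simp: is_ray_def)
  qed
  have E0E: "E0 \<subseteq> E" by (auto simp: E0_def)
  have card: "|V0| \<le>o |K|" unfolding V0_def
  proof (rule card_of_UNION_ordLeq_infinite[OF K], rule ordIso_imp_ordLeq[OF R(3)], rule ballI)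
    fix R assume Rr: "R \<in> \<R>"
    have "countable (P R)" by (rule disjoint_AB_paths_countable) (use P Rr in blast)+
    then have "countable (range R \<union> \<Union>(set ` P R))" by (intro countable_Un countable_UN) (auto simp: countable_finite)
    then show "|range R \<union> \<Union>(set ` P R)| \<le>o |K|"
      using K by (meson countable_card_le_natLeq infinite_iff_natLeq_ordLeq ordLeq_transitive)
  qed
  have g0: "graph V0 E0" using G(1) by (auto simp: graph_def E0_def sym_def)
  have ray0: "is_ray V0 E0 R" if Rr: "R \<in> \<R>" for R
  proof -
    have "is_ray V E R" using end_ray[OF G(2)] Rr R(1) by blast
    moreover have "range R \<subseteq> V0" using Rr by (auto simp: V0_def)
    ultimately show ?thesis by (auto simp: is_ray_def E0_def)
  qed
  define \<epsilon>0 where "\<epsilon>0 = {S. is_ray V0 E0 S \<and> equiv_rays V0 E0 R0 S}"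
  have e0: "is_end V0 E0 \<epsilon>0" unfolding is_end_def \<epsilon>0_def using ray0[OF R0] by blast
  have R0sub: "\<R> \<subseteq> \<epsilon>0"
  proof
    fix R assume Rr: "R \<in> \<R>"
    have "AB_path V0 E0 (range R0) (range R) p" if p: "p \<in> P R" for p
    proof -
      have "AB_path V E (range R0) (range R) p" using P Rr p by blast
      moreover have "set p \<subseteq> V0" using p Rr by (auto simp: V0_def)
      ultimately show ?thesis unfolding AB_path_def is_path_def E0_def by auto
    qed
    then have "equiv_rays V0 E0 R0 R" using P Rr unfolding equiv_rays_def by blast
    then show "R \<in> \<epsilon>0" using ray0[OF Rr] by (simp add: \<epsilon>0_def)
  qed
  have sub: "\<epsilon>0 \<subseteq> \<epsilon>"
  proof
    fix S assume "S \<in> \<epsilon>0"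
    then have S: "is_ray V0 E0 S" "equiv_rays V0 E0 R0 S" by (auto simp: \<epsilon>0_def)
    have "is_ray V E S" using S(1) V0V E0E by (auto simp: is_ray_def)
    then show "S \<in> \<epsilon>" using end_equiv[OF G R0e] equiv_rays_mono[OF S(2) V0V E0E] by simp
  qed
  have "end_degree V0 E0 \<epsilon>0 |K|" unfolding end_degree_def
  proof (intro conjI allI impI)
    show "\<exists>\<R>\<subseteq>\<epsilon>0. disjoint_rays \<R> \<and> |\<R>| =o |K|" using R0sub R by blast
    fix \<S> assume S: "\<S> \<subseteq> \<epsilon>0 \<and> disjoint_rays \<S>"
    have "|\<S>| \<le>o |V0|" by (rule disjoint_rays_card[of _ V0 E0]) (use S in \<open>auto simp: \<epsilon>0_def\<close>)
    then show "|\<S>| \<le>o |K|" using card ordLeq_transitive by blast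
  qed
  moreover have "\<not> has_connected_ray_graph V0 E0 \<epsilon>0 |K|"
  proof
    assume "has_connected_ray_graph V0 E0 \<epsilon>0 |K|"
    then obtain \<S> H where S: "\<S> \<subseteq> \<epsilon>0" "disjoint_rays \<S>" "|\<S>| =o |K|" "is_ray_graph V0 E0 \<S> H" "connected_graph \<S> H"
      unfolding has_connected_ray_graph_def by (elim exE conjE) (rule that)
    then have "has_connected_ray_graph V E \<epsilon> |K|" unfolding has_connected_ray_graph_def
      using is_ray_graph_mono[OF S(4) V0V E0E] subset_trans[OF S(1) sub] by (intro exI[of _ \<S>] exI[of _ H]) simp
    with nex show False ..
  qed
  ultimately have "HC_counterexample V0 E0 \<epsilon>0 |K|" using g0 e0 by (simp add: HC_counterexample_iff)
  then show ?thesis using card by blast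
qed

section \<open>Attaching new rays\<close>

lemma inner_rev: "inner (rev p) = inner p"
proof (cases p)
  case (Cons x q)
  then show ?thesis by (cases q rule: rev_cases) (simp_all add: inner_def butlast_append)
qed (simp add: inner_def)

lemma is_path_butlast:
  assumes "is_path V E p" "butlast p \<noteq> []"
  shows "is_path V E (butlast p)" "(last (butlast p), last p) \<in> E" "hd (butlast p) = hd p"
proof -
  obtain q x where p: "p = q @ [x]" using assms(2) by (cases p rule: rev_cases) auto
  then have q: "q \<noteq> []" using assms(2) by simp
  show "is_path V E (butlast p)"
    using is_path_take[OF assms(1), of "length q"] p q by simp
  show "hd (butlast p) = hd p" using p q by simp
  obtain r y where r: "q = r @ [y]" using q by (cases q rule: rev_cases) auto
  have "Suc (length r) < length p" using p r by simp
  then have "(p ! length r, p ! Suc (length r)) \<in> E" using assms(1) unfolding is_path_def by blast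
  moreover have "p ! length r = y" "p ! Suc (length r) = x" unfolding p r by (simp_all add: nth_append)
  moreover have "butlast p = q" "last q = y" "last p = x" using p r by (simp_all add: butlast_append)
  ultimately show "(last (butlast p), last p) \<in> E" by simp
qed

text \<open>\<open>new v l\<close> with \<open>v = R (c l) n\<close> is the \<open>n\<close>-th vertex of the new ray \<open>T l\<close>, which is attached to
  \<open>R (c l)\<close>; \<open>pi\<close> maps it back to \<open>v\<close>.\<close>

locale thickening =
  fixes V :: "'a set" and E :: "('a \<times> 'a) set" and \<epsilon> :: "(nat \<Rightarrow> 'a) set"
    and K :: "'k set" and R :: "'k \<Rightarrow> nat \<Rightarrow> 'a" and L :: "'l set" and c :: "'l \<Rightarrow> 'k"
    and old :: "'a \<Rightarrow> 'b" and new :: "'a \<Rightarrow> 'l \<Rightarrow> 'b" and pi :: "'b \<Rightarrow> 'a"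
  assumes G: "graph V E" "is_end V E \<epsilon>"
    and R_end: "\<And>k. k \<in> K \<Longrightarrow> R k \<in> \<epsilon>"
    and R_disjoint: "\<And>i j. i \<in> K \<Longrightarrow> j \<in> K \<Longrightarrow> i \<noteq> j \<Longrightarrow> range (R i) \<inter> range (R j) = {}"
    and c_K: "\<And>l. l \<in> L \<Longrightarrow> c l \<in> K"
    and pi_old: "\<And>v. pi (old v) = v" and pi_new: "\<And>v l. pi (new v l) = v"
    and old_new: "\<And>v w l. old v \<noteq> new w l" and new_inj: "\<And>v w l m. new v l = new w m \<Longrightarrow> l = m"
begin

definition T :: "'l \<Rightarrow> nat \<Rightarrow> 'b" where "T l n = new (R (c l) n) l"

definition V' :: "'b set" where "V' = old ` V \<union> {T l n | l n. l \<in> L}"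

definition E1 :: "('b \<times> 'b) set" where
  "E1 = {(old u, old v) | u v. (u, v) \<in> E} \<union> {(T l n, T l (Suc n)) | l n. l \<in> L} \<union>
    {(old (R (c l) n), T l n) | l n. l \<in> L}"

definition E' :: "('b \<times> 'b) set" where "E' = E1 \<union> E1\<inverse>"

text \<open>The class of \<open>v\<close> when every \<open>R k\<close> is contracted to a point.
  Shifted projections are controlled only up to such classes.\<close>

definition cl :: "'a \<Rightarrow> 'a set" where "cl v = insert v (\<Union>k\<in>{k \<in> K. v \<in> range (R k)}. range (R k))"

lemma sym_E: "sym E" and E_V: "E \<subseteq> V \<times> V" using G(1) by (simp_all add: graph_def)

lemma R_ray: "k \<in> K \<Longrightarrow> is_ray V E (R k)" by (rule end_ray[OF G(2) R_end])

lemma R_inj: "k \<in> K \<Longrightarrow> R k m = R k n \<Longrightarrow> m = n" using R_ray[of k] by (auto simp: is_ray_def dest: injD)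

lemma R_V: "k \<in> K \<Longrightarrow> R k n \<in> V" using R_ray[of k] by (auto simp: is_ray_def)

lemma R_edge: "k \<in> K \<Longrightarrow> (R k n, R k (Suc n)) \<in> E" using R_ray[of k] by (auto simp: is_ray_def)

lemma R_eq: "i \<in> K \<Longrightarrow> j \<in> K \<Longrightarrow> R i m = R j n \<Longrightarrow> i = j" using R_disjoint[of i j] by (metis disjoint_iff rangeI)

lemma pi_T: "pi (T l n) = R (c l) n" by (simp add: T_def pi_new)

lemma old_T: "old v \<noteq> T l n" by (simp add: T_def old_new)

lemma T_eq: "T l m = T l' n \<Longrightarrow> l = l'" unfolding T_def by (rule new_inj)

lemma old_inj: "old u = old v \<Longrightarrow> u = v" using pi_old by metis

lemma V'_cases:
  assumes "x \<in> V'" obtains v where "v \<in> V" "x = old v" | l n where "l \<in> L" "x = T l n"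
  using assms by (auto simp: V'_def)

lemma pi_V: "x \<in> V' \<Longrightarrow> pi x \<in> V"
  by (erule V'_cases) (simp_all add: pi_old pi_T R_V c_K)

lemma E'_cases:
  assumes "(x, y) \<in> E'"
  obtains u v where "(u, v) \<in> E" "x = old u" "y = old v"
  | l n where "l \<in> L" "x = T l n" "y = T l (Suc n)"
  | l n where "l \<in> L" "x = T l (Suc n)" "y = T l n"
  | l n where "l \<in> L" "x = old (R (c l) n)" "y = T l n"
  | l n where "l \<in> L" "x = T l n" "y = old (R (c l) n)"
proof -
  from assms consider "(x, y) \<in> E1" | "(y, x) \<in> E1" by (auto simp: E'_def)
  then show thesis
  proof cases
    case 1 then show thesis using that by (auto simp: E1_def)
  next
    case 2
    then consider u v where "(u, v) \<in> E" "y = old u" "x = old v" | l n where "l \<in> L" "y = T l n" "x = T l (Suc n)"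
      | l n where "l \<in> L" "y = old (R (c l) n)" "x = T l n" by (auto simp: E1_def)
    then show thesis
    proof cases
      case (1 u v) then show thesis using that(1)[of v u] symD[OF sym_E] by blast
    next
      case (2 l n) then show thesis using that(3) by blast
    next
      case (3 l n) then show thesis using that(5) by blast
    qed
  qed
qed

lemma E'_old: "(u, v) \<in> E \<Longrightarrow> (old u, old v) \<in> E'" by (auto simp: E'_def E1_def)
lemma E'_T: "l \<in> L \<Longrightarrow> (T l n, T l (Suc n)) \<in> E'" by (auto simp: E'_def E1_def)
lemma E'_rung: "l \<in> L \<Longrightarrow> (T l n, old (R (c l) n)) \<in> E'" by (auto simp: E'_def E1_def)

lemma sym_E': "sym E'" by (auto simp: E'_def sym_def)

lemma T_V': "l \<in> L \<Longrightarrow> T l n \<in> V'" by (auto simp: V'_def)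

lemma old_V': "v \<in> V \<Longrightarrow> old v \<in> V'" by (auto simp: V'_def)

lemma graph': "graph V' E'"
  unfolding graph_def
proof (intro conjI allI subsetI)
  show "sym E'" by (rule sym_E')
  fix e assume "e \<in> E'"
  then obtain x y where e: "e = (x, y)" "(x, y) \<in> E'" by (cases e) auto
  from e(2) have "x \<in> V' \<and> y \<in> V'"
    by (cases rule: E'_cases) (use E_V in \<open>auto intro!: T_V' old_V' R_V c_K\<close>)
  then show "e \<in> V' \<times> V'" using e by simp
next
  fix v show "(v, v) \<notin> E'"
  proof
    assume "(v, v) \<in> E'"
    then show False
    proof (cases rule: E'_cases)
      case (1 u w)
      then have "u = w" using old_inj by metis
      then show False using 1 G(1) by (simp add: graph_def)
    next
      case (2 l n)
      then have "R (c l) n = R (c l) (Suc n)" by (metis pi_T)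
      then show False using R_inj c_K 2(1) by fastforce
    next
      case (3 l n)
      then have "R (c l) n = R (c l) (Suc n)" by (metis pi_T)
      then show False using R_inj c_K 3(1) by fastforce
    qed (use old_T in metis)+
  qed
qed

lemma T_neighbours:
  assumes "(x, y) \<in> E'" "x \<in> range (T l)"
  shows "y \<in> range (T l) \<or> (\<exists>n. x = T l n \<and> y = old (R (c l) n))"
  using assms(1)
proof (cases rule: E'_cases)
  case (1 u v) then show ?thesis using assms(2) old_T by auto
next
  case (2 m n) then have "m = l" using assms(2) T_eq by blast
  then show ?thesis using 2 by simp
next
  case (3 m n) then have "m = l" using assms(2) T_eq by blast
  then show ?thesis using 3 by simp
next
  case (4 m n) then show ?thesis using assms(2) old_T by auto
next
  case (5 m n) then have "m = l" using assms(2) T_eq by blast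
  then show ?thesis using 5 by auto
qed

lemma cl_self: "v \<in> cl v" by (simp add: cl_def)

lemma cl_R: "k \<in> K \<Longrightarrow> cl (R k n) = range (R k)"
proof -
  assume k: "k \<in> K"
  have "{i \<in> K. R k n \<in> range (R i)} = {k}" using R_eq[OF k] k by auto
  then show ?thesis unfolding cl_def by auto
qed

lemma cl_other: "(\<And>k. k \<in> K \<Longrightarrow> v \<notin> range (R k)) \<Longrightarrow> cl v = {v}"
  unfolding cl_def by auto

lemma cl_eq: assumes "w \<in> cl v" shows "cl w = cl v"
proof (cases "\<exists>k\<in>K. v \<in> range (R k)")
  case True
  then obtain k n where k: "k \<in> K" "v = R k n" by blast
  then obtain m where "w = R k m" using assms cl_R by auto
  then show ?thesis using k cl_R by simp
next
  case False
  then show ?thesis using assms cl_other[of v] by simp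
qed

lemma cl_countable: "countable (cl v)"
proof (cases "\<exists>k\<in>K. v \<in> range (R k)")
  case True
  then obtain k n where k: "k \<in> K" "v = R k n" by blast
  then show ?thesis using cl_R by simp
next
  case False
  then show ?thesis using cl_other[of v] by simp
qed

lemma cl_V: "v \<in> V \<Longrightarrow> cl v \<subseteq> V"
  unfolding cl_def using R_V by auto

section \<open>Lifting to the thickened graph and projecting back\<close>

lemma lift_conn:
  assumes "conn E (V - pi ` X) u v" shows "conn E' (V' - X) (old u) (old v)"
proof (rule conn_map[OF assms])
  have o: "old w \<in> V' - X" if "w \<in> V - pi ` X" for w
  proof -
    have "old w \<notin> X" using that pi_old[of w] by (metis DiffD2 imageI)
    then show ?thesis using that old_V' by simp
  qed
  show "old u \<in> V' - X" using o conn_mem[OF assms] by simp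
  fix a b assume "a \<in> V - pi ` X" "b \<in> V - pi ` X" "(a, b) \<in> E"
  then show "conn E' (V' - X) (old a) (old b)" by (intro conn_edge o E'_old)
qed

lemma old_ray: "is_ray V E S \<Longrightarrow> is_ray V' E' (\<lambda>n. old (S n))"
  unfolding is_ray_def using old_inj old_V' E'_old by (auto simp: inj_def)

lemma T_ray: assumes "l \<in> L" shows "is_ray V' E' (T l)"
  unfolding is_ray_def
proof (intro conjI allI)
  show "inj (T l)" by (rule injI) (metis pi_T R_inj c_K assms)
  show "range (T l) \<subseteq> V'" using T_V' assms by blast
  show "(T l n, T l (Suc n)) \<in> E'" for n using E'_T assms by blast
qed

lemma T_equiv:
  assumes "l \<in> L" "k \<in> K" shows "equiv_rays V' E' (\<lambda>n. old (R k n)) (T l)"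
proof (rule equiv_rays_iff[OF sym_E', THEN iffD2], intro allI impI)
  fix X :: "'b set" assume X: "finite X"
  have "equiv_rays V E (R k) (R (c l))" using end_equiv[OF G R_end[OF assms(2)]] R_end[OF c_K[OF assms(1)]] by auto
  from equiv_rays_far[OF sym_E this finite_imageI[OF X], of 0 0] obtain a b where
    ab: "conn E (V - pi ` X) (R k a) (R (c l) b)" by blast
  have 1: "conn E' (V' - X) (old (R k a)) (old (R (c l) b))" by (rule lift_conn[OF ab])
  have "R (c l) b \<notin> pi ` X" using conn_mem[OF ab] by blast
  then have "T l b \<notin> X" using pi_T by (metis imageI)
  then have "conn E' (V' - X) (T l b) (old (R (c l) b))" using conn_mem[OF 1] T_V'[OF assms(1)]
    by (intro conn_edge E'_rung assms(1)) auto
  from conn_trans[OF 1 conn_sym[OF sym_E' this]]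
  show "\<exists>a b. conn E' (V' - X) (old (R k a)) (T l b)" by blast
qed

text \<open>A detour through \<open>T l\<close> cannot simply be mapped to \<open>G\<close> by \<open>pi\<close>, as it may run past vertices of \<open>Y\<close> that
  the walk itself avoids. If \<open>Y\<close> is closed downwards along the rays \<open>R k\<close>, moving the initial part of
  \<open>T l\<close> to the first vertex of \<open>R (c l)\<close> outside \<open>Y\<close> repairs this.\<close>

definition projects_off :: "'a set \<Rightarrow> ('b \<Rightarrow> 'a) \<Rightarrow> bool" where
  "projects_off Y \<rho> \<longleftrightarrow> finite Y \<and> (\<forall>x. pi x \<notin> Y \<longrightarrow> \<rho> x = pi x) \<and>
    (\<forall>x\<in>V' - old ` Y. \<rho> x \<in> cl (pi x)) \<and>
    (\<forall>W x y. W \<subseteq> V' \<longrightarrow> conn E' (W - old ` Y) x y \<longrightarrow> conn E ((\<Union>x\<in>W. cl (pi x)) - Y) (\<rho> x) (\<rho> y))"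

text \<open>Closing \<open>X\<close> downwards makes \<open>Y\<close> an initial segment of each
  \<open>R k\<close>, of length \<open>g k\<close>. On \<open>T l\<close> the projection raises the
  index to at least \<open>g (c l)\<close>, so consecutive vertices remain consecutive or coincide;
  a rung whose old end is outside \<open>Y\<close> collapses.\<close>

lemma projection_exists:
  assumes X: "finite X"
  shows "\<exists>Y \<rho>. X \<subseteq> Y \<and> projects_off Y \<rho>"
proof -
  define D where "D x = {R k m | k m. k \<in> K \<and> (\<exists>n\<ge>m. R k n = x)}" for x
  have finD: "finite (D x)" for x
  proof (cases "\<exists>k\<in>K. \<exists>n. x = R k n")
    case True
    then obtain k n where k: "k \<in> K" "x = R k n" by blast
    have "D x \<subseteq> R k ` {..n}"
    proof
      fix y assume "y \<in> D x"
      then obtain i m n' where y: "y = R i m" "i \<in> K" "n' \<ge> m" "R i n' = x" by (auto simp: D_def)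
      have ik: "i = k" using R_eq[OF y(2) k(1)] y(4) k(2) by simp
      have "n' = n" using R_inj[OF k(1)] y(4) k(2) ik by simp
      then show "y \<in> R k ` {..n}" using y ik by simp
    qed
    then show ?thesis using finite_subset by blast
  next
    case False
    then have "D x = {}" by (auto simp: D_def)
    then show ?thesis by simp
  qed
  define Y where "Y = X \<union> (\<Union>x\<in>X. D x)"
  have finY: "finite Y" using X finD by (simp add: Y_def)
  have down: "R k m \<in> Y" if k: "k \<in> K" "R k n \<in> Y" "m \<le> n" for k m n
  proof -
    have "\<exists>x\<in>X. \<exists>n'\<ge>n. R k n' = x"
    proof (cases "R k n \<in> X")
      case True then show ?thesis by blast
    next
      case False
      then obtain x i m' n' where "x \<in> X" "R k n = R i m'" "i \<in> K" "n' \<ge> m'" "R i n' = x"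
        using k(2) by (auto simp: Y_def D_def)
      moreover then have "i = k" using R_eq k(1) by metis
      moreover then have "m' = n" using R_inj[OF k(1)] calculation(2) by simp
      ultimately show ?thesis by blast
    qed
    then obtain x n' where x: "x \<in> X" "n' \<ge> n" "R k n' = x" by blast
    then have "n' \<ge> m" using k(3) by simp
    then have "R k m \<in> D x" using x k(1) unfolding D_def by blast
    then show ?thesis using x(1) by (auto simp: Y_def)
  qed
  define g where "g k = (LEAST n. R k n \<notin> Y)" for k
  have g: "R k n \<in> Y \<longleftrightarrow> n < g k" if k: "k \<in> K" for k n
  proof -
    have "inj (R k)" using R_ray[OF k] by (simp add: is_ray_def)
    from ray_avoids[OF this finY] obtain M where "R k M \<notin> Y" by blast
    then have gn: "R k (g k) \<notin> Y" unfolding g_def by (rule LeastI)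
    show ?thesis
    proof
      assume "R k n \<in> Y"
      then show "n < g k" using down[OF k, of n "g k"] gn by (meson not_le)
    next
      assume "n < g k"
      then show "R k n \<in> Y" unfolding g_def using not_less_Least by blast
    qed
  qed
  \<comment> \<open>The choice of \<open>k\<close> is arbitrary if \<open>pi x\<close> lies on no
    \<open>R k\<close>; among vertices of \<open>V'\<close> this concerns only old copies of
    vertices of \<open>Y\<close>, which are excluded wherever it matters.\<close>
  define \<rho> where "\<rho> x = (if pi x \<in> Y then let k = (SOME k. k \<in> K \<and> pi x \<in> range (R k)) in R k (g k) else pi x)" for x
  have \<rho>1: "\<rho> x = pi x" if "pi x \<notin> Y" for x using that by (simp add: \<rho>_def)
  have \<rho>2: "\<rho> (T l n) = R (c l) (max n (g (c l)))" if l: "l \<in> L" for l n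
  proof (cases "R (c l) n \<in> Y")
    case False
    then have "n \<ge> g (c l)" using g[OF c_K[OF l]] by (simp add: not_less)
    then show ?thesis using \<rho>1[of "T l n"] False by (simp add: pi_T max_def)
  next
    case True
    have "(SOME k. k \<in> K \<and> R (c l) n \<in> range (R k)) = c l"
    proof (rule some_equality)
      show "c l \<in> K \<and> R (c l) n \<in> range (R (c l))" using c_K[OF l] by simp
      fix k assume "k \<in> K \<and> R (c l) n \<in> range (R k)"
      then show "k = c l" using R_eq[OF _ c_K[OF l]] by (metis imageE)
    qed
    moreover have "max n (g (c l)) = g (c l)" using True g[OF c_K[OF l]] by simp
    ultimately show ?thesis using True by (simp add: \<rho>_def pi_T Let_def)
  qed
  have \<rho>3: "\<rho> x \<in> cl (pi x) \<and> \<rho> x \<notin> Y" if x: "x \<in> V' - old ` Y" for x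
  proof -
    have "x \<in> V'" using x by simp
    then show ?thesis
    proof (cases rule: V'_cases)
      case (1 v)
      then have "\<rho> x = pi x" "pi x \<notin> Y" using x \<rho>1[of x] by (auto simp: pi_old)
      then show ?thesis by (simp add: cl_self)
    next
      case (2 l n)
      then have "\<rho> x = R (c l) (max n (g (c l)))" using \<rho>2 by simp
      moreover have "R (c l) (max n (g (c l))) \<notin> Y" using g[OF c_K[OF 2(1)]] by simp
      ultimately show ?thesis using 2 cl_R[OF c_K[OF 2(1)]] by (simp add: pi_T)
    qed
  qed
  have edge: "\<rho> x = \<rho> y \<or> (\<rho> x, \<rho> y) \<in> E" if xy: "(x, y) \<in> E'" "x \<notin> old ` Y" "y \<notin> old ` Y" for x y
    using xy(1)
  proof (cases rule: E'_cases)
    case (1 u v)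
    then have "\<rho> x = u" "\<rho> y = v" using \<rho>1[of x] \<rho>1[of y] xy by (auto simp: pi_old)
    then show ?thesis using 1 by simp
  next
    case (2 l n)
    show ?thesis unfolding 2 \<rho>2[OF 2(1)] using R_edge[OF c_K[OF 2(1)]]
      by (cases "n < g (c l)") (auto simp: max_def)
  next
    case (3 l n)
    have "(R (c l) (Suc n), R (c l) n) \<in> E" using R_edge[OF c_K[OF 3(1)]] sym_E by (meson symD)
    then show ?thesis unfolding 3 \<rho>2[OF 3(1)] by (cases "n < g (c l)") (auto simp: max_def)
  next
    case (4 l n)
    then have n: "R (c l) n \<notin> Y" using xy by auto
    then have "\<rho> x = R (c l) n" using \<rho>1[of x] 4 by (simp add: pi_old)
    moreover have "\<rho> y = R (c l) n" using \<rho>1[of y] 4 n by (simp add: pi_T)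
    ultimately show ?thesis by simp
  next
    case (5 l n)
    then have n: "R (c l) n \<notin> Y" using xy by auto
    then have "\<rho> y = R (c l) n" using \<rho>1[of y] 5 by (simp add: pi_old)
    moreover have "\<rho> x = R (c l) n" using \<rho>1[of x] 5 n by (simp add: pi_T)
    ultimately show ?thesis by simp
  qed
  have "conn E ((\<Union>x\<in>W. cl (pi x)) - Y) (\<rho> x) (\<rho> y)" if W: "W \<subseteq> V'" and con: "conn E' (W - old ` Y) x y" for W x y
  proof (rule conn_map[OF con])
    have m: "\<rho> w \<in> (\<Union>x\<in>W. cl (pi x)) - Y" if "w \<in> W - old ` Y" for w using \<rho>3[of w] that W by blast
    show "\<rho> x \<in> (\<Union>x\<in>W. cl (pi x)) - Y" using m conn_mem[OF con] by blast
    fix u v assume uv: "u \<in> W - old ` Y" "v \<in> W - old ` Y" "(u, v) \<in> E'"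
    then consider "\<rho> u = \<rho> v" | "(\<rho> u, \<rho> v) \<in> E" using edge by blast
    then show "conn E ((\<Union>x\<in>W. cl (pi x)) - Y) (\<rho> u) (\<rho> v)"
    proof cases
      case 1 then show ?thesis using m[OF uv(1)] by (simp add: conn_refl)
    next
      case 2 then show ?thesis by (rule conn_edge[OF m[OF uv(1)] m[OF uv(2)]])
    qed
  qed
  then have "projects_off Y \<rho>" unfolding projects_off_def using finY \<rho>1 \<rho>3 by simp
  moreover have "X \<subseteq> Y" by (simp add: Y_def)
  ultimately show ?thesis by blast
qed

definition PU :: "'a set \<Rightarrow> 'b set" where "PU U = {x \<in> V'. pi x \<in> U}"

text \<open>Edges along a new ray and rungs stay over a single class. A union of classes can
  therefore be entered only along an old edge, which is an edge of \<open>G\<close> as well.\<close>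

lemma PU_boundary:
  assumes U: "\<And>v. v \<in> U \<Longrightarrow> cl v \<subseteq> U" and xy: "(x, y) \<in> E'" "x \<notin> PU U" "y \<in> PU U"
  shows "\<exists>u\<in>U. \<exists>v. y = old u \<and> x = old v \<and> (v, u) \<in> E"
proof -
  have x: "x \<in> V'" using xy(1) graph' by (auto simp: graph_def)
  have yU: "pi y \<in> U" using xy(3) by (simp add: PU_def)
  have xU: "pi x \<notin> U" using xy(2) x by (simp add: PU_def)
  have RU: "R k m \<in> U" if "k \<in> K" "R k n \<in> U" for k m n using U[OF that(2)] cl_R[OF that(1)] by blast
  from xy(1) show ?thesis
  proof (cases rule: E'_cases)
    case (1 u v) then show ?thesis using yU by (auto simp: pi_old)
  next
    case (2 l n) then show ?thesis using yU xU RU[OF c_K[OF 2(1)]] by (simp add: pi_T)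
  next
    case (3 l n) then show ?thesis using yU xU RU[OF c_K[OF 3(1)]] by (simp add: pi_T)
  next
    case (4 l n) then show ?thesis using yU xU by (simp add: pi_T pi_old)
  next
    case (5 l n) then show ?thesis using yU xU by (simp add: pi_T pi_old)
  qed
qed

text \<open>If \<open>y\<close> keeps returning to some \<open>R k\<close> or its new rays, that \<open>R k\<close> serves as its image; otherwise
  \<open>pi \<circ> y\<close> is a walk visiting every vertex finitely often, which contains a ray.\<close>

lemma project_ray:
  assumes y: "is_ray V' E' y"
  shows "\<exists>N. is_ray V E N \<and> range N \<subseteq> (\<Union>x\<in>range y. cl (pi x)) \<and>
    (\<forall>Y \<rho> M. projects_off Y \<rho> \<longrightarrow> (\<exists>t\<ge>M. \<rho> (y t) \<in> range N))"
proof (cases "\<exists>k\<in>K. infinite {n. pi (y n) \<in> range (R k)}")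
  case True
  then obtain k where k: "k \<in> K" "infinite {n. pi (y n) \<in> range (R k)}" by blast
  have yV: "y n \<in> V'" for n using y by (auto simp: is_ray_def)
  have far: "\<exists>t\<ge>M. pi (y t) \<in> range (R k)" for M
    using k(2) infinite_nat_iff_unbounded_le[of "{n. pi (y n) \<in> range (R k)}"] by auto
  have cly: "cl (pi (y t)) = range (R k)" if "pi (y t) \<in> range (R k)" for t using that cl_R[OF k(1)] by auto
  have "range (R k) \<subseteq> (\<Union>x\<in>range y. cl (pi x))" using far[of 0] cly by blast
  moreover have "\<exists>t\<ge>M. \<rho> (y t) \<in> range (R k)" if pY: "projects_off Y \<rho>" for Y \<rho> M
  proof -
    have Y: "finite Y" "\<forall>x\<in>V' - old ` Y. \<rho> x \<in> cl (pi x)" using pY by (simp_all add: projects_off_def)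
    have "inj y" using y by (simp add: is_ray_def)
    from ray_avoids[OF this finite_imageI[OF Y(1)], of old] obtain M' where M': "\<forall>n\<ge>M'. y n \<notin> old ` Y" ..
    obtain t where t: "t \<ge> max M M'" "pi (y t) \<in> range (R k)" using far by blast
    then have "\<rho> (y t) \<in> cl (pi (y t))" using Y(2) M' yV by auto
    then show ?thesis using t cly by auto
  qed
  ultimately show ?thesis using R_ray[OF k(1)] by (intro exI[of _ "R k"] conjI allI impI) simp_all
next
  case False
  have yV: "y n \<in> V'" for n using y by (auto simp: is_ray_def)
  have injy: "inj y" using y by (simp add: is_ray_def)
  have "\<exists>N. is_ray V E N \<and> range N \<subseteq> range (\<lambda>n. pi (y n))"
  proof (rule finite_to_one_walk_ray)
    fix n
    have "(y n, y (Suc n)) \<in> E'" using y by (simp add: is_ray_def)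
    then show "pi (y n) = pi (y (Suc n)) \<or> (pi (y n), pi (y (Suc n))) \<in> E"
    proof (cases rule: E'_cases)
      case (1 u v) then show ?thesis by (simp add: pi_old)
    next
      case (2 l m) then show ?thesis using R_edge c_K by (simp add: pi_T)
    next
      case (3 l m) then show ?thesis using R_edge c_K symD[OF sym_E] by (simp add: pi_T)
    next
      case (4 l m) then show ?thesis by (simp add: pi_T pi_old)
    next
      case (5 l m) then show ?thesis by (simp add: pi_T pi_old)
    qed
  next
    fix v
    \<comment> \<open>If \<open>v\<close> lies on some \<open>R k\<close>, then already the whole of
      \<open>R k\<close> is visited finitely often; otherwise \<open>old v\<close> is the only
      vertex of \<open>V'\<close> over \<open>v\<close>.\<close>
    show "finite {n. pi (y n) = v}"
    proof (cases "\<exists>k\<in>K. v \<in> range (R k)")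
      case True
      then obtain k where k: "k \<in> K" "v \<in> range (R k)" by blast
      have "finite {n. pi (y n) \<in> range (R k)}" using False k(1) by blast
      then show ?thesis by (rule rev_finite_subset) (use k(2) in auto)
    next
      case nR: False
      have "{n. pi (y n) = v} \<subseteq> y -` {old v}"
      proof
        fix n assume "n \<in> {n. pi (y n) = v}"
        then have n: "pi (y n) = v" by simp
        from yV[of n] show "n \<in> y -` {old v}"
        proof (cases rule: V'_cases)
          case (1 w) then show ?thesis using n by (simp add: pi_old)
        next
          case (2 l m) then show ?thesis using n nR c_K[OF 2(1)] by (auto simp: pi_T)
        qed
      qed
      then show ?thesis by (rule finite_subset) (simp add: finite_vimageI[OF _ injy])
    qed
  next
    show "range (\<lambda>n. pi (y n)) \<subseteq> V" using pi_V yV by blast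
  qed
  then obtain N where N: "is_ray V E N" "range N \<subseteq> range (\<lambda>n. pi (y n))" by blast
  have "\<exists>t\<ge>M. \<rho> (y t) \<in> range N" if pY: "projects_off Y \<rho>" for Y \<rho> M
  proof -
    have Y: "finite Y" "\<forall>x. pi x \<notin> Y \<longrightarrow> \<rho> x = pi x" using pY by (simp_all add: projects_off_def)
    have "inj N" using N by (simp add: is_ray_def)
    have "finite (Y \<union> (\<lambda>n. pi (y n)) ` {..<M})" using Y by simp
    from ray_avoids[OF \<open>inj N\<close> this] obtain i where i: "N i \<notin> Y" "N i \<notin> (\<lambda>n. pi (y n)) ` {..<M}" by blast
    obtain t where t: "N i = pi (y t)" using N(2) by blast
    then have "t \<ge> M" using i(2) by (metis imageI lessThan_iff not_le)
    moreover have "\<rho> (y t) = N i" using Y(2) t i(1) by simp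
    ultimately show ?thesis by (metis rangeI)
  qed
  moreover have "range N \<subseteq> (\<Union>x\<in>range y. cl (pi x))"
  proof
    fix v assume "v \<in> range N"
    then obtain t where "v = pi (y t)" using N(2) by blast
    then show "v \<in> (\<Union>x\<in>range y. cl (pi x))" using cl_self[of v] by auto
  qed
  ultimately show ?thesis using N(1) by (intro exI[of _ N] conjI allI impI) simp_all
qed

text \<open>The paths in \<open>Q\<close> are the teeth of a comb with spine \<open>y\<close>. To
  attach \<open>N\<close> to \<open>U\<close> off \<open>X\<close>, start where \<open>N\<close>
  meets the projected spine far out, follow the spine to a tooth missing the old copies of
  \<open>Y\<close>, and climb it to its last vertex before \<open>PU U\<close>. By
  \<open>PU_boundary\<close> the remaining edge belongs to \<open>G\<close>.\<close>

lemma project_comb: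
  assumes k0: "k0 \<in> K" and y: "is_ray V' E' y" "equiv_rays V' E' y (\<lambda>n. old (R k0 n))"
    and U: "\<And>v. v \<in> U \<Longrightarrow> cl v \<subseteq> U"
    and Z: "range y \<subseteq> Z" "Z \<subseteq> V'" "Z \<inter> PU U = {}"
    and Q: "infinite Q" "disjoint_paths Q" "\<And>q. q \<in> Q \<Longrightarrow> is_path V' E' q" "\<And>q. q \<in> Q \<Longrightarrow> hd q \<in> range y"
      "\<And>q. q \<in> Q \<Longrightarrow> set (butlast q) \<subseteq> Z" "\<And>q. q \<in> Q \<Longrightarrow> butlast q \<noteq> []" "\<And>q. q \<in> Q \<Longrightarrow> last q \<in> PU U"
  shows "\<exists>N. N \<in> \<epsilon> \<and> range N \<subseteq> (\<Union>x\<in>Z. cl (pi x)) \<and> (\<forall>X. finite X \<longrightarrow>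
    (\<exists>a\<in>range N. \<exists>z. \<exists>u\<in>U - X. conn E ((\<Union>x\<in>Z. cl (pi x)) - X) a z \<and> (z, u) \<in> E))"
proof -
  let ?Z = "\<Union>x\<in>Z. cl (pi x)"
  have ZV: "?Z \<subseteq> V" using cl_V pi_V Z(2) by blast
  have injy: "inj y" using y(1) by (simp add: is_ray_def)
  obtain N where N: "is_ray V E N" "range N \<subseteq> (\<Union>x\<in>range y. cl (pi x))"
    and Nt: "\<And>Y \<rho> M. projects_off Y \<rho> \<Longrightarrow> \<exists>t\<ge>M. \<rho> (y t) \<in> range N"
    using project_ray[OF y(1)] by (elim exE conjE) (rule that, assumption, assumption, simp)
  have NZ: "range N \<subseteq> ?Z" using N(2) Z(1) by blast
  have "equiv_rays V E (R k0) N"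
  proof (rule equiv_rays_sym[OF sym_E], rule equiv_rays_iff[OF sym_E, THEN iffD2], intro allI impI)
    fix X :: "'a set" assume "finite X"
    from projection_exists[OF this] obtain Y \<rho> where XY: "X \<subseteq> Y" and pY: "projects_off Y \<rho>" by blast
    have Y: "finite Y" "\<And>x. pi x \<notin> Y \<Longrightarrow> \<rho> x = pi x"
      and pr: "\<And>W x y. W \<subseteq> V' \<Longrightarrow> conn E' (W - old ` Y) x y \<Longrightarrow> conn E ((\<Union>x\<in>W. cl (pi x)) - Y) (\<rho> x) (\<rho> y)"
      using pY by (simp_all add: projects_off_def)
    from ray_avoids[OF injy finite_imageI[OF Y(1)], of old] obtain M where M: "\<forall>n\<ge>M. y n \<notin> old ` Y" ..
    obtain t where t: "t \<ge> M" "\<rho> (y t) \<in> range N" using Nt[OF pY] by blast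
    from equiv_rays_far[OF sym_E' y(2) finite_imageI[OF Y(1)], of M 0 old] obtain a b where
      ab: "a \<ge> M" "conn E' (V' - old ` Y) (y a) (old (R k0 b))" by blast
    have "conn E' (V' - old ` Y) (y t) (y a)" using y(1) M t(1) ab(1)
      by (intro conn_ray[OF sym_E' y(1), of M]) (auto simp: is_ray_def)
    from conn_trans[OF this ab(2)] have "conn E ((\<Union>x\<in>V'. cl (pi x)) - Y) (\<rho> (y t)) (\<rho> (old (R k0 b)))"
      by (rule pr[OF order_refl])
    moreover have "R k0 b \<notin> Y" using conn_mem(2)[OF ab(2)] by blast
    then have "\<rho> (old (R k0 b)) = R k0 b" using Y(2) by (simp add: pi_old)
    moreover have "(\<Union>x\<in>V'. cl (pi x)) - Y \<subseteq> V - X" using cl_V pi_V XY by blast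
    moreover obtain i where "\<rho> (y t) = N i" using t(2) by blast
    ultimately have "conn E (V - X) (N i) (R k0 b)" using conn_mono by (metis order_refl)
    then show "\<exists>a b. conn E (V - X) (N a) (R k0 b)" by blast
  qed
  then have Ne: "N \<in> \<epsilon>" using end_equiv[OF G R_end[OF k0]] N(1) by simp
  have "\<exists>a\<in>range N. \<exists>z. \<exists>u\<in>U - X. conn E (?Z - X) a z \<and> (z, u) \<in> E" if X: "finite X" for X
  proof -
    from projection_exists[OF X] obtain Y \<rho> where XY: "X \<subseteq> Y" and pY: "projects_off Y \<rho>" by blast
    have Y: "finite Y" "\<And>x. pi x \<notin> Y \<Longrightarrow> \<rho> x = pi x"
      and pr: "\<And>W x y. W \<subseteq> V' \<Longrightarrow> conn E' (W - old ` Y) x y \<Longrightarrow> conn E ((\<Union>x\<in>W. cl (pi x)) - Y) (\<rho> x) (\<rho> y)"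
      using pY by (simp_all add: projects_off_def)
    from ray_avoids[OF injy finite_imageI[OF Y(1)], of old] obtain M where M: "\<forall>n\<ge>M. y n \<notin> old ` Y" ..
    obtain t where t: "t \<ge> M" "\<rho> (y t) \<in> range N" using Nt[OF pY] by blast
    \<comment> \<open>Avoiding the first \<open>M\<close> vertices of the spine makes the tooth
      start in the part of \<open>y\<close> that is clear of the old copies of
      \<open>Y\<close>.\<close>
    have "finite (old ` Y \<union> y ` {..<M})" using Y(1) by simp
    from disjoint_paths_escape[OF Q(1,2) this] obtain q where q: "q \<in> Q" "set q \<inter> (old ` Y \<union> y ` {..<M}) = {}" by blast
    note q' = Q(3-7)[OF q(1)]
    have qne: "q \<noteq> []" using q'(4) by auto
    obtain b where b: "hd q = y b" using q'(2) by blast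
    have "hd q \<in> set q" using qne by simp
    then have bM: "b \<ge> M" using q(2) b by (metis IntI UnI2 emptyE imageI lessThan_iff not_le)
    define z where "z = last (butlast q)"
    have zb: "z \<in> set (butlast q)" using q'(4) by (simp add: z_def)
    note pb = is_path_butlast(1)[OF q'(1,4)] and hb = is_path_butlast(3)[OF q'(1,4)]
    have zl: "(z, last q) \<in> E'" unfolding z_def by (rule is_path_butlast(2)[OF q'(1,4)])
    have znU: "z \<notin> PU U" using zb q'(3) Z(3) by blast
    obtain u v where u: "u \<in> U" "last q = old u" "z = old v" "(v, u) \<in> E" using PU_boundary[OF U zl znU q'(5)] by blast
    have sq: "set (butlast q) \<subseteq> Z - old ` Y" using q'(3) q(2) in_set_butlastD[of _ q] by blast
    have "conn E' (Z - old ` Y) (y t) (y b)" using Z(1) M t(1) bM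
      by (intro conn_ray[OF sym_E' y(1), of M]) auto
    moreover have "conn E' (Z - old ` Y) (y b) z"
      using conn_path[OF sym_E' pb sq _ zb, of "hd (butlast q)"] hd_in_set[OF q'(4)] hb b by simp
    ultimately have "conn E' (Z - old ` Y) (y t) z" by (rule conn_trans)
    then have con: "conn E (?Z - Y) (\<rho> (y t)) (\<rho> z)" by (rule pr[OF Z(2)])
    have "v \<notin> Y" using sq zb u(3) by blast
    then have "\<rho> z = v" using Y(2) u(3) by (simp add: pi_old)
    moreover have "conn E (?Z - X) (\<rho> (y t)) (\<rho> z)" by (rule conn_mono[OF con order_refl]) (use XY in blast)
    moreover have "u \<notin> X"
    proof -
      have "last q \<in> set q" using qne by simp
      then have "u \<notin> Y" using q(2) u(2) by blast
      then show ?thesis using XY by blast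
    qed
    ultimately show ?thesis using t(2) u(1,4) by blast
  qed
  then show ?thesis using Ne NZ by blast
qed

section \<open>Transferring a connected ray graph back to \<open>G\<close>\<close>

text \<open>The only way out of \<open>T l\<close> is by a rung to the old copy of
  \<open>R (c l)\<close>.\<close>

lemma ray_stays_in_T:
  assumes N: "is_ray V' E' N" "N i \<in> range (T l)" "range N \<inter> old ` range (R (c l)) = {}"
  shows "range N \<subseteq> range (T l)"
proof
  fix x assume "x \<in> range N"
  then obtain j where j: "x = N j" by blast
  have "conn E' (range N) (N i) (N j)" by (rule conn_ray[OF sym_E' N(1), of 0]) auto
  then have cn: "conn E' (range N \<inter> range (T l)) (N i) (N j)"
  proof (rule conn_closed[OF _ N(2)])
    fix u v assume uv: "(u, v) \<in> E'" "u \<in> range (T l) \<inter> range N" "v \<in> range N"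
    then have "u \<in> range (T l)" by simp
    from T_neighbours[OF uv(1) this] show "v \<in> range (T l)"
    proof
      assume "\<exists>n. u = T l n \<and> v = old (R (c l) n)"
      then have "v \<in> old ` range (R (c l))" by auto
      then show ?thesis using uv(3) N(3) by (metis disjoint_iff)
    qed
  qed
  from conn_mem(2)[OF cn] show "x \<in> range (T l)" using j by simp
qed

lemma new_ray:
  assumes N: "is_ray V' E' N" "range N \<inter> old ` V = {}"
  shows "\<exists>l\<in>L. range N \<subseteq> range (T l)"
proof -
  have "N 0 \<in> V'" using N(1) by (auto simp: is_ray_def)
  then show ?thesis
  proof (cases rule: V'_cases)
    case (1 v) then show ?thesis using N(2) by (metis disjoint_iff imageI rangeI)
  next
    case (2 l n)
    have "range (R (c l)) \<subseteq> V" using R_V[OF c_K[OF 2(1)]] by blast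
    then have "range N \<inter> old ` range (R (c l)) = {}" using N(2) by blast
    from ray_stays_in_T[OF N(1) _ this, of 0] show ?thesis using 2 by auto
  qed
qed

text \<open>The quotient supplies \<open>|K|\<close> rays around one node. Each ray and its paths to
  the centre form a territory; countably many bad territories are discarded, the others are
  projected as combs over a countable set \<open>U\<close>, and
  \<open>star_over_countable_set\<close> builds a star from them.\<close>

lemma witness_projects:
  assumes K: "Cinfinite |K|" "regularCard |K|" "uncountable K" "k0 \<in> K"
    and c_small: "\<And>A. A \<subseteq> L \<Longrightarrow> |c ` A| <o |K| \<Longrightarrow> |A| <o |L|" and KL: "|K| \<le>o |L|"
    and \<R>: "\<R> \<subseteq> {S. is_ray V' E' S \<and> equiv_rays V' E' (\<lambda>n. old (R k0 n)) S}" "disjoint_rays \<R>" "|\<R>| =o |L|"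
      "is_ray_graph V' E' \<R> H" "connected_graph \<R> H"
  shows "has_connected_ray_graph V E \<epsilon> |K|"
proof -
  have ray: "is_ray V' E' S" if "S \<in> \<R>" for S using \<R>(1) that by blast
  have S_dj: "range S \<inter> range S' = {}" if "S \<in> \<R>" "S' \<in> \<R>" "S \<noteq> S'" for S S'
    using \<R>(2) that by (simp add: disjoint_rays_def)
  have uL: "uncountable L" using K(3) KL countable_ordLeq by blast
  have infL: "infinite L" using uL countable_finite by blast
  obtain \<P> where gH: "graph \<R> H" and P1: "\<forall>p\<in>\<P>. Rpath V' E' \<R> p" and P2: "independent_paths \<P>"
    and P3: "\<forall>(R, S)\<in>H. \<exists>Q. Q \<subseteq> \<P> \<and> infinite Q \<and> disjoint_paths Q \<and> (\<forall>p\<in>Q. RS_path V' E' R S p)"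
    using \<R>(4) unfolding is_ray_graph_def by (elim exE conjE) (rule that)
  have HR: "H \<subseteq> \<R> \<times> \<R>" using gH by (simp add: graph_def)
  define om where "om S \<longleftrightarrow> range S \<inter> old ` V \<noteq> {}" for S :: "nat \<Rightarrow> 'b"
  have "\<forall>S\<in>{S \<in> \<R>. \<not> om S}. \<exists>l. l \<in> L \<and> range S \<subseteq> range (T l)"
  proof
    fix S assume S: "S \<in> {S \<in> \<R>. \<not> om S}"
    then have "range S \<inter> old ` V = {}" by (simp add: om_def)
    then show "\<exists>l. l \<in> L \<and> range S \<subseteq> range (T l)" using new_ray[OF ray] S by blast
  qed
  from bchoice[OF this] obtain lab where lab': "\<forall>S\<in>{S \<in> \<R>. \<not> om S}. lab S \<in> L \<and> range S \<subseteq> range (T (lab S))" ..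
  have lab: "lab S \<in> L" "range S \<subseteq> range (T (lab S))" if "S \<in> \<R>" "\<not> om S" for S using lab' that by simp_all
  \<comment> \<open>Only rays lying inside new rays are merged, according to the \<open>R k\<close>
    on which they hang. A ray that meets an old vertex stays a node of its own.\<close>
  define \<phi> :: "(nat \<Rightarrow> 'b) \<Rightarrow> (nat \<Rightarrow> 'b) + 'k" where "\<phi> S = (if om S then Inl S else Inr (c (lab S)))" for S
  \<comment> \<open>With fewer than \<open>|K|\<close> nodes there would be fewer than
    \<open>|K|\<close> rays meeting old vertices, and by \<open>c_small\<close> fewer than
    \<open>|L|\<close> labels of the remaining rays. As each \<open>T l\<close> is countable,
    comparing initial vertices leaves fewer than \<open>|L|\<close> rays in total.\<close>
  have big: "\<not> |\<phi> ` \<R>| <o |K|"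
  proof
    assume small: "|\<phi> ` \<R>| <o |K|"
    define Old where "Old = {S \<in> \<R>. om S}"
    define New where "New = {S \<in> \<R>. \<not> om S}"
    have "|Old| \<le>o |\<phi> ` \<R>|"
      by (rule card_of_ordLeqI[of \<phi>]) (auto simp: Old_def \<phi>_def inj_on_def)
    then have Old: "|Old| <o |L|" using small KL by (meson ordLeq_ordLess_trans ordLess_ordLeq_trans)
    let ?A = "lab ` New"
    have "|c ` ?A| \<le>o |\<phi> ` \<R>|"
    proof (rule card_of_ordLeqI[of Inr])
      fix a assume "a \<in> c ` ?A"
      then obtain S where "S \<in> New" "a = c (lab S)" by blast
      then show "Inr a \<in> \<phi> ` \<R>" by (intro image_eqI[of _ _ S]) (auto simp: New_def \<phi>_def)
    qed simp
    then have "|c ` ?A| <o |K|" using small ordLeq_ordLess_trans by blast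
    moreover have "?A \<subseteq> L" using lab(1) by (auto simp: New_def)
    ultimately have A: "|?A| <o |L|" using c_small by blast
    have TA: "|\<Union>l\<in>?A. range (T l)| <o |L|"
    proof (cases "finite ?A")
      case True
      then have "countable (\<Union>l\<in>?A. range (T l))" by (intro countable_UN) (auto simp: countable_finite)
      then show ?thesis using countable_ordLess_uncountable uL by blast
    next
      case False
      have "|range (T l)| \<le>o |?A|" for l
      proof -
        have "countable (range (T l))" by simp
        then show ?thesis using False by (meson countable_card_le_natLeq infinite_iff_natLeq_ordLeq ordLeq_transitive)
      qed
      then have "|\<Union>l\<in>?A. range (T l)| \<le>o |?A|"
        by (intro card_of_UNION_ordLeq_infinite[OF False card_of_mono1[OF order_refl]]) blast
      then show ?thesis using A ordLeq_ordLess_trans by blast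
    qed
    have "|New| \<le>o |\<Union>l\<in>?A. range (T l)|"
    proof (rule card_of_ordLeqI[of "\<lambda>S. S 0"])
      show "inj_on (\<lambda>S. S 0) New"
      proof (rule inj_onI, rule ccontr)
        fix S S' assume SS: "S \<in> New" "S' \<in> New" "S 0 = S' 0" "S \<noteq> S'"
        then have "range S \<inter> range S' = {}" using S_dj by (simp add: New_def)
        then show False using SS(3) by (metis disjoint_iff rangeI)
      qed
      fix S assume S: "S \<in> New"
      then have "range S \<subseteq> range (T (lab S))" using lab(2) by (simp add: New_def)
      then show "S 0 \<in> (\<Union>l\<in>?A. range (T l))" using S by blast
    qed
    then have "|New| <o |L|" using TA ordLeq_ordLess_trans by blast
    with Old have "|Old \<union> New| <o |L|" by (rule card_of_Un_ordLess_infinite[OF infL])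
    moreover have "Old \<union> New = \<R>" by (auto simp: Old_def New_def)
    ultimately show False using \<R>(3) not_ordLess_ordIso by auto
  qed
  obtain \<nu> where \<nu>: "\<nu> \<in> \<phi> ` \<R>" "\<not> |{\<phi> y | x y. (x, y) \<in> H \<and> \<phi> x = \<nu>}| <o |K|"
    using connected_large_degree[OF K(1-3) \<R>(5) HR big] by blast
  define Nb where "Nb = {\<phi> y | x y. (x, y) \<in> H \<and> \<phi> x = \<nu>}"
  have "|K| \<le>o |Nb|" using \<nu>(2) card_of_not_ordLeq unfolding Nb_def by blast
  then obtain f where f: "inj_on f K" "f ` K \<subseteq> Nb" unfolding card_of_ordLeq[symmetric] by blast
  have fK: "|f ` K| =o |K|" using card_of_ordIsoI[OF inj_on_imp_bij_betw[OF f(1)]] ordIso_symmetric by blast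
  have unc: "uncountable (f ` K)" by (rule uncountable_ordIso[OF fK K(3)])
  \<comment> \<open>If the centre is a single ray, \<open>U\<close> is the union of the classes it
    meets. If it is a merged group, possibly uncountable, all its rays lie over one
    \<open>R k\<close>, which serves as \<open>U\<close>.\<close>
  have "\<exists>U. countable U \<and> (\<forall>v\<in>U. cl v \<subseteq> U) \<and> (\<forall>S\<in>\<R>. \<phi> S = \<nu> \<longrightarrow> range S \<subseteq> PU U)"
  proof (cases \<nu>)
    case (Inl C)
    let ?U = "\<Union>n. cl (pi (C n))"
    have "countable ?U" using cl_countable by (intro countable_UN) auto
    moreover have "\<forall>v\<in>?U. cl v \<subseteq> ?U" using cl_eq by blast
    moreover have "range S \<subseteq> PU ?U" if S: "S \<in> \<R>" "\<phi> S = \<nu>" for S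
    proof -
      have "S = C" using S(2) Inl by (simp add: \<phi>_def split: if_splits)
      then show ?thesis using ray[OF S(1)] cl_self by (auto simp: PU_def is_ray_def)
    qed
    ultimately show ?thesis by (intro exI[of _ ?U]) blast
  next
    case (Inr k)
    obtain S0 where "S0 \<in> \<R>" "\<phi> S0 = Inr k" using \<nu>(1) Inr by auto
    then have k: "k \<in> K" using lab(1)[of S0] c_K by (auto simp: \<phi>_def split: if_splits)
    have "\<forall>v\<in>range (R k). cl v \<subseteq> range (R k)" using cl_R[OF k] by auto
    moreover have "range S \<subseteq> PU (range (R k))" if S: "S \<in> \<R>" "\<phi> S = \<nu>" for S
    proof -
      have o: "\<not> om S" "c (lab S) = k" using S(2) Inr by (auto simp: \<phi>_def split: if_splits)
      show ?thesis
      proof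
        fix z assume "z \<in> range S"
        then obtain n where "z = T (lab S) n" using lab(2)[OF S(1) o(1)] by blast
        then show "z \<in> PU (range (R k))" using o(2) T_V'[OF lab(1)[OF S(1) o(1)]] by (simp add: PU_def pi_T)
      qed
    qed
    ultimately show ?thesis by (intro exI[of _ "range (R k)"]) auto
  qed
  then obtain U where cU: "countable U" and clU: "\<And>v. v \<in> U \<Longrightarrow> cl v \<subseteq> U"
    and centre: "\<And>S. S \<in> \<R> \<Longrightarrow> \<phi> S = \<nu> \<Longrightarrow> range S \<subseteq> PU U" by blast
  define J0 where "J0 = f ` K - {\<nu>}"
  have "\<forall>e\<in>J0. \<exists>xy. xy \<in> H \<and> \<phi> (fst xy) = \<nu> \<and> \<phi> (snd xy) = e"
  proof
    fix e assume "e \<in> J0"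
    then have "e \<in> Nb" using f(2) by (auto simp: J0_def)
    then obtain x y where "e = \<phi> y" "(x, y) \<in> H" "\<phi> x = \<nu>" unfolding Nb_def by blast
    then show "\<exists>xy. xy \<in> H \<and> \<phi> (fst xy) = \<nu> \<and> \<phi> (snd xy) = e" by (intro exI[of _ "(x, y)"]) simp
  qed
  from bchoice[OF this] obtain xy where xy: "\<forall>e\<in>J0. xy e \<in> H \<and> \<phi> (fst (xy e)) = \<nu> \<and> \<phi> (snd (xy e)) = e" ..
  define x where "x e = fst (xy e)" for e
  define y where "y e = snd (xy e)" for e
  have XY: "(x e, y e) \<in> H" "\<phi> (x e) = \<nu>" "\<phi> (y e) = e" "x e \<in> \<R>" "y e \<in> \<R>" "e \<noteq> \<nu>" if "e \<in> J0" for e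
  proof -
    show 1: "(x e, y e) \<in> H" "\<phi> (x e) = \<nu>" "\<phi> (y e) = e" using bspec[OF xy that] by (simp_all add: x_def y_def)
    show "x e \<in> \<R>" "y e \<in> \<R>" using 1(1) HR by blast+
    show "e \<noteq> \<nu>" using that by (simp add: J0_def)
  qed
  have xy_dj: "range (y e) \<inter> range (x e') = {}" if "e \<in> J0" "e' \<in> J0" for e e'
    by (rule S_dj) (use XY[OF that(1)] XY[OF that(2)] in auto)
  have yy_dj: "range (y e) \<inter> range (y e') = {}" if "e \<in> J0" "e' \<in> J0" "e \<noteq> e'" for e e'
    by (rule S_dj) (use XY[OF that(1)] XY[OF that(2)] that(3) in auto)
  have "\<forall>e\<in>J0. \<exists>Q. Q \<subseteq> \<P> \<and> infinite Q \<and> disjoint_paths Q \<and> (\<forall>p\<in>Q. RS_path V' E' (x e) (y e) p)"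

  proof
    fix e assume "e \<in> J0"
    from bspec[OF P3 XY(1)[OF this]]
    show "\<exists>Q. Q \<subseteq> \<P> \<and> infinite Q \<and> disjoint_paths Q \<and> (\<forall>p\<in>Q. RS_path V' E' (x e) (y e) p)" by simp
  qed
  from bchoice[OF this] obtain P where P: "\<forall>e\<in>J0. P e \<subseteq> \<P> \<and> infinite (P e) \<and> disjoint_paths (P e) \<and>
    (\<forall>p\<in>P e. RS_path V' E' (x e) (y e) p)" ..
  \<comment> \<open>\<open>RS_path\<close> leaves the direction of the list open; here all paths are
    oriented from \<open>y e\<close> towards the centre.\<close>
  define Q where "Q e = {q. AB_path V' E' (range (y e)) (range (x e)) q \<and> (q \<in> P e \<or> rev q \<in> P e)}" for e
  have Qp: "\<exists>p\<in>P e. set p = set q \<and> inner p = inner q \<and> (p = q \<or> p = rev q)" if "q \<in> Q e" for e q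
  proof -
    have "q \<in> P e \<or> rev q \<in> P e" using that by (simp add: Q_def)
    then show ?thesis using inner_rev[of q] by (metis set_rev)
  qed
  have Q1: "is_path V' E' q" "q \<noteq> []" "set q \<inter> range (y e) = {hd q}" "set q \<inter> range (x e) = {last q}"
      "hd q \<in> range (y e)" "last q \<in> range (x e)" "inner q = set q - {hd q, last q}" "length q \<ge> 2"
    if e: "e \<in> J0" and q: "q \<in> Q e" for e q
  proof -
    have ab: "AB_path V' E' (range (y e)) (range (x e)) q" using q by (simp add: Q_def)
    then show p: "is_path V' E' q" "q \<noteq> []" by (auto simp: AB_path_def is_path_def)
    show hl: "set q \<inter> range (y e) = {hd q}" "set q \<inter> range (x e) = {last q}" using ab by (simp_all add: AB_path_def)
    have "hd q \<in> set q \<inter> range (y e)" "last q \<in> set q \<inter> range (x e)" unfolding hl by simp_all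
    then show 2: "hd q \<in> range (y e)" "last q \<in> range (x e)" by simp_all
    have ne: "hd q \<noteq> last q" using 2 xy_dj[OF e e] by (metis disjoint_iff)
    have "distinct q" using p by (simp add: is_path_def)
    from inner_path[OF p(2) this ne] show "inner q = set q - {hd q, last q}" "length q \<ge> 2" by simp_all
  qed
  have Q2: "inner q \<inter> range S = {}" if e: "e \<in> J0" and q: "q \<in> Q e" and S: "S \<in> \<R>" for e q S
  proof -
    obtain p where p: "p \<in> P e" "inner p = inner q" using Qp[OF q] by blast
    then have "Rpath V' E' \<R> p" using P e P1 by blast
    then show ?thesis using p(2) S by (auto simp: Rpath_def)
  qed
  have infQ: "infinite (Q e)" if e: "e \<in> J0" for e
  proof
    assume fin: "finite (Q e)"
    have "P e \<subseteq> Q e \<union> rev ` Q e"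
    proof
      fix p assume p: "p \<in> P e"
      then have rs: "RS_path V' E' (x e) (y e) p" using P e by blast
      show "p \<in> Q e \<union> rev ` Q e"
      proof (cases "AB_path V' E' (range (x e)) (range (y e)) p")
        case True
        from AB_path_rev[OF sym_E' True] have "rev p \<in> Q e" using p by (simp add: Q_def)
        then show ?thesis by (metis UnI2 imageI rev_rev_ident)
      next
        case False
        then have "AB_path V' E' (range (x e)) (range (y e)) (rev p)" using rs by (simp add: RS_path_def)
        from AB_path_rev[OF sym_E' this] show ?thesis using p by (simp add: Q_def)
      qed
    qed
    then have "finite (P e)" using fin finite_subset by blast
    then show False using P e by blast
  qed
  have djQ: "disjoint_paths (Q e)" if e: "e \<in> J0" for e
    unfolding disjoint_paths_def
  proof (intro ballI impI)
    fix q q' assume q: "q \<in> Q e" "q' \<in> Q e" "q \<noteq> q'"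
    obtain p where p: "p \<in> P e" "set p = set q" "p = q \<or> p = rev q" using Qp[OF q(1)] by blast
    obtain p' where p': "p' \<in> P e" "set p' = set q'" "p' = q' \<or> p' = rev q'" using Qp[OF q(2)] by blast
    have "p \<noteq> p'"
    proof
      assume "p = p'"
      then have "q' = rev q" using p(3) p'(3) q(3) by auto
      then have "last q \<in> range (y e)" using Q1(5)[OF e q(2)] by (simp add: hd_rev)
      then show False using Q1(6)[OF e q(1)] xy_dj[OF e e] by blast
    qed
    moreover have "disjoint_paths (P e)" using P e by blast
    ultimately have "set p \<inter> set p' = {}" using p(1) p'(1) by (simp add: disjoint_paths_def)
    then show "set q \<inter> set q' = {}" using p(2) p'(2) by simp
  qed
  \<comment> \<open>The ends on the centre rays are left out, since paths of different
    \<open>e\<close> may share them.\<close>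
  define Z where "Z e = range (y e) \<union> (\<Union>q\<in>Q e. inner q)" for e
  have Zdj: "Z e \<inter> Z e' = {}" if e: "e \<in> J0" "e' \<in> J0" "e \<noteq> e'" for e e'
  proof -
    have "inner q \<inter> inner q' = {}" if q: "q \<in> Q e" "q' \<in> Q e'" for q q'
    proof -
      obtain p where p: "p \<in> P e" "set p = set q" "inner p = inner q" using Qp[OF q(1)] by blast
      obtain p' where p': "p' \<in> P e'" "set p' = set q'" "inner p' = inner q'" using Qp[OF q(2)] by blast
      \<comment> \<open>Independence speaks about different paths only. A common path would contain
        a vertex of \<open>y e'\<close>, which could only be one of its ends on \<open>y e\<close>
        or \<open>x e\<close>, but these rays are disjoint from \<open>y e'\<close>.\<close>
      have "p \<noteq> p'"
      proof
        assume eq: "p = p'"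
        have hd: "hd q' \<in> set q" using hd_in_set[OF Q1(2)[OF e(2) q(2)]] eq p(2) p'(2) by simp
        have hy: "hd q' \<in> range (y e')" by (rule Q1(5)[OF e(2) q(2)])
        then have "hd q' \<notin> inner q" using Q2[OF e(1) q(1) XY(5)[OF e(2)]] by blast
        then have "hd q' = hd q \<or> hd q' = last q" using hd Q1(7)[OF e(1) q(1)] by blast
        then show False
          using hy Q1(5,6)[OF e(1) q(1)] yy_dj[OF e] xy_dj[OF e(2,1)] by (metis disjoint_iff)
      qed
      moreover have "p \<in> \<P>" "p' \<in> \<P>" using P e p(1) p'(1) by blast+
      ultimately have "inner p \<inter> set p' = {}" using P2 by (simp add: independent_paths_def)
      then show ?thesis using inner_subset[of p'] p(3) p'(3) by blast
    qed
    moreover have "inner q \<inter> range (y e') = {}" if "q \<in> Q e" for q using Q2[OF e(1) that XY(5)[OF e(2)]] .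
    moreover have "inner q \<inter> range (y e) = {}" if "q \<in> Q e'" for q using Q2[OF e(2) that XY(5)[OF e(1)]] .
    ultimately show ?thesis using yy_dj[OF e] unfolding Z_def by blast
  qed
  have cZ: "countable (Z e)" if e: "e \<in> J0" for e
  proof -
    have "countable (Q e)"
      by (rule disjoint_AB_paths_countable[of _ V' E' "y e" "range (x e)", OF djQ[OF e]]) (simp add: Q_def)
    moreover have "countable (inner q)" for q :: "'b list" by (simp add: inner_def countable_finite)
    ultimately show ?thesis unfolding Z_def by (intro countable_Un countable_UN) auto
  qed
  have ZV: "Z e \<subseteq> V'" if e: "e \<in> J0" for e
  proof -
    have "range (y e) \<subseteq> V'" using ray[OF XY(5)[OF e]] by (simp add: is_ray_def)
    moreover have "inner q \<subseteq> V'" if "q \<in> Q e" for q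
      using Q1(1)[OF e that] inner_subset[of q] by (auto simp: is_path_def)
    ultimately show ?thesis unfolding Z_def by blast
  qed
  \<comment> \<open>Besides territories meeting old copies of \<open>U\<close>, the groups
    \<open>Inr k\<close> with \<open>R k\<close> meeting \<open>U\<close> must go: a ray inside a
    new ray on such an \<open>R k\<close> lies over \<open>U\<close> without containing any old
    vertex. Both kinds are countable in number.\<close>
  define J1 where "J1 = J0 - ({e \<in> J0. Z e \<inter> old ` U \<noteq> {}} \<union> Inr ` {k \<in> K. range (R k) \<inter> U \<noteq> {}})"
  have c1: "countable {e \<in> J0. Z e \<inter> old ` U \<noteq> {}}"
    by (rule disjoint_family_meet_countable[OF Zdj]) (simp_all add: cU)
  have c2: "countable {k \<in> K. range (R k) \<inter> U \<noteq> {}}"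
    by (rule disjoint_family_meet_countable[OF R_disjoint]) (simp_all add: cU)
  have "countable ({\<nu>} \<union> ({e \<in> J0. Z e \<inter> old ` U \<noteq> {}} \<union> Inr ` {k \<in> K. range (R k) \<inter> U \<noteq> {}}))"
    using c1 c2 by (intro countable_Un countable_image) simp_all
  moreover have "J1 = f ` K - ({\<nu>} \<union> ({e \<in> J0. Z e \<inter> old ` U \<noteq> {}} \<union> Inr ` {k \<in> K. range (R k) \<inter> U \<noteq> {}}))"
    unfolding J1_def by (simp only: J0_def Diff_eq Int_assoc Compl_Un)
  ultimately have "|J1| =o |f ` K|" using card_of_Diff_countable[OF unc] by simp
  then have J1K: "|J1| =o |K|" using fK ordIso_transitive by blast
  have J10: "J1 \<subseteq> J0" by (auto simp: J1_def)
  have yU: "range (y e) \<inter> PU U = {}" if e: "e \<in> J1" for e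
  proof (rule ccontr)
    assume "range (y e) \<inter> PU U \<noteq> {}"
    then obtain i where i: "y e i \<in> V'" "pi (y e i) \<in> U" by (auto simp: PU_def)
    have e0: "e \<in> J0" using e J10 by blast
    have no: "range (y e) \<inter> old ` U = {}" using e by (auto simp: J1_def Z_def)
    from i(1) show False
    proof (cases rule: V'_cases)
      case (1 v) then show False using i(2) no by (metis disjoint_iff imageI pi_old rangeI)
    next
      case (2 l n)
      have RU: "R (c l) n \<in> U" using i(2) 2 by (simp add: pi_T)
      then have "range (R (c l)) \<subseteq> U" using clU cl_R[OF c_K[OF 2(1)]] by blast
      then have "range (y e) \<inter> old ` range (R (c l)) = {}" using no by blast
      then have sub: "range (y e) \<subseteq> range (T l)" using ray_stays_in_T[OF ray[OF XY(5)[OF e0]], of i l] 2(2) by simp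
      have o: "\<not> om (y e)"
      proof
        assume "om (y e)"
        then obtain z where z: "z \<in> range (y e)" "z \<in> old ` V" unfolding om_def by blast
        obtain v where "z = old v" using z(2) by blast
        moreover obtain m where "z = T l m" using subsetD[OF sub z(1)] by blast
        ultimately show False using old_T[of v l m] by simp
      qed
      have "y e 0 \<in> range (T (lab (y e)))" "y e 0 \<in> range (T l)" using lab(2)[OF XY(5)[OF e0] o] sub by blast+
      then have "lab (y e) = l" using T_eq by (metis imageE)
      then have "e = Inr (c l)" using XY(3)[OF e0] o by (simp add: \<phi>_def)
      then show False using e c_K[OF 2(1)] RU by (auto simp: J1_def)
    qed
  qed
  \<comment> \<open>The path starts outside \<open>PU U\<close> and by \<open>PU_boundary\<close>
    enters it at an old copy of a vertex of \<open>U\<close>. The territory contains no such vertex,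
    so the entry is the last vertex of the path.\<close>
  have Qq: "set (butlast q) \<subseteq> Z e \<and> butlast q \<noteq> [] \<and> last q \<in> PU U \<and> set (butlast q) \<inter> PU U = {}"
    if e: "e \<in> J1" and q: "q \<in> Q e" for e q
  proof -
    have e0: "e \<in> J0" using e J10 by blast
    note q1 = Q1[OF e0 q]
    have dq: "distinct q" using q1(1) by (simp add: is_path_def)
    have lq: "last q \<in> PU U" using centre[OF XY(4,2)[OF e0]] q1(6) by blast
    have qd: "q = butlast q @ [last q]" using q1(2) by simp
    have bl: "set (butlast q) = set q - {last q}"
    proof -
      have "distinct (butlast q @ [last q])" using dq qd by simp
      then have "last q \<notin> set (butlast q)" by simp
      moreover have "set q = set (butlast q) \<union> {last q}" using qd by (metis set_append list.set(1) list.set(2))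
      ultimately show ?thesis by blast
    qed
    have bZ: "set (butlast q) \<subseteq> Z e" unfolding bl Z_def using q1(5,7) q by blast
    have "i \<ge> length q - 1" if i: "i < length q" "q ! i \<in> PU U" for i
    proof -
      define m where "m = (LEAST i. i < length q \<and> q ! i \<in> PU U)"
      have m: "m < length q \<and> q ! m \<in> PU U" unfolding m_def by (rule LeastI[of _ i]) (use i in simp)
      have mi: "m \<le> i" unfolding m_def by (rule Least_le) (use i in simp)
      have "q ! 0 = hd q" using q1(2) by (simp add: hd_conv_nth)
      then have "m \<noteq> 0" using m yU[OF e] q1(5) by (metis disjoint_iff)
      then obtain m' where m': "m = Suc m'" by (cases m) auto
      then have "q ! m' \<notin> PU U" using not_less_Least[of m' "\<lambda>i. i < length q \<and> q ! i \<in> PU U"] m unfolding m_def[symmetric] by simp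
      moreover have "(q ! m', q ! m) \<in> E'" using q1(1) m m' by (simp add: is_path_def)
      ultimately have "q ! m \<in> old ` U" using PU_boundary[OF clU] m by blast
      then have "q ! m \<notin> Z e" using e by (auto simp: J1_def)
      then have "q ! m \<notin> set (butlast q)" using bZ by blast
      then have "\<not> m < length (butlast q)" using nth_mem[of m "butlast q"] nth_butlast[of m q] by auto
      then show ?thesis using mi by simp
    qed
    then have bU: "set (butlast q) \<inter> PU U = {}"
    proof -
      assume a: "\<And>i. i < length q \<Longrightarrow> q ! i \<in> PU U \<Longrightarrow> i \<ge> length q - 1"
      have "z \<notin> PU U" if zq: "z \<in> set (butlast q)" for z
      proof
        assume zU: "z \<in> PU U"
        obtain i where i: "i < length (butlast q)" "butlast q ! i = z" using zq by (auto simp only: in_set_conv_nth)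
        then have "q ! i = z" "i < length q - 1" using nth_butlast[OF i(1)] by auto
        moreover then have "i < length q" by linarith
        ultimately show False using a[of i] zU by simp
      qed
      then show ?thesis by blast
    qed
    have "butlast q \<noteq> []" using q1(8) by (cases q rule: rev_cases) auto
    with bZ lq bU show ?thesis by simp
  qed
  have ZU: "Z e \<inter> PU U = {}" if e: "e \<in> J1" for e
  proof -
    have e0: "e \<in> J0" using e J10 by blast
    have "inner q \<inter> PU U = {}" if q: "q \<in> Q e" for q
    proof -
      have "inner q \<subseteq> set (butlast q)" unfolding inner_def by (cases q) (auto dest: in_set_butlastD)
      then show ?thesis using Qq[OF e q] by blast
    qed
    then show ?thesis using yU[OF e] unfolding Z_def by blast
  qed
  have att: "\<exists>z u. conn E' (Z e) a z \<and> (z, u) \<in> E' \<and> u \<in> PU U" if e: "e \<in> J1" and a: "a \<in> Z e" for e a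
  proof -
    have e0: "e \<in> J0" using e J10 by blast
    have along: "\<exists>z u. conn E' (Z e) b z \<and> (z, u) \<in> E' \<and> u \<in> PU U" if q: "q \<in> Q e" and b: "b \<in> set (butlast q)" for q b
    proof -
      note qq = Qq[OF e q] and q1 = Q1[OF e0 q]
      note pb = is_path_butlast[OF q1(1) qq[THEN conjunct2, THEN conjunct1]]
      have "last (butlast q) \<in> set (butlast q)" using qq by simp
      then have "conn E' (Z e) b (last (butlast q))" using conn_path[OF sym_E' pb(1) _ b] qq by blast
      moreover note pb(2)
      ultimately show ?thesis using qq by blast
    qed
    consider "a \<in> range (y e)" | q where "q \<in> Q e" "a \<in> inner q" using a by (auto simp: Z_def)
    then show ?thesis
    proof cases
      case 1
      obtain q where q: "q \<in> Q e" using infQ[OF e0] by (metis ex_in_conv infinite_imp_nonempty)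
      note qq = Qq[OF e q] and q1 = Q1[OF e0 q]
      obtain i j where ij: "a = y e i" "hd q = y e j" using 1 q1(5) by blast
      have h: "hd (butlast q) = hd q" using qq by (metis append_butlast_last_id hd_append2 q1(2))
      have "hd q \<in> set (butlast q)" using qq h hd_in_set[of "butlast q"] by simp
      from along[OF q this] obtain z u where zu: "conn E' (Z e) (hd q) z" "(z, u) \<in> E'" "u \<in> PU U" by blast
      have "conn E' (Z e) (y e i) (y e j)"
        by (rule conn_ray[OF sym_E' ray[OF XY(5)[OF e0]], of 0]) (auto simp: Z_def)
      then have "conn E' (Z e) a z" using conn_trans zu(1) ij by metis
      then show ?thesis using zu by blast
    next
      case 2
      have "inner q \<subseteq> set (butlast q)" unfolding inner_def by (cases q) (auto dest: in_set_butlastD)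
      then show ?thesis using along[OF 2(1)] 2(2) by blast
    qed
  qed
  define ZG where "ZG e = (\<Union>x\<in>Z e. cl (pi x))" for e
  have cZG: "countable (ZG e)" if "e \<in> J1" for e
    unfolding ZG_def by (rule countable_UN) (use cZ J10 that cl_countable in auto)
  \<comment> \<open>Territories over a common \<open>v\<close> need not meet upstairs, but each of
    them meets the countable set of old copies of \<open>cl v\<close>: otherwise its part over that
    class would be trapped in one new ray and could not reach \<open>PU U\<close>, whose boundary
    consists of old edges. Disjoint territories do this only countably often.\<close>
  have cnt: "countable {e \<in> J1. v \<in> ZG e}" for v
  proof (rule countable_subset)
    show "countable {e \<in> J0. Z e \<inter> old ` cl v \<noteq> {}}"
      by (rule disjoint_family_meet_countable[OF Zdj]) (auto intro: countable_image cl_countable)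
    show "{e \<in> J1. v \<in> ZG e} \<subseteq> {e \<in> J0. Z e \<inter> old ` cl v \<noteq> {}}"
    proof
      fix e assume "e \<in> {e \<in> J1. v \<in> ZG e}"
      then obtain a where e: "e \<in> J1" and a: "a \<in> Z e" "v \<in> cl (pi a)" by (auto simp: ZG_def)
      have e0: "e \<in> J0" using e J10 by blast
      have cv: "cl v = cl (pi a)" by (rule cl_eq[OF a(2)])
      have aV: "a \<in> V'" using ZV[OF e0] a(1) by blast
      have aU: "pi a \<notin> U" using ZU[OF e] a(1) aV by (auto simp: PU_def)
      have "Z e \<inter> old ` cl v \<noteq> {}"
      proof
        assume emp: "Z e \<inter> old ` cl v = {}"
        from aV show False
        proof (cases rule: V'_cases)
          case (1 w)
          then have "a \<in> old ` cl v" using cv cl_self[of w] by (simp add: pi_old)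
          then show False using emp a(1) by blast
        next
          case (2 l n)
          have clv: "cl v = range (R (c l))" using cv 2 cl_R[OF c_K[OF 2(1)]] by (simp add: pi_T)
          obtain z u where zu: "conn E' (Z e) a z" "(z, u) \<in> E'" "u \<in> PU U" using att[OF e a(1)] by blast
          have "conn E' (Z e \<inter> range (T l)) a z"
          proof (rule conn_closed[OF zu(1)])
            show "a \<in> range (T l)" using 2 by simp
            fix b d assume bd: "(b, d) \<in> E'" "b \<in> range (T l) \<inter> Z e" "d \<in> Z e"
            then have "b \<in> range (T l)" by simp
            from T_neighbours[OF bd(1) this] show "d \<in> range (T l)"
            proof
              assume "\<exists>n. b = T l n \<and> d = old (R (c l) n)"
              then have "d \<in> old ` cl v" using clv by auto
              then show ?thesis using bd(3) emp by (metis disjoint_iff)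
            qed
          qed
          from conn_mem(2)[OF this] have zT: "z \<in> range (T l)" "z \<in> Z e" by simp_all
          then have "z \<notin> PU U" using ZU[OF e] by (metis disjoint_iff)
          then obtain w where "z = old w" using PU_boundary[OF clU zu(2) _ zu(3)] by blast
          then show False using zT(1) old_T by auto
        qed
      qed
      then show "e \<in> {e \<in> J0. Z e \<inter> old ` cl v \<noteq> {}}" using e0 by simp
    qed
  qed
  have uJ1: "uncountable J1" by (rule uncountable_ordIso[OF J1K K(3)])
  obtain J2 where J2: "J2 \<subseteq> J1" "|J2| =o |J1|" "\<forall>i\<in>J2. \<forall>j\<in>J2. i \<noteq> j \<longrightarrow> ZG i \<inter> ZG j = {}"
    using large_disjoint_subfamily[of J1 ZG, OF uJ1 _ cnt] cZG by auto
  have uJ2: "uncountable J2" by (rule uncountable_ordIso[OF J2(2) uJ1])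
  have "\<forall>e\<in>J2. \<exists>N. N \<in> \<epsilon> \<and> range N \<subseteq> ZG e \<and> (\<forall>X. finite X \<longrightarrow>
    (\<exists>a\<in>range N. \<exists>z. \<exists>u\<in>U - X. conn E (ZG e - X) a z \<and> (z, u) \<in> E))"
  proof
    fix e assume "e \<in> J2"
    then have e: "e \<in> J1" and e0: "e \<in> J0" using J2(1) J10 by blast+
    have "equiv_rays V' E' (\<lambda>n. old (R k0 n)) (y e)" using \<R>(1) XY(5)[OF e0] by blast
    then have eq: "equiv_rays V' E' (y e) (\<lambda>n. old (R k0 n))" by (rule equiv_rays_sym[OF sym_E'])
    show "\<exists>N. N \<in> \<epsilon> \<and> range N \<subseteq> ZG e \<and> (\<forall>X. finite X \<longrightarrow>
      (\<exists>a\<in>range N. \<exists>z. \<exists>u\<in>U - X. conn E (ZG e - X) a z \<and> (z, u) \<in> E))"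
      unfolding ZG_def
    proof (rule project_comb[OF K(4) ray[OF XY(5)[OF e0]] eq clU _ ZV[OF e0] ZU[OF e] infQ[OF e0] djQ[OF e0]])
      show "range (y e) \<subseteq> Z e" by (auto simp: Z_def)
      fix q assume q: "q \<in> Q e"
      show "is_path V' E' q" "hd q \<in> range (y e)" using Q1[OF e0 q] by simp_all
      show "set (butlast q) \<subseteq> Z e" "butlast q \<noteq> []" "last q \<in> PU U" using Qq[OF e q] by simp_all
    qed
  qed
  from bchoice[OF this] obtain N where N: "\<forall>e\<in>J2. N e \<in> \<epsilon> \<and> range (N e) \<subseteq> ZG e \<and> (\<forall>X. finite X \<longrightarrow>
    (\<exists>a\<in>range (N e). \<exists>z. \<exists>u\<in>U - X. conn E (ZG e - X) a z \<and> (z, u) \<in> E))" ..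
  have "has_connected_ray_graph V E \<epsilon> |J2|"
  proof (rule star_over_countable_set[OF G uJ2 cU])
    fix e assume e: "e \<in> J2"
    show "N e \<in> \<epsilon>" "range (N e) \<subseteq> ZG e" using bspec[OF N e] by simp_all
    show "ZG e \<subseteq> V" unfolding ZG_def using ZV J2(1) J10 e cl_V pi_V by blast
    fix X :: "'a set" assume "finite X"
    then show "\<exists>a\<in>range (N e). \<exists>z. \<exists>u\<in>U - X. conn E (ZG e - X) a z \<and> (z, u) \<in> E" using bspec[OF N e] by simp
  next
    fix i j assume "i \<in> J2" "j \<in> J2" "i \<noteq> j"
    then show "ZG i \<inter> ZG j = {}" using J2(3) by simp
  qed
  then obtain \<S> H' where S: "\<S> \<subseteq> \<epsilon>" "disjoint_rays \<S>" "|\<S>| =o |J2|" "is_ray_graph V E \<S> H'" "connected_graph \<S> H'"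
    unfolding has_connected_ray_graph_def by (elim exE conjE) (rule that)
  have "|\<S>| =o |K|" by (rule ordIso_transitive[OF S(3) ordIso_transitive[OF J2(2) J1K]])
  then show ?thesis unfolding has_connected_ray_graph_def using S by (intro exI[of _ \<S>] exI[of _ H']) simp
qed

text \<open>The rays \<open>T l\<close> show that the degree is at least \<open>|L|\<close>, and
  \<open>|V'|\<close> bounds it from above; a connected ray graph of that size would project to
  \<open>G\<close>.\<close>

lemma thick_counterexample:
  assumes K: "Cinfinite |K|" "regularCard |K|" "uncountable K" "k0 \<in> K"
    and c_small: "\<And>A. A \<subseteq> L \<Longrightarrow> |c ` A| <o |K| \<Longrightarrow> |A| <o |L|" and KL: "|K| \<le>o |L|" and VK: "|V| \<le>o |K|"
    and nex: "\<not> has_connected_ray_graph V E \<epsilon> |K|"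
  shows "HC_counterexample V' E' {S. is_ray V' E' S \<and> equiv_rays V' E' (\<lambda>n. old (R k0 n)) S} |L|"
proof -
  let ?e = "{S. is_ray V' E' S \<and> equiv_rays V' E' (\<lambda>n. old (R k0 n)) S}"
  have infL: "infinite L" using K(3) KL countable_ordLeq countable_finite by blast
  have "is_end V' E' ?e" unfolding is_end_def using old_ray[OF R_ray[OF K(4)]] by blast
  moreover have "end_degree V' E' ?e |L|" unfolding end_degree_def
  proof (intro conjI allI impI)
    have T_dj: "range (T l) \<inter> range (T m) = {}" if "l \<noteq> m" for l m using T_eq that by blast
    have "inj_on T L" by (rule inj_onI) (metis T_eq)
    then have "|T ` L| =o |L|" using card_of_ordIsoI[OF inj_on_imp_bij_betw] ordIso_symmetric by blast
    moreover have "disjoint_rays (T ` L)" unfolding disjoint_rays_def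
    proof (intro ballI impI)
      fix S S' assume "S \<in> T ` L" "S' \<in> T ` L" "S \<noteq> S'"
      then obtain l m where "S = T l" "S' = T m" "l \<noteq> m" by blast
      then show "range S \<inter> range S' = {}" using T_dj by simp
    qed
    moreover have "T ` L \<subseteq> ?e" using T_ray T_equiv[OF _ K(4)] by blast
    ultimately show "\<exists>\<R>\<subseteq>?e. disjoint_rays \<R> \<and> |\<R>| =o |L|" by (intro exI[of _ "T ` L"] conjI)
    have "|V'| \<le>o |L|"
    proof -
      have 1: "|old ` V| \<le>o |L|"
        by (rule ordLeq_transitive[OF card_of_image ordLeq_transitive[OF VK KL]])
      have 2: "|\<Union>l\<in>L. range (T l)| \<le>o |L|"
      proof (rule card_of_UNION_ordLeq_infinite[OF infL card_of_mono1[OF order_refl]], rule ballI)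
        fix l
        have "countable (range (T l))" by simp
        then show "|range (T l)| \<le>o |L|" using infL by (meson countable_card_le_natLeq infinite_iff_natLeq_ordLeq ordLeq_transitive)
      qed
      have "V' = old ` V \<union> (\<Union>l\<in>L. range (T l))" by (auto simp: V'_def)
      moreover have "|old ` V \<union> (\<Union>l\<in>L. range (T l))| \<le>o |L|"
        using infL by (intro card_of_Un_ordLeq_infinite_Field 1 2 card_of_Card_order) (simp add: Field_card_of)
      ultimately show ?thesis by simp
    qed
    moreover fix \<S> assume S: "\<S> \<subseteq> ?e \<and> disjoint_rays \<S>"
    have "|\<S>| \<le>o |V'|" by (rule disjoint_rays_card[of _ V' E']) (use S in auto)
    ultimately show "|\<S>| \<le>o |L|" using ordLeq_transitive by blast
  qed
  moreover have "\<not> has_connected_ray_graph V' E' ?e |L|"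
  proof
    assume "has_connected_ray_graph V' E' ?e |L|"
    then obtain \<R> H where "\<R> \<subseteq> ?e" "disjoint_rays \<R>" "|\<R>| =o |L|" "is_ray_graph V' E' \<R> H" "connected_graph \<R> H"
      unfolding has_connected_ray_graph_def by (elim exE conjE) (rule that)
    from witness_projects[OF K c_small KL this] nex show False by (rule notE[rotated])
  qed
  ultimately show ?thesis using graph' by (simp add: HC_counterexample_iff)
qed

end

section \<open>The index map from cofinality, and the conclusion\<close>

text \<open>Send \<open>l\<close> to a strictly larger element of a smallest cofinal set, identified
  with \<open>K\<close>. If \<open>A\<close> uses fewer than \<open>|K|\<close> such bounds, they
  are not cofinal, so \<open>A\<close> lies in a proper initial segment of the cardinal order
  \<open>|L|\<close>, and these are smaller than \<open>|L|\<close>.\<close>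

lemma cofinality_map:
  fixes K :: "'k set" and L :: "'l set"
  assumes "cf_eq L K"
  shows "\<exists>c. (\<forall>l\<in>L. c l \<in> K) \<and> (\<forall>A\<subseteq>L. |c ` A| <o |K| \<longrightarrow> |A| <o |L| ) \<and> |K| \<le>o |L|"
proof -
  obtain A0 where A0: "A0 \<subseteq> L" "cofinal A0 |L|" "|A0| =o |K|" and min: "\<And>A. A \<subseteq> L \<Longrightarrow> cofinal A |L| \<Longrightarrow> |K| \<le>o |A|"
    using assms by (auto simp: cf_eq_def)
  obtain h where h: "bij_betw h A0 K" using A0(3) card_of_ordIso by blast
  have KL: "|K| \<le>o |L|" using A0(3) card_of_mono1[OF A0(1)] ordIso_ordLeq_trans ordIso_symmetric by blast
  have "\<forall>l\<in>L. \<exists>b. b \<in> A0 \<and> l \<noteq> b \<and> (l, b) \<in> |L|" using A0(2) by (auto simp: cofinal_def Field_card_of)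
  from bchoice[OF this] obtain b where b: "\<forall>l\<in>L. b l \<in> A0 \<and> l \<noteq> b l \<and> (l, b l) \<in> |L|" ..
  have wo: "Well_order |L|" by (rule card_of_Well_order)
  have tr: "trans |L|" and an: "antisym |L|" and tot: "total_on L |L|"
    using wo by (auto simp: well_order_on_def linear_order_on_def partial_order_on_def preorder_on_def Field_card_of)
  have "|A| <o |L|" if A: "A \<subseteq> L" and small: "|(\<lambda>l. h (b l)) ` A| <o |K|" for A
  proof -
    have bA: "b ` A \<subseteq> A0" using b A by blast
    have "inj_on h (b ` A)" using h bA by (meson bij_betw_def inj_on_subset)
    then have "|b ` A| \<le>o |(\<lambda>l. h (b l)) ` A|" by (rule card_of_ordLeqI) auto
    then have "|b ` A| <o |K|" using small ordLeq_ordLess_trans by blast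
    then have "\<not> |K| \<le>o |b ` A|" using not_ordLess_ordLeq by blast
    then have "\<not> cofinal (b ` A) |L|" using min bA A0(1) by blast
    then obtain a where a: "a \<in> L" "\<And>l. l \<in> A \<Longrightarrow> a = b l \<or> (a, b l) \<notin> |L|" by (auto simp: cofinal_def Field_card_of)
    have "A \<subseteq> underS |L| a"
    proof
      fix l assume l: "l \<in> A"
      have bl: "b l \<in> L" "l \<noteq> b l" "(l, b l) \<in> |L|" using b l A A0(1) by auto
      have "a = b l \<or> (b l, a) \<in> |L|" using a(2)[OF l] tot a(1) bl(1) by (auto simp: total_on_def)
      then have "(l, a) \<in> |L|" using bl(3) tr by (auto dest: transD)
      moreover have "l \<noteq> a" using a(2)[OF l] bl by blast
      ultimately show "l \<in> underS |L| a" by (simp add: underS_def)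
    qed
    then have "|A| \<le>o |underS |L| a|" by (rule card_of_mono1)
    moreover have "|underS |L| a| <o |L|" by (rule card_of_underS[OF card_of_Card_order]) (simp add: Field_card_of a(1))
    ultimately show ?thesis by (rule ordLeq_ordLess_trans)
  qed
  moreover have "\<forall>l\<in>L. h (b l) \<in> K" using b h by (auto simp: bij_betw_def)
  ultimately show ?thesis using KL by (intro exI[of _ "\<lambda>l. h (b l)"]) blast
qed

theorem theorem9p1:
  fixes K :: "'k set" and V :: "'a set" and E :: "('a \<times> 'a) set"
    and \<epsilon> :: "(nat \<Rightarrow> 'a) set" and L :: "'l set"
  assumes "Cinfinite (card_of K)" and "regularCard (card_of K)"
    and "HC_counterexample V E \<epsilon> (card_of K)"
    and "cf_eq L K"
  shows "\<exists>(V' :: ('a \<times> 'l) set set) E' \<epsilon>'. HC_counterexample V' E' \<epsilon>' (card_of L)"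
proof -
  have infK: "infinite K" using assms(1) by (simp add: cinfinite_def Field_card_of)
  have unc: "uncountable K"
  proof
    assume cK: "countable K"
    have hc: "graph V E" "is_end V E \<epsilon>" "end_degree V E \<epsilon> |K|" using assms(3) by (simp_all add: HC_counterexample_iff)
    obtain \<D> where D: "\<D> \<subseteq> \<epsilon>" "disjoint_rays \<D>" "|\<D>| =o |K|" using hc(3) by (auto simp: end_degree_def)
    have "infinite \<D>" using card_of_ordIso_finite[OF D(3)] infK by simp
    from halin_countable[OF hc(1,2) D(1) this D(2)] obtain \<R> H where
      R: "\<R> \<subseteq> \<epsilon>" "disjoint_rays \<R>" "infinite \<R>" "countable \<R>" "is_ray_graph V E \<R> H" "connected_graph \<R> H"
      by (elim exE conjE) (rule that)
    have "|\<R>| \<le>o |K|" "|K| \<le>o |\<R>|"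
      using R(3,4) infK cK by (meson countable_card_le_natLeq infinite_iff_natLeq_ordLeq ordLeq_transitive)+
    then have "|\<R>| =o |K|" by (simp add: ordIso_iff_ordLeq)
    then have "has_connected_ray_graph V E \<epsilon> |K|" unfolding has_connected_ray_graph_def
      using R by (intro exI[of _ \<R>] exI[of _ H]) simp
    then show False using assms(3) by (simp add: HC_counterexample_iff)
  qed
  obtain V0 :: "'a set" and E0 \<epsilon>0 where hc: "HC_counterexample V0 E0 \<epsilon>0 |K|" and VK: "|V0| \<le>o |K|"
    using HC_counterexample_small[OF assms(3) infK] by (elim exE conjE) (rule that)
  have G: "graph V0 E0" "is_end V0 E0 \<epsilon>0" and deg: "end_degree V0 E0 \<epsilon>0 |K|"
    and nex: "\<not> has_connected_ray_graph V0 E0 \<epsilon>0 |K|"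
    using hc by (simp_all add: HC_counterexample_iff)
  obtain \<D> where D: "\<D> \<subseteq> \<epsilon>0" "disjoint_rays \<D>" "|\<D>| =o |K|" using deg by (auto simp: end_degree_def)
  then obtain R where R: "bij_betw R K \<D>" using card_of_ordIso ordIso_symmetric by blast
  obtain c where c: "\<forall>l\<in>L. c l \<in> K" "\<forall>A\<subseteq>L. |c ` A| <o |K| \<longrightarrow> |A| <o |L|" and KL: "|K| \<le>o |L|"
    using cofinality_map[OF assms(4)] by (elim exE conjE) (rule that)
  have "infinite L" using unc countable_ordLeq[OF KL] countable_finite by blast
  then have infU: "infinite (UNIV :: 'l set)" by (metis finite_subset subset_UNIV)
  \<comment> \<open>Both kinds of vertices are coded as sets of pairs: a full fibre over
    \<open>v\<close> for an old vertex, a singleton for a new one. They differ because the type of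
    labels is infinite, and \<open>pi\<close> reads off the common first coordinate.\<close>
  define old :: "'a \<Rightarrow> ('a \<times> 'l) set" where "old v = {v} \<times> UNIV" for v
  define new :: "'a \<Rightarrow> 'l \<Rightarrow> ('a \<times> 'l) set" where "new v l = {(v, l)}" for v l
  define pi :: "('a \<times> 'l) set \<Rightarrow> 'a" where "pi x = the_elem (fst ` x)" for x
  interpret thickening V0 E0 \<epsilon>0 K R L c old new pi
  proof
    show "graph V0 E0" "is_end V0 E0 \<epsilon>0" by fact+
    show "R k \<in> \<epsilon>0" if "k \<in> K" for k using R D(1) that by (auto simp: bij_betw_def)
    show "range (R i) \<inter> range (R j) = {}" if "i \<in> K" "j \<in> K" "i \<noteq> j" for i j
    proof -
      have "R i \<in> \<D>" "R j \<in> \<D>" "R i \<noteq> R j" using R that by (auto simp: bij_betw_def inj_on_def)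
      then show ?thesis using D(2) by (simp add: disjoint_rays_def)
    qed
    show "c l \<in> K" if "l \<in> L" for l using c(1) that by blast
    show "pi (old v) = v" for v by (simp add: pi_def old_def)
    show "pi (new v l) = v" for v l by (simp add: pi_def new_def)
    show "old v \<noteq> new w l" for v w l
    proof
      assume "old v = new w l"
      then have "finite ({v} \<times> (UNIV :: 'l set))" by (simp add: old_def new_def)
      then show False using infU by (auto dest: finite_cartesian_productD2)
    qed
    show "l = m" if "new v l = new w m" for v w l m using that by (simp add: new_def)
  qed
  obtain k0 where k0: "k0 \<in> K" using infK by (metis ex_in_conv infinite_imp_nonempty)
  have "|A| <o |L|" if "A \<subseteq> L" "|c ` A| <o |K|" for A using c(2) that by blast
  from thick_counterexample[OF assms(1,2) unc k0 this KL VK nex] show ?thesis by blast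
qed

end
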